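(* Let $n,k$ be integers with $1\le k\le n/2$, let $\alpha=n-k$, let $r\in\{0,1,\dots,k-1\}$ satisfy $n+1\equiv r\pmod k$, let $n_0=3k^2-k-1-(k-1)r$, and suppose $n\ge n_0$. Put $\ell_{n,k}=\frac{n-n_0}{k}$ (an integer). Then a graph $T^*$ is a minimizer graph of $\mathbb{G}^k_{n,\alpha}$ if and only if there exists a minimizer graph $T_{n_0}$ of $\mathbb{G}^k_{n_0,n_0-k}$ such that $T^*=T_{n_0}\circ \ell_{n,k}\mathbf{1}_{V_2^*}$, where $V_2^*$ is the set of even vertices of $T_{n_0}$. In that case $\rho(T^* )=\sqrt{\rho^2(T_{n_0})+\ell_{n,k}}$.
   Context: Graphs are finite and simple; $\rho(G)$ is the spectral radius (largest adjacency eigenvalue), $\alpha(G)$ the independence number. $\mathbb{G}_{n,\alpha}$ is the set of connected graphs on $n$ vertices with independence number $\alpha$, and $\mathbb{G}^k_{n,\alpha}$ denotes $\mathbb{G}_{n,\alpha}$ with $k=n-\alpha$. A minimizer graph of $\mathbb{G}_{n,\alpha}$ is a graph in it of minimum spectral radius. For $\alpha\ge\lceil n/2\rceil$ every minimizer graph is a tree. For a tree $T$: if $T$ is not a path with an even number of vertices, $L(T)$ is its set of leaves; if $T=P_{2t}=v_1\cdots v_{2t}$ then $L(T)=\{v_1\}$. $D_m$ ($m$ even) is obtained from a path $w_1\cdots w_{m-2}$ by attaching two new pendant vertices to $w_1$. For a tree $T$ not isomorphic to a path or to $D_m$, a vertex $v$ is a control vertex if $d(v)\ge3$ and at least $d(v)-1$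 components of $T-v$ are paths; for $P_{2t+1}=v_1\cdots v_{2t+1}$ the control vertices are $v_2,v_{2t}$, for $P_{2t}=v_1\cdots v_{2t}$ they are $v_2,v_{2t}$, for $D_m$ they are $w_1,w_{m-3}$. A control path is a path whose ends are control vertices (a single vertex if there is only one control vertex). In a minimizer tree $T$ (with $\alpha\ge\lceil n/2\rceil$) every vertex $x\notin L(T)$ lies on a control path $v_0\cdots v_q$, and $x$ is even if $x=v_i$ with $i$ even (independent of the path chosen); these are the even vertices. For a graph $G$, $U\subseteq V(G)$ and an integer $\ell\ge0$, $G\circ\ell\mathbf{1}_U$ is the graph obtained from $G$ by attaching $\ell$ new pendant vertices to each vertex of $U$.
   Formalization: For k=1 one has n_0=1, and the class of connected graphs with 1 vertex and independence number 0 is empty, so the claim fails literally; here that class is taken to be the one-vertex graphs, whose vertex counts as a control (hence even) vertex. For k≥2 nothing is changed. *)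

theory Defs
  imports
    "Graph_Theory.Graph_Theory"
    "Jordan_Normal_Form.Spectral_Radius"
    "HOL-Number_Theory.Cong"
begin

text \<open>
  Finite simple graphs are symmetric, loop-free, finite pair digraphs
  (locale predicate \<^const>\<open>pair_graph\<close>): an edge \<open>uv\<close> is the pair of arcs
  \<open>(u, v)\<close>, \<open>(v, u)\<close>, and the degree of a vertex is its \<^const>\<open>out_degree\<close>.
\<close>

definition adjacency_matrix :: "'a pair_pre_digraph \<Rightarrow> 'a list \<Rightarrow> real mat" where
  "adjacency_matrix G vs =
     mat (length vs) (length vs) (\<lambda>(i, j). if (vs ! i, vs ! j) \<in> parcs G then 1 else 0)"

text \<open>The spectrum does not depend on the chosen ordering of the vertices.\<close>

definition graph_spectral_radius :: "'a pair_pre_digraph \<Rightarrow> real" where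
  "graph_spectral_radius G =
     Max (spectrum (adjacency_matrix G (SOME vs. distinct vs \<and> set vs = pverts G)))"

definition independent_set :: "'a pair_pre_digraph \<Rightarrow> 'a set \<Rightarrow> bool" where
  "independent_set G S \<longleftrightarrow> S \<subseteq> pverts G \<and> (\<forall>u\<in>S. \<forall>v\<in>S. (u, v) \<notin> parcs G)"

definition independence_number :: "'a pair_pre_digraph \<Rightarrow> nat" where
  "independence_number G = Max (card ` {S. independent_set G S})"

definition conn_graphs :: "nat \<Rightarrow> nat \<Rightarrow> 'a pair_pre_digraph set" where
  "conn_graphs n \<alpha> =
     {G. pair_graph G \<and> Digraph_Component.connected (with_proj G) \<and>
         card (pverts G) = n \<and> independence_number G = \<alpha>}"

text \<open>
  The class \<open>\<bbbG>\<^sup>k\<^bsub>n,\<alpha>\<^esub>\<close> is \<open>\<bbbG>\<^bsub>n,\<alpha>\<^esub>\<close> with \<open>k = n - \<alpha>\<close>. There is one convention: for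
  \<open>k = 1\<close> the theorem has \<open>n\<^sub>0 = 1\<close> and so refers to \<open>\<bbbG>\<^sup>1\<^bsub>1,0\<^esub>\<close>. Read literally this class is
  empty (see \<open>conn_graphs_1_0\<close>), and the equivalence would fail for every star
  \<open>K\<^bsub>1,n-1\<^esub>\<close>. The intended seed graph is the single vertex \<open>P\<^sub>1\<close>, whose only vertex is even
  and which yields the stars by attaching pendant vertices; so \<open>\<bbbG>\<^sup>1\<^bsub>1,0\<^esub>\<close> is taken to
  consist of the one-vertex graphs. No other class is affected.
\<close>

definition conn_graphs_k :: "nat \<Rightarrow> nat \<Rightarrow> nat \<Rightarrow> 'a pair_pre_digraph set" where
  "conn_graphs_k k n \<alpha> =
     (if k = 1 \<and> n = 1 \<and> \<alpha> = 0 then {G. pair_graph G \<and> card (pverts G) = 1}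
      else {G \<in> conn_graphs n \<alpha>. k + \<alpha> = n})"

lemma conn_graphs_1_0: "conn_graphs 1 0 = {}"
proof (rule equals0I)
  fix G :: "'a pair_pre_digraph"
  assume "G \<in> conn_graphs 1 0"
  then have G: "pair_graph G" and c: "card (pverts G) = 1" and i: "independence_number G = 0"
    by (auto simp: conn_graphs_def)
  from c obtain v where v: "pverts G = {v}" by (auto simp: card_1_singleton_iff)
  have nl: "(v, v) \<notin> parcs G"
    using pair_loopfree_digraph.pair_no_loops[of G "(v, v)"] G
    by (auto simp: pair_graph_def pair_digraph_def)
  have "finite {S. independent_set G S}"
    by (rule finite_subset[of _ "Pow {v}"]) (auto simp: independent_set_def v)
  moreover have "independent_set G {v}" by (simp add: independent_set_def v nl)
  ultimately have "card {v} \<le> independence_number G"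
    unfolding independence_number_def by (intro Max_ge imageI finite_imageI) auto
  with i show False by simp
qed

definition minimizer_graph :: "nat \<Rightarrow> nat \<Rightarrow> nat \<Rightarrow> 'a pair_pre_digraph \<Rightarrow> bool" where
  "minimizer_graph k n \<alpha> G \<longleftrightarrow>
     G \<in> conn_graphs_k k n \<alpha> \<and>
     (\<forall>H \<in> (conn_graphs_k k n \<alpha> :: 'a pair_pre_digraph set).
        graph_spectral_radius G \<le> graph_spectral_radius H)"

text \<open>\<open>path_labelling G [v\<^sub>1, \<dots>, v\<^sub>m]\<close>: the graph \<open>G\<close> is the path \<open>P\<^sub>m = v\<^sub>1 \<dots> v\<^sub>m\<close>.\<close>

definition path_labelling :: "('a, 'b) pre_digraph \<Rightarrow> 'a list \<Rightarrow> bool" where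
  "path_labelling G vs \<longleftrightarrow>
     vs \<noteq> [] \<and> distinct vs \<and> verts G = set vs \<and>
     arcs_ends G = set (vwalk_arcs vs) \<union> (set (vwalk_arcs vs))\<inverse>"

definition is_path_graph :: "('a, 'b) pre_digraph \<Rightarrow> bool" where
  "is_path_graph G \<longleftrightarrow> (\<exists>vs. path_labelling G vs)"

text \<open>
  \<open>D_labelling G [w\<^sub>1, \<dots>, w\<^bsub>m-2\<^esub>]\<close>: the graph \<open>G\<close> is \<open>D\<^sub>m\<close> (\<open>m \<ge> 4\<close> even), with \<open>a\<close> and \<open>b\<close> the two
  pendant vertices attached to \<open>w\<^sub>1\<close>.
\<close>

definition D_labelling :: "('a, 'b) pre_digraph \<Rightarrow> 'a list \<Rightarrow> bool" where
  "D_labelling G ws \<longleftrightarrow>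
     ws \<noteq> [] \<and> even (length ws) \<and>
     (\<exists>a b. distinct (a # b # ws) \<and> verts G = {a, b} \<union> set ws \<and>
        (let E = set (vwalk_arcs ws) \<union> {(hd ws, a), (hd ws, b)} in arcs_ends G = E \<union> E\<inverse>))"

definition is_D_graph :: "('a, 'b) pre_digraph \<Rightarrow> bool" where
  "is_D_graph G \<longleftrightarrow> (\<exists>ws. D_labelling G ws)"

text \<open>
  For an even path the set \<open>L(T)\<close> depends on which end is called \<open>v\<^sub>1\<close>; one labelling
  is fixed here and used for \<open>L(T)\<close> and for the control vertices alike.
\<close>

definition the_path_labelling :: "('a, 'b) pre_digraph \<Rightarrow> 'a list" where
  "the_path_labelling T = (SOME vs. path_labelling T vs)"

definition leaf_set :: "('a, 'b) pre_digraph \<Rightarrow> 'a set" where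
  "leaf_set T =
     (if is_path_graph T \<and> even (card (verts T)) then {hd (the_path_labelling T)}
      else {v \<in> verts T. out_degree T v = 1})"

text \<open>
  Lists are indexed from \<open>0\<close>. For \<open>P\<^bsub>2t\<^esub>\<close> and \<open>P\<^bsub>2t+1\<^esub>\<close> the control vertices \<open>v\<^sub>2\<close>, \<open>v\<^bsub>2t\<^esub>\<close> are the
  entries \<open>1\<close> and \<open>2t - 1\<close>; for \<open>D\<^sub>m\<close> the list \<open>ws\<close> has length \<open>m - 2\<close>, and \<open>w\<^bsub>m-3\<^esub>\<close> is its entry \<open>m - 4\<close>.
  \<open>P\<^sub>1\<close> has no \<open>v\<^sub>2\<close>; its vertex is not a leaf, so it must lie on a control path and
  hence is the control vertex.
  The components of \<open>T - v\<close> are the (strong) components of a symmetric digraph.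
\<close>

definition control_vertices :: "('a, 'b) pre_digraph \<Rightarrow> 'a set" where
  "control_vertices T =
     (if is_path_graph T then
        (let vs = the_path_labelling T; t = length vs div 2
         in if t = 0 then set vs else {vs ! 1, vs ! (2 * t - 1)})
      else if is_D_graph T then
        (let ws = (SOME ws. D_labelling T ws) in {ws ! 0, ws ! (length ws - 2)})
      else
        {v \<in> verts T. out_degree T v \<ge> 3 \<and>
           card {C \<in> pre_digraph.sccs (pre_digraph.del_vert T v). is_path_graph C}
             \<ge> out_degree T v - 1})"

definition control_path :: "('a, 'b) pre_digraph \<Rightarrow> 'a list \<Rightarrow> bool" where
  "control_path T p \<longleftrightarrow>
     vpath p T \<and> hd p \<in> control_vertices T \<and> last p \<in> control_vertices T \<and>
     (hd p = last p \<longrightarrow> control_vertices T = {hd p})"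

definition even_vertices :: "('a, 'b) pre_digraph \<Rightarrow> 'a set" where
  "even_vertices T =
     {x \<in> verts T - leaf_set T.
        \<exists>p i. control_path T p \<and> i < length p \<and> even i \<and> x = p ! i}"

text \<open>
  \<open>G \<circ> l\<one>\<^sub>U\<close>: the old vertex \<open>v\<close> becomes \<open>Inl v\<close>, and the \<open>l\<close> new pendant vertices at
  \<open>u \<in> U\<close> are \<open>Inr (u, i)\<close> for \<open>i < l\<close>.
\<close>

definition attach_pendants ::
    "'a pair_pre_digraph \<Rightarrow> nat \<Rightarrow> 'a set \<Rightarrow> ('a + 'a \<times> nat) pair_pre_digraph" where
  "attach_pendants G l U =
     \<lparr> pverts = Inl ` pverts G \<union> Inr ` (U \<times> {..<l}),
       parcs = {(Inl u, Inl v) | u v. (u, v) \<in> parcs G}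
             \<union> {(Inl u, Inr (u, i)) | u i. u \<in> U \<and> i < l}
             \<union> {(Inr (u, i), Inl u) | u i. u \<in> U \<and> i < l} \<rparr>"

definition graph_iso :: "'a pair_pre_digraph \<Rightarrow> 'b pair_pre_digraph \<Rightarrow> bool" (infix "\<simeq>\<^sub>G" 50) where
  "G \<simeq>\<^sub>G H \<longleftrightarrow> digraph_iso (with_proj G) (with_proj H)"

end

theory Submission
  imports Defs "HOL-Analysis.Function_Topology"
begin

text \<open>
  Fix a vertex set \<open>V\<close> of size \<open>n\<close> and a set \<open>W\<close> of size \<open>k\<close>, and minimize the spectral radius
  over all connected graphs on \<open>V\<close> with vertex cover \<open>W\<close>. Write \<open>n + 1 = k q + r\<close>. A caterpillar
  shows that the minimum satisfies \<open>\<rho>\<^sup>2 < q + 3\<close>, so every degree is at most \<open>q + 2\<close>; since the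
  degrees over \<open>W\<close> sum to at least \<open>n - 1\<close>, the condition \<open>n \<ge> n\<^sub>0\<close>, that is \<open>q + r + 1 \<ge> 3 k\<close>,
  forces every degree on \<open>W\<close> to be at least \<open>k - 1\<close>. Hence there are enough leaves for the following
  edge swaps, each of which lowers the spectral radius: deleting an edge that is not a bridge,
  subdividing an edge inside \<open>W\<close> by a leaf, and splitting a vertex outside \<open>W\<close> of degree at
  least three by means of a leaf. So the minimum is attained exactly by trees whose edges join
  \<open>W\<close> to its complement and whose vertices outside \<open>W\<close> have degree at most two. Such a tree has
  independence number \<open>n - k\<close>, so these are the minimizer graphs, and \<open>W\<close> is the set of their
  even vertices.

  On a bipartite graph, \<open>\<rho>\<^sup>2\<close> is the largest eigenvalue of \<open>B B\<^sup>T\<close> for the biadjacency matrix \<open>B\<close> with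
  rows indexed by \<open>W\<close>, and attaching \<open>l\<close> pendant vertices to each vertex of \<open>W\<close> adds \<open>l\<close> times the
  identity. The degree bound also shows that \<open>l\<close> pendant vertices can be removed from each
  vertex of \<open>W\<close> again, so the minimizers for \<open>n\<close> and \<open>n\<^sub>0\<close> correspond to each other.
\<close>

section \<open>Perron vectors of connected graphs\<close>

text \<open>The cover is fixed because a swap can change the independence number, while it keeps
  \<open>W\<close> a vertex cover as long as the new edge meets \<open>W\<close>. Nothing is lost:
  the complement of a maximum independent set is a cover of size k, and the minimal trees have a
  matching of \<open>W\<close> into its complement, so their independence number is n - k again and
  they compete in the original class. The threshold is where two counts meet. The degrees over
  \<open>W\<close> sum to at least n - 1, so with all other degrees at most q + 2 a cover vertex has
  degree at least q + r - 2 k. At most k - 1 of its neighbours are not private leaves. Hence at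
  least q + r + 1 - 3 k of them are private leaves: this number is 0 at n0 and l at n, just enough
  to undo the attachment. For k = 2 and k = 3 the degree bound k - 1 is too weak: identifying the
  even vertices means excluding paths and \<open>D_m\<close>, which takes degree at least three on
  \<open>W\<close>. So the caterpillar is estimated by q + min 3 (k - 1).\<close>

definition simple_graph :: "'a set \<Rightarrow> 'a rel \<Rightarrow> bool" where
  "simple_graph V E \<longleftrightarrow> finite V \<and> E \<subseteq> V \<times> V \<and> sym E \<and> irrefl E"

definition connected_graph :: "'a set \<Rightarrow> 'a rel \<Rightarrow> bool" where
  "connected_graph V E \<longleftrightarrow> simple_graph V E \<and> V \<noteq> {} \<and> (\<forall>u\<in>V. \<forall>v\<in>V. (u, v) \<in> E\<^sup>*)"

abbreviation rho :: "'a set \<Rightarrow> 'a rel \<Rightarrow> real" where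
  "rho V E \<equiv> graph_spectral_radius \<lparr>pverts = V, parcs = E\<rparr>"

definition nbr_sum :: "'a rel \<Rightarrow> ('a \<Rightarrow> real) \<Rightarrow> 'a \<Rightarrow> real" where
  "nbr_sum E x v = (\<Sum>u\<in>E `` {v}. x u)"

lemma simple_graph_finite_nbrs: "simple_graph V E \<Longrightarrow> finite (E `` {v})"
  unfolding simple_graph_def by (rule finite_subset[of _ V]) auto

lemma simple_graph_symD: "simple_graph V E \<Longrightarrow> (u, v) \<in> E \<Longrightarrow> (v, u) \<in> E"
  by (auto simp: simple_graph_def dest: symD)

lemma simple_graph_in_verts: "simple_graph V E \<Longrightarrow> (u, v) \<in> E \<Longrightarrow> u \<in> V \<and> v \<in> V \<and> u \<noteq> v"
  by (auto simp: simple_graph_def irrefl_def)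

text \<open>Both sides are sums over arcs, and the arc set is invariant under reversal. The
  comparisons of spectral radii below rest on this symmetry.\<close>

lemma nbr_sum_self_adjoint:
  assumes "simple_graph V E"
  shows "(\<Sum>v\<in>V. y v * nbr_sum E z v) = (\<Sum>v\<in>V. z v * nbr_sum E y v)"
proof -
  have fin: "finite V" "\<And>v. finite (E `` {v})" and V: "E \<subseteq> V \<times> V"
    using assms simple_graph_finite_nbrs[OF assms] by (auto simp: simple_graph_def)
  have *: "(\<Sum>v\<in>V. f v * nbr_sum E g v) = (\<Sum>(v, u)\<in>E. f v * g u)" for f g
  proof -
    have "E = (SIGMA v:V. E `` {v})" using V by auto
    then have "(\<Sum>(v, u)\<in>E. f v * g u) = (\<Sum>(v, u)\<in>(SIGMA v:V. E `` {v}). f v * g u)" by simp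
    also have "\<dots> = (\<Sum>v\<in>V. \<Sum>u\<in>E `` {v}. f v * g u)"
      using fin by (intro sum.Sigma[symmetric]) auto
    finally show ?thesis by (simp add: nbr_sum_def sum_distrib_left)
  qed
  have "(\<Sum>(v, u)\<in>E. y v * z u) = (\<Sum>(v, u)\<in>E. z v * y u)"
    by (rule sum.reindex_bij_witness[where i = prod.swap and j = prod.swap])
      (auto simp: mult.commute dest: simple_graph_symD[OF assms])
  then show ?thesis by (simp only: *)
qed

lemma nbr_sum_add: "nbr_sum E (\<lambda>u. y u + t * z u) v = nbr_sum E y v + t * nbr_sum E z v"
  by (simp add: nbr_sum_def sum.distrib sum_distrib_left)

text \<open>Vectors are total functions on the vertex type. Pinning the coordinates outside
  \<open>V\<close> to 0 makes the cube a product of compact sets, hence compact by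
  Tychonoff.\<close>

lemma compact_unit_box:
  fixes V :: "'a set"
  shows "compact {x :: 'a \<Rightarrow> real. \<forall>v. x v \<in> (if v \<in> V then {-1..1} else {0})}"
proof -
  let ?S = "\<lambda>v. if v \<in> V then {-1..1} else {0 :: real}"
  have "compactin (product_topology (\<lambda>_. euclidean) UNIV) (Pi\<^sub>E UNIV ?S)"
    by (subst compactin_PiE) auto
  then have "compact (Pi\<^sub>E UNIV ?S)"
    by (simp add: euclidean_product_topology)
  moreover have "Pi\<^sub>E UNIV ?S = {x. \<forall>v. x v \<in> ?S v}" by (auto simp: PiE_UNIV_domain Pi_def)
  ultimately show ?thesis by simp
qed

text \<open>The quadratic form attains its maximum on the unit sphere inside the compact cube. The
  homogeneous inequality replaces the quotient, so it also covers unnormalised perturbations and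
  vectors vanishing on \<open>V\<close>.\<close>

lemma rayleigh_maximum:
  fixes V :: "'a set"
  assumes G: "simple_graph V E" and ne: "V \<noteq> {}"
  obtains x where "(\<Sum>v\<in>V. (x v)\<^sup>2) = (1 :: real)"
    and "\<And>y. (\<Sum>v\<in>V. y v * nbr_sum E y v) \<le>
              (\<Sum>v\<in>V. x v * nbr_sum E x v) * (\<Sum>v\<in>V. (y v)\<^sup>2)"
proof -
  have fin: "finite V" using G by (simp add: simple_graph_def)
  define Q where "Q x = (\<Sum>v\<in>V. x v * nbr_sum E x v)" for x :: "'a \<Rightarrow> real"
  define N where "N x = (\<Sum>v\<in>V. (x v)\<^sup>2)" for x :: "'a \<Rightarrow> real"
  define K where "K = {x :: 'a \<Rightarrow> real. \<forall>v. x v \<in> (if v \<in> V then {-1..1} else {0})} \<inter> N -` {1}"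
  have coord: "continuous_on UNIV (\<lambda>x :: 'a \<Rightarrow> real. x v)" for v
    by (rule continuous_on_product_coordinates)
  have contN: "continuous_on UNIV N" unfolding N_def
    by (intro continuous_intros coord)
  have contQ: "continuous_on UNIV Q" unfolding Q_def nbr_sum_def
    by (intro continuous_intros coord)
  have "compact K" unfolding K_def
    using contN by (intro compact_Int_closed compact_unit_box closed_vimage) auto
  have sq: "(y v)\<^sup>2 \<le> N y" if "v \<in> V" for y v
    unfolding N_def using that fin by (intro member_le_sum) auto
  have scaled: "(\<lambda>v. if v \<in> V then y v / sqrt (N y) else 0) \<in> K"
      and Qscaled: "Q (\<lambda>v. if v \<in> V then y v / sqrt (N y) else 0) = Q y / N y" if "N y > 0" for y
  proof -
    let ?z = "\<lambda>v. if v \<in> V then y v / sqrt (N y) else 0"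
    have "\<bar>y v\<bar> \<le> sqrt (N y)" if "v \<in> V" for v
      using sq[OF that, of y] by (simp add: real_le_rsqrt)
    then have "\<bar>y v / sqrt (N y)\<bar> \<le> 1" if "v \<in> V" for v
      using that \<open>N y > 0\<close> by (simp add: abs_divide)
    then have "y v / sqrt (N y) \<in> {-1..1}" if "v \<in> V" for v
      using that unfolding abs_le_iff by force
    moreover have "N ?z = 1"
      using \<open>N y > 0\<close> by (simp add: N_def power_divide sum_divide_distrib[symmetric])
    ultimately show "?z \<in> K" by (simp add: K_def)
    have nb: "nbr_sum E ?z v = nbr_sum E y v / sqrt (N y)" for v
    proof -
      have "nbr_sum E ?z v = (\<Sum>u\<in>E `` {v}. y u / sqrt (N y))" unfolding nbr_sum_def
        by (rule sum.cong) (use simple_graph_in_verts[OF G] in auto)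
      then show ?thesis by (simp add: nbr_sum_def sum_divide_distrib)
    qed
    have "Q ?z = (\<Sum>v\<in>V. y v * nbr_sum E y v / N y)" unfolding Q_def
      by (rule sum.cong) (use \<open>N y > 0\<close> in \<open>auto simp: nb\<close>)
    then show "Q ?z = Q y / N y" by (simp add: Q_def sum_divide_distrib)
  qed
  have "N (\<lambda>_. 1) > 0" using ne fin by (simp add: N_def card_gt_0_iff)
  from scaled[OF this] have "K \<noteq> {}" by blast
  with \<open>compact K\<close> obtain x where x: "x \<in> K" "\<And>y. y \<in> K \<Longrightarrow> Q y \<le> Q x"
    using continuous_attains_sup[of K Q] continuous_on_subset[OF contQ] by blast
  have "Q y \<le> Q x * N y" for y
  proof (cases "N y = 0")
    case True
    then have "y v = 0" if "v \<in> V" for v using sq[OF that, of y] by auto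
    then have "Q y = 0" by (simp add: Q_def)
    with True show ?thesis by simp
  next
    case False
    then have pos: "N y > 0" using fin by (simp add: N_def sum_nonneg order_less_le)
    from x(2)[OF scaled[OF pos]] Qscaled[OF pos] have "Q y / N y \<le> Q x" by simp
    with pos show ?thesis by (simp add: divide_le_eq)
  qed
  moreover have "N x = 1" using x(1) by (simp add: K_def)
  ultimately show ?thesis using that[of x] by (simp add: Q_def N_def)
qed

definition positive_eigenvector :: "'a set \<Rightarrow> 'a rel \<Rightarrow> real \<Rightarrow> ('a \<Rightarrow> real) \<Rightarrow> bool" where
  "positive_eigenvector V E \<kappa> x \<longleftrightarrow> (\<forall>v\<in>V. x v > 0 \<and> nbr_sum E x v = \<kappa> * x v)"

text \<open>Taking absolute values of a Rayleigh maximizer does not lower the form, so there is a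
  nonnegative maximizer. Stationarity in each single coordinate is the eigenvalue equation, and a
  zero entry would spread along edges to all of \<open>V\<close>.\<close>

lemma positive_eigenvector_exists:
  fixes V :: "'a set"
  assumes C: "connected_graph V E"
  obtains \<kappa> x where "positive_eigenvector V E \<kappa> x"
proof -
  from C have G: "simple_graph V E" and ne: "V \<noteq> {}" and conn: "\<And>u v. u \<in> V \<Longrightarrow> v \<in> V \<Longrightarrow> (u, v) \<in> E\<^sup>*"
    by (auto simp: connected_graph_def)
  have fin: "finite V" using G by (simp add: simple_graph_def)
  from rayleigh_maximum[OF G ne] obtain x0 where x0: "(\<Sum>v\<in>V. (x0 v)\<^sup>2) = (1 :: real)"
    "\<And>y. (\<Sum>v\<in>V. y v * nbr_sum E y v) \<le>
              (\<Sum>v\<in>V. x0 v * nbr_sum E x0 v) * (\<Sum>v\<in>V. (y v)\<^sup>2)" by blast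
  define x where "x v = \<bar>x0 v\<bar>" for v
  define \<kappa> where "\<kappa> = (\<Sum>v\<in>V. x v * nbr_sum E x v)"
  have N1: "(\<Sum>v\<in>V. (x v)\<^sup>2) = 1" using x0(1) by (simp add: x_def)
  have "(\<Sum>v\<in>V. x0 v * nbr_sum E x0 v) \<le> \<kappa>" unfolding \<kappa>_def
  proof (rule sum_mono)
    fix v assume "v \<in> V"
    have "x0 v * nbr_sum E x0 v \<le> \<bar>x0 v\<bar> * \<bar>nbr_sum E x0 v\<bar>" by (metis abs_ge_self abs_mult)
    also have "\<dots> \<le> x v * nbr_sum E x v"
      unfolding x_def nbr_sum_def by (intro mult_left_mono sum_abs) auto
    finally show "x0 v * nbr_sum E x0 v \<le> x v * nbr_sum E x v" .
  qed
  then have max: "(\<Sum>v\<in>V. y v * nbr_sum E y v) \<le> \<kappa> * (\<Sum>v\<in>V. (y v)\<^sup>2)" for y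
    using x0(2)[of y] mult_right_mono[of _ \<kappa> "\<Sum>v\<in>V. (y v)\<^sup>2"]
    by (meson order_trans sum_nonneg zero_le_power2)
  have eig: "nbr_sum E x w = \<kappa> * x w" if w: "w \<in> V" for w
  proof (rule ccontr)
    assume neq: "nbr_sum E x w \<noteq> \<kappa> * x w"
    define c where "c = \<kappa> * x w - nbr_sum E x w"
    define h :: "'a \<Rightarrow> real" where "h v = of_bool (v = w)" for v
    have hs: "(\<Sum>v\<in>V. h v * f v) = f w" "(\<Sum>v\<in>V. f v * h v) = f w" for f
      using w fin by (simp_all add: h_def)
    have hw: "nbr_sum E h w = 0"
      unfolding nbr_sum_def h_def using simple_graph_in_verts[OF G, of w w] by (intro sum.neutral) auto
    \<comment> \<open>This is the Rayleigh inequality at x + t h; its first-order coefficient in t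
      is 2 c.\<close>
    have key: "0 \<le> 2 * t * c + \<kappa> * t\<^sup>2" for t
    proof -
      have "(\<Sum>v\<in>V. (x v + t * h v) * nbr_sum E (\<lambda>u. x u + t * h u) v)
        = (\<Sum>v\<in>V. x v * nbr_sum E x v) + t * (\<Sum>v\<in>V. x v * nbr_sum E h v)
          + t * (\<Sum>v\<in>V. h v * nbr_sum E x v) + t\<^sup>2 * (\<Sum>v\<in>V. h v * nbr_sum E h v)"
        unfolding nbr_sum_add by (simp add: algebra_simps sum.distrib sum_distrib_left power2_eq_square)
      also have "(\<Sum>v\<in>V. x v * nbr_sum E h v) = nbr_sum E x w"
        using nbr_sum_self_adjoint[OF G, of x h] by (simp add: hs)
      finally have A: "(\<Sum>v\<in>V. (x v + t * h v) * nbr_sum E (\<lambda>u. x u + t * h u) v)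
        = \<kappa> + 2 * t * nbr_sum E x w" by (simp add: hs hw \<kappa>_def)
      have "(\<Sum>v\<in>V. (x v + t * h v)\<^sup>2)
        = (\<Sum>v\<in>V. (x v)\<^sup>2) + 2 * t * (\<Sum>v\<in>V. x v * h v) + t\<^sup>2 * (\<Sum>v\<in>V. h v * h v)"
        by (simp add: algebra_simps sum.distrib sum_distrib_left power2_eq_square)
      then have B: "(\<Sum>v\<in>V. (x v + t * h v)\<^sup>2) = 1 + 2 * t * x w + t\<^sup>2"
        using N1 by (simp add: hs) (simp add: h_def)
      from max[of "\<lambda>v. x v + t * h v"] show ?thesis
        unfolding A B c_def by (simp add: algebra_simps)
    qed
    have "c \<noteq> 0" using neq by (simp add: c_def)
    \<comment> \<open>Any d above both 0 and kappa works: at t = - c / d the linear term dominates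
      and the quadratic in \<open>key\<close> is negative.\<close>
    define d where "d = \<bar>\<kappa>\<bar> + 1"
    have d: "d > 0" "\<kappa> < d" by (auto simp: d_def)
    have "2 * (- c / d) * c + \<kappa> * (- c / d)\<^sup>2 = (c\<^sup>2 / d) * (\<kappa> / d - 2)"
      using d by (simp add: field_simps power2_eq_square)
    also have "\<dots> < 0"
      using d \<open>c \<noteq> 0\<close> by (intro mult_pos_neg) (auto simp: field_simps)
    finally show False using key[of "- c / d"] by simp
  qed
  have pos: "x v > 0" if "v \<in> V" for v
  proof (rule ccontr)
    assume "\<not> x v > 0"
    then have z: "x v = 0" by (simp add: x_def)
    have "u \<in> V \<and> x u = 0" if "(v, u) \<in> E\<^sup>*" for u
      using that
    proof (induction rule: rtrancl_induct)
      case base then show ?case using z \<open>v \<in> V\<close> by simp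
    next
      case (step a b)
      then have "(\<Sum>u\<in>E `` {a}. x u) = 0" using eig[of a] by (simp add: nbr_sum_def)
      then have "\<forall>u\<in>E `` {a}. x u = 0"
        using simple_graph_finite_nbrs[OF G] by (subst (asm) sum_nonneg_eq_0_iff) (auto simp: x_def)
      then show ?case using step(2) simple_graph_in_verts[OF G] by auto
    qed
    then have "\<forall>u\<in>V. x u = 0" using conn[OF \<open>v \<in> V\<close>] by blast
    then show False using N1 by simp
  qed
  from eig pos have "positive_eigenvector V E \<kappa> x" by (simp add: positive_eigenvector_def)
  with that show ?thesis by blast
qed

text \<open>The enumeration \<open>vs\<close> turns matrix vectors into functions, of which only the
  values on \<open>V\<close> count because all arcs stay in \<open>V\<close>. After this and
  \<open>rho_eqI\<close> matrices no longer occur.\<close>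

lemma eigenvalue_adjacency_iff:
  assumes G: "simple_graph V E" and vs: "distinct vs" "set vs = V"
  shows "eigenvalue (adjacency_matrix \<lparr>pverts = V, parcs = E\<rparr> vs) \<mu> \<longleftrightarrow>
    (\<exists>y. (\<exists>v\<in>V. y v \<noteq> 0) \<and> (\<forall>v\<in>V. nbr_sum E y v = \<mu> * y v))"
proof -
  define n where "n = length vs"
  let ?A = "adjacency_matrix \<lparr>pverts = V, parcs = E\<rparr> vs"
  have bij: "bij_betw ((!) vs) {..<n} V" using vs by (simp add: bij_betw_nth n_def)
  have dim: "dim_row ?A = n" "dim_col ?A = n" by (simp_all add: adjacency_matrix_def n_def)
  have mv: "(?A *\<^sub>v vec n (\<lambda>i. y (vs ! i))) $ i = nbr_sum E y (vs ! i)" if "i < n" for y i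
  proof -
    have "(?A *\<^sub>v vec n (\<lambda>i. y (vs ! i))) $ i
        = (\<Sum>j<n. (if (vs ! i, vs ! j) \<in> E then 1 else 0) * y (vs ! j))"
      using that by (simp add: adjacency_matrix_def n_def[symmetric] scalar_prod_def atLeast0LessThan)
    also have "\<dots> = (\<Sum>u\<in>V. (if (vs ! i, u) \<in> E then 1 else 0) * y u)"
      by (rule sum.reindex_bij_betw[OF bij, of "\<lambda>u. (if (vs ! i, u) \<in> E then 1 else 0) * y u"])
    also have "\<dots> = nbr_sum E y (vs ! i)" unfolding nbr_sum_def
      using G simple_graph_in_verts[OF G]
      by (intro sum.mono_neutral_cong_right) (auto simp: simple_graph_def)
    finally show ?thesis .
  qed
  have iff: "?A *\<^sub>v vec n (\<lambda>i. y (vs ! i)) = \<mu> \<cdot>\<^sub>v vec n (\<lambda>i. y (vs ! i)) \<longleftrightarrow>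
      (\<forall>v\<in>V. nbr_sum E y v = \<mu> * y v)" for y
  proof -
    have "?A *\<^sub>v vec n (\<lambda>i. y (vs ! i)) = \<mu> \<cdot>\<^sub>v vec n (\<lambda>i. y (vs ! i)) \<longleftrightarrow>
        (\<forall>i<n. nbr_sum E y (vs ! i) = \<mu> * y (vs ! i))"
      using mv[of _ y] by (auto simp: vec_eq_iff dim)
    also have "\<dots> \<longleftrightarrow> (\<forall>v\<in>set vs. nbr_sum E y v = \<mu> * y v)"
      unfolding all_set_conv_all_nth n_def ..
    finally show ?thesis using vs by simp
  qed
  have nz: "vec n (\<lambda>i. y (vs ! i)) \<noteq> 0\<^sub>v n \<longleftrightarrow> (\<exists>v\<in>V. y v \<noteq> 0)" for y
  proof -
    have "vec n (\<lambda>i. y (vs ! i)) = 0\<^sub>v n \<longleftrightarrow> (\<forall>i<n. y (vs ! i) = 0)"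
      by (auto simp: vec_eq_iff)
    also have "\<dots> \<longleftrightarrow> (\<forall>v\<in>set vs. y v = 0)" unfolding all_set_conv_all_nth n_def ..
    finally show ?thesis using vs by simp
  qed
  have "\<exists>y. w = vec n (\<lambda>i. y (vs ! i))" if "w \<in> carrier_vec n" for w :: "real vec"
  proof -
    define y where "y u = w $ (the_inv_into {..<n} ((!) vs) u)" for u
    have "w = vec n (\<lambda>i. y (vs ! i))"
      using that bij by (auto simp: vec_eq_iff y_def the_inv_into_f_f bij_betw_def)
    then show ?thesis by blast
  qed
  then have "eigenvalue ?A \<mu> \<longleftrightarrow> (\<exists>y. vec n (\<lambda>i. y (vs ! i)) \<noteq> 0\<^sub>v n \<and>
      ?A *\<^sub>v vec n (\<lambda>i. y (vs ! i)) = \<mu> \<cdot>\<^sub>v vec n (\<lambda>i. y (vs ! i)))"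
    unfolding eigenvalue_def eigenvector_def dim by (metis vec_carrier)
  then show ?thesis by (simp only: iff nz)
qed

text \<open>If y has eigenvalue mu, pairing |y| with the positive vector x gives mu <x, |y|> <= <x,
  A |y|> = kappa <x, |y|>, where <x, |y|> is positive. So a spectral radius is computed by
  exhibiting one positive eigenvector.\<close>

lemma rho_eqI:
  assumes G: "simple_graph V E" and ne: "V \<noteq> {}" and x: "positive_eigenvector V E \<kappa> x"
  shows "rho V E = \<kappa>"
proof -
  have fin: "finite V" using G by (simp add: simple_graph_def)
  define vs where "vs = (SOME vs. distinct vs \<and> set vs = V)"
  have "\<exists>vs. distinct vs \<and> set vs = V" using finite_distinct_list[OF fin] by blast
  then have vs: "distinct vs" "set vs = V" unfolding vs_def by (metis (mono_tags, lifting) someI_ex)+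
  let ?A = "adjacency_matrix \<lparr>pverts = V, parcs = E\<rparr> vs"
  have "?A \<in> carrier_mat (length vs) (length vs)" by (simp add: adjacency_matrix_def)
  then have fs: "finite (spectrum ?A)" by (rule card_finite_spectrum)
  have mem: "\<kappa> \<in> spectrum ?A"
    unfolding spectrum_def mem_Collect_eq eigenvalue_adjacency_iff[OF G vs]
    using x ne by (metis all_not_in_conv less_irrefl positive_eigenvector_def)
  have "\<mu> \<le> \<kappa>" if "\<mu> \<in> spectrum ?A" for \<mu>
  proof -
    from that obtain y v0 where v0: "v0 \<in> V" "y v0 \<noteq> 0" and y: "\<forall>v\<in>V. nbr_sum E y v = \<mu> * y v"
      unfolding spectrum_def mem_Collect_eq eigenvalue_adjacency_iff[OF G vs] by blast
    let ?y = "\<lambda>v. \<bar>y v\<bar>"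
    have "x v0 * \<bar>y v0\<bar> \<le> (\<Sum>v\<in>V. x v * \<bar>y v\<bar>)"
      using v0 x fin
      by (intro member_le_sum[where f = "\<lambda>v. x v * \<bar>y v\<bar>"])
        (auto simp: positive_eigenvector_def less_imp_le)
    moreover have "x v0 * \<bar>y v0\<bar> > 0" using v0 x by (simp add: positive_eigenvector_def)
    ultimately have pos: "(\<Sum>v\<in>V. x v * \<bar>y v\<bar>) > 0" by linarith
    have "\<mu> * (\<Sum>v\<in>V. x v * \<bar>y v\<bar>) = (\<Sum>v\<in>V. x v * (\<mu> * \<bar>y v\<bar>))"
      by (simp add: sum_distrib_left algebra_simps)
    also have "\<dots> \<le> (\<Sum>v\<in>V. x v * nbr_sum E ?y v)"
    proof (rule sum_mono, rule mult_left_mono)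
      fix v assume "v \<in> V"
      have "\<mu> * \<bar>y v\<bar> \<le> \<bar>\<mu> * y v\<bar>" by (simp add: abs_mult mult_right_mono)
      also have "\<dots> = \<bar>nbr_sum E y v\<bar>" using y \<open>v \<in> V\<close> by simp
      also have "\<dots> \<le> nbr_sum E ?y v" by (simp add: nbr_sum_def sum_abs)
      finally show "\<mu> * \<bar>y v\<bar> \<le> nbr_sum E ?y v" .
    qed (use x in \<open>auto simp: positive_eigenvector_def less_imp_le\<close>)
    also have "\<dots> = (\<Sum>v\<in>V. ?y v * nbr_sum E x v)" by (rule nbr_sum_self_adjoint[OF G])
    also have "\<dots> = (\<Sum>v\<in>V. ?y v * (\<kappa> * x v))"
      using x by (intro sum.cong) (auto simp: positive_eigenvector_def)
    also have "\<dots> = \<kappa> * (\<Sum>v\<in>V. x v * \<bar>y v\<bar>)" by (simp add: sum_distrib_left algebra_simps)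
    finally show ?thesis using pos by simp
  qed
  with fs mem have "Max (spectrum ?A) = \<kappa>" by (intro Max_eqI) auto
  then show ?thesis by (simp add: graph_spectral_radius_def vs_def)
qed

lemma rho_eigenvector:
  assumes "connected_graph V E"
  obtains x where "positive_eigenvector V E (rho V E) x"
  using positive_eigenvector_exists[OF assms] rho_eqI[of V E] assms
  by (metis connected_graph_def)

text \<open>Pairing z with the Perron vector transfers the defect of the supersolution to the
  eigenvalue. Strictness at one vertex is enough because the Perron vector is positive
  everywhere.\<close>

lemma rho_less:
  assumes C: "connected_graph V E" and z: "\<And>v. v \<in> V \<Longrightarrow> z v > 0"
    and le: "\<And>v. v \<in> V \<Longrightarrow> nbr_sum E z v \<le> \<kappa> * z v"
    and strict: "w \<in> V" "nbr_sum E z w < \<kappa> * z w"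
  shows "rho V E < \<kappa>"
proof -
  obtain x where x: "positive_eigenvector V E (rho V E) x" using rho_eigenvector[OF C] .
  have G: "simple_graph V E" and fin: "finite V" using C by (auto simp: connected_graph_def simple_graph_def)
  have "rho V E * (\<Sum>v\<in>V. z v * x v) = (\<Sum>v\<in>V. z v * nbr_sum E x v)"
    using x by (auto simp: sum_distrib_left positive_eigenvector_def intro!: sum.cong)
  also have "\<dots> = (\<Sum>v\<in>V. x v * nbr_sum E z v)" by (rule nbr_sum_self_adjoint[OF G])
  also have "\<dots> < (\<Sum>v\<in>V. x v * (\<kappa> * z v))"
    using x le strict fin by (intro sum_strict_mono_ex1) (auto simp: positive_eigenvector_def)
  also have "\<dots> = \<kappa> * (\<Sum>v\<in>V. z v * x v)" by (simp add: sum_distrib_left algebra_simps)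
  finally have "rho V E * (\<Sum>v\<in>V. z v * x v) < \<kappa> * (\<Sum>v\<in>V. z v * x v)" .
  moreover have "(\<Sum>v\<in>V. z v * x v) > 0"
    using fin x z strict(1) by (intro sum_pos) (auto simp: positive_eigenvector_def)
  ultimately show ?thesis by (simp add: mult_less_cancel_right)
qed

lemma rho_nonneg:
  assumes C: "connected_graph V E"
  shows "rho V E \<ge> 0"
proof -
  obtain x where x: "positive_eigenvector V E (rho V E) x" using rho_eigenvector[OF C] .
  obtain v where "v \<in> V" using C by (auto simp: connected_graph_def)
  have G: "simple_graph V E" using C by (simp add: connected_graph_def)
  have "x u \<ge> 0" if "u \<in> E `` {v}" for u
    using that x simple_graph_in_verts[OF G, of v u] by (simp add: positive_eigenvector_def less_imp_le)
  then have "nbr_sum E x v \<ge> 0" unfolding nbr_sum_def by (rule sum_nonneg)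
  with x \<open>v \<in> V\<close> have "rho V E * x v \<ge> 0" "x v > 0" by (simp_all add: positive_eigenvector_def)
  then show ?thesis by (simp add: zero_le_mult_iff)
qed

text \<open>The eigenvalue equation at a neighbour u of v gives x v <= rho * x u; summing over u and
  using the equation at v brings in the second factor rho.\<close>

lemma degree_le_rho_square:
  assumes C: "connected_graph V E" and v: "v \<in> V"
  shows "real (card (E `` {v})) \<le> (rho V E)\<^sup>2"
proof -
  obtain x where x: "positive_eigenvector V E (rho V E) x" using rho_eigenvector[OF C] .
  have G: "simple_graph V E" using C by (simp add: connected_graph_def)
  have pos: "x u > 0" and eig: "nbr_sum E x u = rho V E * x u" if "u \<in> V" for u
    using x that by (auto simp: positive_eigenvector_def)
  have "x v \<le> rho V E * x u" if "u \<in> E `` {v}" for u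
  proof -
    have u: "u \<in> V" "v \<in> E `` {u}"
      using that simple_graph_in_verts[OF G] simple_graph_symD[OF G] by auto
    have "x v \<le> nbr_sum E x u" unfolding nbr_sum_def
      using u simple_graph_finite_nbrs[OF G] simple_graph_in_verts[OF G]
      by (intro member_le_sum) (auto intro!: less_imp_le pos)
    then show ?thesis using eig[OF u(1)] by simp
  qed
  then have "(\<Sum>u\<in>E `` {v}. x v) \<le> (\<Sum>u\<in>E `` {v}. rho V E * x u)" by (rule sum_mono)
  also have "\<dots> = (rho V E)\<^sup>2 * x v"
    using eig[OF v] by (simp add: nbr_sum_def sum_distrib_left[symmetric] power2_eq_square)
  finally show ?thesis using pos[OF v] by simp
qed

section \<open>Edge swaps that lower the spectral radius\<close>

text \<open>Acyclicity of a symmetric relation in the form in which it is proved and used: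
  minimality refutes one non-bridge at a time, and the tree structure always enters through one
  deleted edge.\<close>

definition bridged :: "'a rel \<Rightarrow> bool" where
  "bridged E \<longleftrightarrow> (\<forall>a b. (a, b) \<in> E \<longrightarrow> (a, b) \<notin> (E - {(a, b), (b, a)})\<^sup>*)"

text \<open>Both swaps have this form. With c a leaf at a, the edge ab becomes the path a, c, b;
  with c a leaf at another neighbour of a, the branch towards b moves from a to c.\<close>

definition swap_edge :: "'a rel \<Rightarrow> 'a \<Rightarrow> 'a \<Rightarrow> 'a \<Rightarrow> 'a rel" where
  "swap_edge E a b c = (E - {(a, b), (b, a)}) \<union> {(c, b), (b, c)}"

lemma simple_graph_delete: "simple_graph V E \<Longrightarrow> simple_graph V (E - {(a, b), (b, a)})"
  by (auto simp: simple_graph_def irrefl_def intro!: symI dest: symD)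

lemma simple_graph_swap:
  "simple_graph V E \<Longrightarrow> b \<in> V \<Longrightarrow> c \<in> V \<Longrightarrow> b \<noteq> c \<Longrightarrow> simple_graph V (swap_edge E a b c)"
  by (auto simp: simple_graph_def irrefl_def swap_edge_def intro!: symI dest: symD)

lemma connected_graph_transfer:
  assumes "connected_graph V E" "simple_graph V E'" "E \<subseteq> E'\<^sup>*"
  shows "connected_graph V E'"
  using assms rtrancl_subset_rtrancl[OF assms(3)] by (auto simp: connected_graph_def)

lemma rtrancl_symmetric: "sym E \<Longrightarrow> (a, b) \<in> E\<^sup>* \<Longrightarrow> (b, a) \<in> E\<^sup>*"
  by (meson sym_rtrancl symD)

lemma connected_delete:
  assumes C: "connected_graph V E" and p: "(a, b) \<in> (E - {(a, b), (b, a)})\<^sup>*"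
  shows "connected_graph V (E - {(a, b), (b, a)})"
proof (rule connected_graph_transfer[OF C])
  show S: "simple_graph V (E - {(a, b), (b, a)})"
    using C by (auto simp: connected_graph_def intro!: simple_graph_delete)
  have "(b, a) \<in> (E - {(a, b), (b, a)})\<^sup>*"
    using S p by (auto simp: simple_graph_def intro: rtrancl_symmetric)
  with p show "E \<subseteq> (E - {(a, b), (b, a)})\<^sup>*" by auto
qed

lemma connected_swap:
  assumes C: "connected_graph V E" and ab: "(a, b) \<in> E" and c: "c \<in> V" "c \<noteq> b"
    and p: "(a, c) \<in> (E - {(a, b), (b, a)})\<^sup>*"
  shows "connected_graph V (swap_edge E a b c)"
proof (rule connected_graph_transfer[OF C])
  have G: "simple_graph V E" using C by (simp add: connected_graph_def)
  show S: "simple_graph V (swap_edge E a b c)"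
    using G c simple_graph_in_verts[OF G ab] by (intro simple_graph_swap) auto
  have "(E - {(a, b), (b, a)})\<^sup>* \<subseteq> (swap_edge E a b c)\<^sup>*"
    by (rule rtrancl_mono) (auto simp: swap_edge_def)
  with p have "(a, c) \<in> (swap_edge E a b c)\<^sup>*" by blast
  moreover have "(c, b) \<in> swap_edge E a b c" by (simp add: swap_edge_def)
  ultimately have ab': "(a, b) \<in> (swap_edge E a b c)\<^sup>*" by (rule rtrancl_into_rtrancl)
  then have "(b, a) \<in> (swap_edge E a b c)\<^sup>*"
    using S by (auto simp: simple_graph_def intro: rtrancl_symmetric)
  with ab' show "E \<subseteq> (swap_edge E a b c)\<^sup>*" by (auto simp: swap_edge_def)
qed

lemma nbr_sum_delete:
  assumes G: "simple_graph V E" and ab: "(a, b) \<in> E"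
  shows "nbr_sum (E - {(a, b), (b, a)}) x v =
    nbr_sum E x v - (if v = a then x b else 0) - (if v = b then x a else 0)"
proof -
  have ne: "a \<noteq> b" and ba: "(b, a) \<in> E"
    using simple_graph_in_verts[OF G ab] simple_graph_symD[OF G ab] by auto
  have fin: "finite (E `` {v})" by (rule simple_graph_finite_nbrs[OF G])
  consider "v = a" | "v = b" | "v \<noteq> a" "v \<noteq> b" by blast
  then show ?thesis
  proof cases
    case 1
    then have "(E - {(a, b), (b, a)}) `` {v} = E `` {v} - {b}" using ne by auto
    then show ?thesis using 1 ne ab fin by (simp add: nbr_sum_def sum_diff1)
  next
    case 2
    then have "(E - {(a, b), (b, a)}) `` {v} = E `` {v} - {a}" using ne by auto
    then show ?thesis using 2 ne ba fin by (simp add: nbr_sum_def sum_diff1)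
  next
    case 3
    then have "(E - {(a, b), (b, a)}) `` {v} = E `` {v}" by auto
    then show ?thesis using 3 by (simp add: nbr_sum_def)
  qed
qed

lemma nbr_sum_insert:
  assumes G: "simple_graph V E" and cb: "(c, b) \<notin> E" "c \<noteq> b"
  shows "nbr_sum (E \<union> {(c, b), (b, c)}) x v =
    nbr_sum E x v + (if v = c then x b else 0) + (if v = b then x c else 0)"
proof -
  have bc: "(b, c) \<notin> E" using simple_graph_symD[OF G] cb by blast
  have fin: "finite (E `` {v})" by (rule simple_graph_finite_nbrs[OF G])
  consider "v = c" | "v = b" | "v \<noteq> c" "v \<noteq> b" by blast
  then show ?thesis
  proof cases
    case 1
    then have "(E \<union> {(c, b), (b, c)}) `` {v} = insert b (E `` {v})" using cb by auto
    then show ?thesis using 1 cb fin by (simp add: nbr_sum_def)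
  next
    case 2
    then have "(E \<union> {(c, b), (b, c)}) `` {v} = insert c (E `` {v})" using cb by auto
    then show ?thesis using 2 cb bc fin by (simp add: nbr_sum_def)
  next
    case 3
    then have "(E \<union> {(c, b), (b, c)}) `` {v} = E `` {v}" by auto
    then show ?thesis using 3 by (simp add: nbr_sum_def)
  qed
qed

lemma nbr_sum_swap:
  assumes G: "simple_graph V E" and ab: "(a, b) \<in> E" and cb: "(c, b) \<notin> E" "c \<noteq> b"
  shows "nbr_sum (swap_edge E a b c) x v = nbr_sum E x v
    - (if v = a then x b else 0) - (if v = b then x a else 0)
    + (if v = c then x b else 0) + (if v = b then x c else 0)"
  unfolding swap_edge_def using cb
  by (subst nbr_sum_insert[OF simple_graph_delete[OF G]]) (auto simp: nbr_sum_delete[OF G ab])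

lemma nbr_sum_update:
  assumes G: "simple_graph V E"
  shows "nbr_sum E (x(s := t)) v = nbr_sum E x v + (if (v, s) \<in> E then t - x s else 0)"
proof -
  have fin: "finite (E `` {v})" by (rule simple_graph_finite_nbrs[OF G])
  show ?thesis
  proof (cases "(v, s) \<in> E")
    case True
    then have "(\<Sum>u\<in>E `` {v}. f u) = f s + (\<Sum>u\<in>E `` {v} - {s}. f u)" for f :: "'a \<Rightarrow> real"
      using fin by (intro sum.remove) auto
    moreover have "(\<Sum>u\<in>E `` {v} - {s}. (x(s := t)) u) = (\<Sum>u\<in>E `` {v} - {s}. x u)"
      by (rule sum.cong) auto
    ultimately show ?thesis using True by (simp add: nbr_sum_def)
  next
    case False
    then show ?thesis by (auto simp: nbr_sum_def intro!: sum.cong)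
  qed
qed

text \<open>The old Perron vector is already a strict supersolution: an endpoint of the deleted edge
  loses a positive summand.\<close>

lemma rho_delete_less:
  assumes C: "connected_graph V E" and ab: "(a, b) \<in> E"
    and C': "connected_graph V (E - {(a, b), (b, a)})"
  shows "rho V (E - {(a, b), (b, a)}) < rho V E"
proof -
  obtain x where x: "positive_eigenvector V E (rho V E) x" using rho_eigenvector[OF C] .
  have G: "simple_graph V E" using C by (simp add: connected_graph_def)
  have v: "a \<in> V" "b \<in> V" "a \<noteq> b" using simple_graph_in_verts[OF G ab] by auto
  show ?thesis
    by (rule rho_less[OF C', where z = x and w = a])
      (use x v in \<open>auto simp: nbr_sum_delete[OF G ab] positive_eigenvector_def less_imp_le\<close>)
qed

text \<open>
  The two edge swaps below lower the spectral radius because the Perron vector of the old graph,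
  corrected only at the leaf (and, in the second case, at the branching vertex), is a strict
  supersolution of the eigenvalue equation for the new graph.
\<close>

lemma rho_subdivide_less:
  assumes C: "connected_graph V E" and x: "positive_eigenvector V E (rho V E) x"
    and uv: "(u, v) \<in> E" and s: "E `` {s} = {u}" "s \<noteq> v"
    and xuv: "x v \<le> x u" and two: "2 \<le> rho V E"
  shows "connected_graph V (swap_edge E u v s)" "rho V (swap_edge E u v s) < rho V E"
proof -
  let ?r = "rho V E" and ?E = "swap_edge E u v s"
  have G: "simple_graph V E" using C by (simp add: connected_graph_def)
  have vu: "u \<in> V" "v \<in> V" "u \<noteq> v" using simple_graph_in_verts[OF G uv] by auto
  have su: "(s, u) \<in> E" using s by auto
  have us: "(u, s) \<in> E" by (rule simple_graph_symD[OF G su])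
  have sV: "s \<in> V" "s \<noteq> u" using simple_graph_in_verts[OF G su] by auto
  have sv: "(s, v) \<notin> E" using s vu by auto
  have ts: "(t, s) \<in> E \<longleftrightarrow> t = u" for t
    using us s(1) simple_graph_symD[OF G, of t s] by auto
  show C': "connected_graph V ?E"
    using C uv sV s us vu by (intro connected_swap r_into_rtrancl) auto
  have pos: "x t > 0" and eig: "nbr_sum E x t = ?r * x t" if "t \<in> V" for t
    using x that by (auto simp: positive_eigenvector_def)
  have xs: "?r * x s = x u" using eig[OF sV(1)] s by (simp add: nbr_sum_def)
  \<comment> \<open>The new entry solves the eigenvalue equation at s, whose neighbours are now u
    and v. At u the gain x v / rho from s is less than the loss x v, and at v the entry at s is at
    most the lost x u; both use rho >= 2, the second also x v <= x u.\<close>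
  define z where "z = x(s := (x u + x v) / ?r)"
  have zs: "?r * z s = x u + x v" and zu: "z u = x u" "z v = x v"
    using two sV s by (auto simp: z_def)
  have diff: "?r * (z s - x s) = x v" using zs xs by (simp add: algebra_simps)
  have gap: "z s - x s < x v"
  proof -
    have "z s - x s = x v / ?r" using diff two by (simp add: field_simps)
    also have "\<dots> < x v" using two pos[OF vu(2)] by (simp add: field_simps)
    finally show ?thesis .
  qed
  have zsu: "z s \<le> x u"
  proof -
    have "?r * z s \<le> 2 * x u" using zs xuv by simp
    also have "\<dots> \<le> ?r * x u" using two pos[OF vu(1)] by (intro mult_right_mono) auto
    finally show ?thesis using two by simp
  qed
  have sum: "nbr_sum ?E z t = nbr_sum E x t + (if t = u then z s - x s else 0)
    - (if t = u then x v else 0) - (if t = v then x u else 0)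
    + (if t = s then x v else 0) + (if t = v then z s else 0)" for t
    using nbr_sum_swap[OF G uv sv s(2), of z t] nbr_sum_update[OF G, of x s "(x u + x v) / ?r" t] sV s(2) vu
    by (simp add: z_def[symmetric] ts zu) (auto simp: z_def)
  show "rho V ?E < ?r"
  proof (rule rho_less[OF C', where z = z and w = u])
    fix t assume t: "t \<in> V"
    show "z t > 0" using pos[OF t] pos[OF vu(1)] pos[OF vu(2)] two by (auto simp: z_def)
    show "nbr_sum ?E z t \<le> ?r * z t"
      using eig[OF t] gap zsu vu sV s zs xs unfolding sum by (auto simp: z_def)
  next
    show "nbr_sum ?E z u < ?r * z u"
      using eig[OF vu(1)] gap vu sV unfolding sum by (auto simp: zu)
  qed (rule vu)
qed

lemma rho_split_branching_less:
  assumes C: "connected_graph V E"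
    and s: "(s, b) \<in> E" "(s, w1) \<in> E" "(s, w2) \<in> E" "distinct [b, w1, w2]"
    and s': "E `` {s'} = {w1}"
  shows "connected_graph V (swap_edge E s b s')" "rho V (swap_edge E s b s') < rho V E" "s' \<noteq> b"
proof -
  let ?r = "rho V E" and ?E = "swap_edge E s b s'"
  have G: "simple_graph V E" using C by (simp add: connected_graph_def)
  have V: "s \<in> V" "b \<in> V" "w1 \<in> V" "w2 \<in> V" "s \<noteq> b" "s \<noteq> w1" "s \<noteq> w2"
    using simple_graph_in_verts[OF G] s by auto
  have bs: "(b, s) \<in> E" by (rule simple_graph_symD[OF G s(1)])
  have sw: "(s', w1) \<in> E" using s' by auto
  have ws: "(w1, s') \<in> E" by (rule simple_graph_symD[OF G sw])
  have sV: "s' \<in> V" "s' \<noteq> w1" using simple_graph_in_verts[OF G sw] by auto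
  show s'b: "s' \<noteq> b" using bs s' V(6) by auto
  have ss: "s' \<noteq> s" using s s' by auto
  have sb: "(s', b) \<notin> E" using s' s by auto
  have ts: "(t, s') \<in> E \<longleftrightarrow> t = w1" for t
    using ws s' simple_graph_symD[OF G, of t s'] by auto
  have path: "(s, s') \<in> (E - {(s, b), (b, s)})\<^sup>*"
  proof (rule rtrancl_trans)
    show "(s, w1) \<in> (E - {(s, b), (b, s)})\<^sup>*" using s V by (intro r_into_rtrancl) auto
    show "(w1, s') \<in> (E - {(s, b), (b, s)})\<^sup>*" using s V ws by (intro r_into_rtrancl) auto
  qed
  show C': "connected_graph V ?E"
    by (rule connected_swap[OF C s(1) sV(1) s'b path])
  obtain x where x: "positive_eigenvector V E ?r x" using rho_eigenvector[OF C] .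
  have pos: "x t > 0" and eig: "nbr_sum E x t = ?r * x t" if "t \<in> V" for t
    using x that by (auto simp: positive_eigenvector_def)
  have "nbr_sum E x s > 0" unfolding nbr_sum_def
    using s simple_graph_finite_nbrs[OF G] simple_graph_in_verts[OF G]
    by (intro sum_pos) (auto intro: pos)
  then have r: "?r > 0" using eig[OF V(1)] pos[OF V(1)] by (simp add: zero_less_mult_iff)
  have xs: "?r * x s' = x w1" using eig[OF sV(1)] s' by (simp add: nbr_sum_def)
  have "(\<Sum>u\<in>{b, w1, w2}. x u) \<le> nbr_sum E x s" unfolding nbr_sum_def
    using s simple_graph_finite_nbrs[OF G] simple_graph_in_verts[OF G]
    by (intro sum_mono2) (auto intro!: less_imp_le pos)
  then have big: "x b + x w1 + x w2 \<le> ?r * x s" using s(4) eig[OF V(1)] by simp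
  \<comment> \<open>These entries solve the equations at s, which loses b, and at s', which gains b.
    At w1 the two changes by x b / rho cancel; at b the condition is that the entry at s' lies below
    x s, and the third neighbour w2 makes this strict through \<open>big\<close>.\<close>
  define ys where "ys = x s - x b / ?r"
  define ys' where "ys' = (x w1 + x b) / ?r"
  define z where "z = x(s := ys, s' := ys')"
  have rys: "?r * ys = ?r * x s - x b" "?r * ys' = x w1 + x b"
    using r by (auto simp: ys_def ys'_def field_simps)
  have yss: "ys' - x s' = x b / ?r" using rys(2) xs r by (simp add: field_simps)
  have ysp: "ys > 0" "ys' > 0"
  proof -
    have "?r * ys > 0" using rys big pos V by (smt (verit))
    then show "ys > 0" using r by (simp add: zero_less_mult_iff)
    show "ys' > 0" using r pos[OF V(2)] pos[OF V(3)] by (simp add: ys'_def)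
  qed
  have less: "x b / ?r + ys' < x s + x b / ?r"
  proof -
    have "?r * ys' < ?r * x s" using rys big pos[OF V(4)] by simp
    then show ?thesis using r by simp
  qed
  have sum: "nbr_sum ?E z t = nbr_sum E x t
    + (if (t, s) \<in> E then - (x b / ?r) else 0) + (if t = w1 then x b / ?r else 0)
    - (if t = s then x b else 0) - (if t = b then ys else 0)
    + (if t = s' then x b else 0) + (if t = b then ys' else 0)" for t
    using nbr_sum_swap[OF G s(1) sb s'b, of z t] nbr_sum_update[OF G, of "x(s := ys)" s' ys' t]
      nbr_sum_update[OF G, of x s ys t] V s'b ss yss
    by (simp add: z_def[symmetric] ts) (simp add: z_def ys_def)
  have sw1: "(w1, s) \<in> E" by (rule simple_graph_symD[OF G s(2)])
  have irr: "(s, s) \<notin> E" using simple_graph_in_verts[OF G] by blast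
  have s's: "(s', s) \<notin> E" using s' V by auto
  have xbr: "x b / ?r \<ge> 0" using r pos[OF V(2)] by simp
  show "rho V ?E < ?r"
  proof (rule rho_less[OF C', where z = z and w = b])
    fix t assume t: "t \<in> V"
    show "z t > 0" using pos[OF t] ysp by (auto simp: z_def)
    consider "t = s" | "t = s'" | "t = b" | "t = w1" | "t \<notin> {s, s', b, w1}" by blast
    then show "nbr_sum ?E z t \<le> ?r * z t"
    proof cases
      case 1 then show ?thesis using eig[OF t] V ss irr rys unfolding sum by (auto simp: z_def)
    next
      case 2 then show ?thesis using eig[OF t] sV s'b ss s's rys xs unfolding sum by (auto simp: z_def)
    next
      case 3 then show ?thesis using eig[OF t] V s'b s bs less unfolding sum
        by (auto simp: z_def ys_def)
    next
      case 4 then show ?thesis using eig[OF t] V sV s sw1 unfolding sum by (auto simp: z_def)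
    next
      case 5 then show ?thesis using eig[OF t] xbr unfolding sum by (auto simp: z_def)
    qed
  next
    show "nbr_sum ?E z b < ?r * z b"
      using eig[OF V(2)] V s'b s bs less unfolding sum by (auto simp: z_def ys_def)
  qed (rule V)
qed

section \<open>Minimal graphs with a prescribed vertex cover\<close>

definition covered_graphs :: "'a set \<Rightarrow> 'a set \<Rightarrow> 'a rel set" where
  "covered_graphs V W = {E. connected_graph V E \<and> (\<forall>u v. (u, v) \<in> E \<longrightarrow> u \<in> W \<or> v \<in> W)}"

definition private_leaves :: "'a rel \<Rightarrow> 'a set \<Rightarrow> 'a \<Rightarrow> 'a set" where
  "private_leaves E W u = {y \<in> E `` {u} - W. E `` {y} = {u}}"

text \<open>For nonempty \<open>W\<close> these are the graphs obtained from a tree on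
  \<open>W\<close> by subdividing every edge once and then hanging pendant vertices on vertices of
  \<open>W\<close>.\<close>

definition subdivided_tree :: "'a set \<Rightarrow> 'a rel \<Rightarrow> 'a set \<Rightarrow> bool" where
  "subdivided_tree V E W \<longleftrightarrow> connected_graph V E \<and> W \<subseteq> V \<and>
     E \<subseteq> W \<times> (V - W) \<union> (V - W) \<times> W \<and> (\<forall>s\<in>V - W. card (E `` {s}) \<le> 2) \<and> bridged E"

text \<open>Here d is the distance from c, and \<open>par v\<close> precedes v on a shortest walk.
  This is a spanning tree in functional form; the decreasing distance keeps two vertices from being
  each other's parent.\<close>

lemma connected_graph_parent:
  assumes C: "connected_graph V E" and r: "c \<in> V"
  obtains par d where "\<And>v. v \<in> V \<Longrightarrow> v \<noteq> c \<Longrightarrow> (par v, v) \<in> E \<and> d (par v) < (d v :: nat)"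
proof -
  define d where "d v = (LEAST m. (c, v) \<in> E ^^ m)" for v
  have "\<exists>p. (p, v) \<in> E \<and> d p < d v" if v: "v \<in> V" "v \<noteq> c" for v
  proof -
    have "(c, v) \<in> E\<^sup>*" using C r v by (auto simp: connected_graph_def)
    then have "\<exists>m. (c, v) \<in> E ^^ m" by (simp add: rtrancl_is_UN_relpow)
    then have *: "(c, v) \<in> E ^^ d v" unfolding d_def by (rule LeastI_ex)
    then have "d v \<noteq> 0" using v by (intro notI) auto
    then obtain m where m: "d v = Suc m" using not0_implies_Suc by blast
    with * obtain p where p: "(c, p) \<in> E ^^ m" "(p, v) \<in> E" by auto
    have "d p \<le> m" unfolding d_def using p(1) by (rule Least_le)
    with m p show ?thesis by (intro exI[of _ p]) simp
  qed
  then obtain par where "\<And>v. v \<in> V \<Longrightarrow> v \<noteq> c \<Longrightarrow> (par v, v) \<in> E \<and> d (par v) < d v" by metis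
  with that show ?thesis by blast
qed

text \<open>Every vertex other than the root owns the edge to its parent, and the cover lets this
  edge be oriented so that it starts in \<open>W\<close>; distinct vertices give distinct arcs. An
  edge inside \<open>W\<close> contributes both orientations, of which at most one is owned.\<close>

lemma sum_degree_cover:
  assumes E: "E \<in> covered_graphs V W" and W: "W \<subseteq> V"
  shows "card V - 1 \<le> (\<Sum>w\<in>W. card (E `` {w}))"
    and "(a, b) \<in> E \<Longrightarrow> a \<in> W \<Longrightarrow> b \<in> W \<Longrightarrow> card V \<le> (\<Sum>w\<in>W. card (E `` {w}))"
proof -
  have C: "connected_graph V E" and cov: "\<And>u v. (u, v) \<in> E \<Longrightarrow> u \<in> W \<or> v \<in> W"
    using E by (auto simp: covered_graphs_def)
  have G: "simple_graph V E" and fin: "finite V" "finite W" using C W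
    by (auto simp: connected_graph_def simple_graph_def intro: finite_subset)
  obtain c where c: "c \<in> V" using C by (auto simp: connected_graph_def)
  obtain par d where par: "\<And>v. v \<in> V \<Longrightarrow> v \<noteq> c \<Longrightarrow> (par v, v) \<in> E \<and> d (par v) < (d v :: nat)"
    using connected_graph_parent[OF C c] by metis
  define f where "f v = (if v \<in> W then (v, par v) else (par v, v))" for v
  define A where "A = (SIGMA w:W. E `` {w})"
  have cA: "card A = (\<Sum>w\<in>W. card (E `` {w}))" unfolding A_def
    using fin simple_graph_finite_nbrs[OF G] by simp
  have finA: "finite A" unfolding A_def
    using fin simple_graph_finite_nbrs[OF G] by simp
  have sub: "f ` (V - {c}) \<subseteq> A"
  proof
    fix e assume "e \<in> f ` (V - {c})"
    then obtain v where v: "v \<in> V" "v \<noteq> c" "e = f v" by blast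
    have "(par v, v) \<in> E" "(v, par v) \<in> E" using par[OF v(1,2)] simple_graph_symD[OF G] by auto
    then show "e \<in> A" using cov[of "par v" v] v(3) by (auto simp: f_def A_def)
  qed
  have inj: "inj_on f (V - {c})"
  proof (rule inj_onI)
    fix v v' assume *: "v \<in> V - {c}" "v' \<in> V - {c}" "f v = f v'"
    then show "v = v'"
      using par[of v] par[of v'] by (auto simp: f_def split: if_splits)
  qed
  have cf: "card (f ` (V - {c})) = card V - 1"
    using card_image[OF inj] c fin by simp
  show "card V - 1 \<le> (\<Sum>w\<in>W. card (E `` {w}))"
    using card_mono[OF finA sub] cf cA by simp
  assume ab: "(a, b) \<in> E" "a \<in> W" "b \<in> W"
  then have ba: "(b, a) \<in> E" using simple_graph_symD[OF G] by blast
  have "(a, b) \<notin> f ` (V - {c}) \<or> (b, a) \<notin> f ` (V - {c})"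
  proof (rule ccontr)
    assume "\<not> ?thesis"
    then obtain v v' where v: "v \<in> V - {c}" "(a, b) = f v" "v' \<in> V - {c}" "(b, a) = f v'" by blast
    then have "v = a" "par a = b" "v' = b" "par b = a" using ab by (auto simp: f_def split: if_splits)
    then show False using par[of a] par[of b] v by simp
  qed
  moreover have "(a, b) \<in> A" "(b, a) \<in> A" using ab ba by (auto simp: A_def)
  ultimately have "f ` (V - {c}) \<subset> A" using sub by blast
  from psubset_card_mono[OF finA this] show "card V \<le> (\<Sum>w\<in>W. card (E `` {w}))"
    using cf cA by simp
qed

text \<open>The vertices u, y, w, y' would close a triangle or a 4-cycle; the disjunctions allow one
  neighbour of u to coincide with w.\<close>

lemma bridged_no_short_cycle:
  assumes B: "bridged E" and G: "simple_graph V E"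
    and "(u, y) \<in> E" "(u, y') \<in> E" "y \<noteq> y'" "w \<noteq> u"
    and "y = w \<or> (y, w) \<in> E" "y' = w \<or> (y', w) \<in> E"
  shows False
proof -
  let ?E = "E - {(u, y), (y, u)}"
  have ne: "u \<noteq> y" "u \<noteq> y'" using assms simple_graph_in_verts[OF G] by auto
  have "(u, y') \<in> ?E" using assms ne by auto
  moreover have "(y', w) \<in> ?E\<^sup>*" using assms ne by (auto intro: r_into_rtrancl)
  moreover have "(w, y) \<in> ?E\<^sup>*"
    using assms ne simple_graph_symD[OF G] by (auto intro: r_into_rtrancl)
  ultimately have "(u, y) \<in> ?E\<^sup>*" by (meson converse_rtrancl_into_rtrancl rtrancl_trans)
  with B assms(3) show False by (auto simp: bridged_def)
qed

text \<open>A neighbour of u that is not a private leaf leads to a second cover vertex, possibly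
  itself, and in a tree distinct neighbours lead to distinct ones. A branching neighbour outside
  \<open>W\<close> leads to two further cover vertices but uses up only one, which saves one
  more.\<close>

lemma card_shared_nbrs:
  assumes E: "E \<in> covered_graphs V W" and B: "bridged E" and W: "W \<subseteq> V" "u \<in> W"
  shows "card (E `` {u} - private_leaves E W u) \<le> card W - 1"
    and "\<lbrakk>s \<in> E `` {u} - W; 3 \<le> card (E `` {s})\<rbrakk> \<Longrightarrow>
      card (E `` {u} - private_leaves E W u) \<le> card W - 2"
proof -
  have C: "connected_graph V E" and cov: "\<And>u v. (u, v) \<in> E \<Longrightarrow> u \<in> W \<or> v \<in> W"
    using E by (auto simp: covered_graphs_def)
  have G: "simple_graph V E" and fin: "finite W" using C W
    by (auto simp: connected_graph_def simple_graph_def intro: finite_subset)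
  let ?N = "E `` {u} - private_leaves E W u"
  have "\<exists>w. w \<in> W \<and> w \<noteq> u \<and> (y = w \<or> (y, w) \<in> E)" if y: "y \<in> ?N" for y
  proof (cases "y \<in> W")
    case True
    then show ?thesis using y simple_graph_in_verts[OF G, of u y] by auto
  next
    case False
    then have "E `` {y} \<noteq> {u}" using y by (auto simp: private_leaves_def)
    moreover have "u \<in> E `` {y}" using y simple_graph_symD[OF G] by auto
    ultimately obtain w where "(y, w) \<in> E" "w \<noteq> u" by auto
    then show ?thesis using cov[of y w] False by auto
  qed
  then obtain g where g: "\<And>y. y \<in> ?N \<Longrightarrow> g y \<in> W \<and> g y \<noteq> u \<and> (y = g y \<or> (y, g y) \<in> E)" by metis
  have inj: "inj_on g ?N"
  proof (rule inj_onI, rule ccontr)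
    fix y y' assume *: "y \<in> ?N" "y' \<in> ?N" "g y = g y'" "y \<noteq> y'"
    show False
      by (rule bridged_no_short_cycle[OF B G, of u y y' "g y"]) (use * g[OF *(1)] g[OF *(2)] in auto)
  qed
  have "card ?N = card (g ` ?N)" using card_image[OF inj] by simp
  also have "\<dots> \<le> card (W - {u})" using g fin by (intro card_mono) auto
  finally show "card ?N \<le> card W - 1" using W fin by simp
  assume s: "s \<in> E `` {u} - W" "3 \<le> card (E `` {s})"
  then have "card {u, g s} < card (E `` {s})"
    by (auto simp: card_insert_if)
  then have "\<not> E `` {s} \<subseteq> {u, g s}" by (meson card_mono finite.intros linorder_not_less)
  \<comment> \<open>A third neighbour of s besides u and the chosen \<open>g s\<close>; acyclicity
    keeps it out of the image of g.\<close>
  then obtain w where w: "(s, w) \<in> E" "w \<noteq> u" "w \<noteq> g s" by auto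
  then have wW: "w \<in> W" using cov[of s w] s by auto
  have "E `` {s} \<noteq> {u}" using s(2) by auto
  then have sN: "s \<in> ?N" using s by (auto simp: private_leaves_def)
  have "w \<notin> g ` ?N"
  proof
    assume "w \<in> g ` ?N"
    then obtain y where y: "y \<in> ?N" "w = g y" by blast
    show False
      by (rule bridged_no_short_cycle[OF B G, of u y s w]) (use y sN g[OF y(1)] w in auto)
  qed
  then have sub: "g ` ?N \<subseteq> W - {u, w}" using g by blast
  have "card ?N = card (g ` ?N)" using card_image[OF inj] by simp
  also have "\<dots> \<le> card (W - {u, w})" using sub fin by (intro card_mono) auto
  also have "\<dots> = card W - 2" using W wW w(2) fin by (subst card_Diff_subset) auto
  finally show "card ?N \<le> card W - 2" .
qed

section \<open>Degrees of cover vertices at large order, and the shape of minimal graphs\<close>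

locale large_order =
  fixes n k q r :: nat
  assumes k2: "2 \<le> k" and rk: "r < k" and nq: "n + 1 = k * q + r" and q_large: "3 * k \<le> q + r + 1"
begin

lemma q_ge: "2 * k \<le> q" using rk q_large by linarith

lemma sum_bound_split:
  fixes d :: "'a \<Rightarrow> nat"
  assumes "finite W" "card W = k" "w \<in> W" "\<And>v. v \<in> W \<Longrightarrow> d v \<le> q + c"
  shows "(\<Sum>v\<in>W. d v) \<le> d w + (k - 1) * (q + c)"
proof -
  have "(\<Sum>v\<in>W. d v) = d w + (\<Sum>v\<in>W - {w}. d v)" using assms by (simp add: sum.remove)
  also have "(\<Sum>v\<in>W - {w}. d v) \<le> (\<Sum>v\<in>W - {w}. q + c)" using assms by (intro sum_mono) auto
  also have "\<dots> = (k - 1) * (q + c)" using assms by simp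
  finally show ?thesis by simp
qed

text \<open>All degrees but one are capped, so the sum bounds the remaining one from below. With cap
  q + 2 this gives k - 1, which reaches three only for k >= 4; the caps q for k = 2 and q + 1 for k
  = 3 settle the small cases.\<close>

lemma degree_lower_bounds:
  fixes d :: "'a \<Rightarrow> nat"
  assumes W: "finite W" "card W = k" "w \<in> W" and d: "\<And>v. v \<in> W \<Longrightarrow> d v \<le> q + min 2 (k - 2)"
    and sum: "n - 1 \<le> (\<Sum>v\<in>W. d v)"
  shows "q + r \<le> d w + 2 * k" "3 \<le> d w" "k - 1 \<le> d w"
    and "n \<le> (\<Sum>v\<in>W. d v) \<Longrightarrow> k \<le> d w"
proof -
  obtain j where j: "k = j + 2" using k2 nat_le_iff_add by (metis add.commute)
  have e: "(k - 1) * (q + 2) = k * q + 2 * k - q - 2" "(k - 1) * (q + 2) + q + 2 = k * q + 2 * k"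
    using j by (auto simp: algebra_simps)
  have d2: "\<And>v. v \<in> W \<Longrightarrow> d v \<le> q + 2" using d by (meson add_left_mono min.cobounded1 order_trans)
  have b: "(\<Sum>v\<in>W. d v) \<le> d w + (k - 1) * (q + 2)"
    by (rule sum_bound_split[where d = d, OF W d2])
  show 1: "q + r \<le> d w + 2 * k" using b sum nq e(2) by linarith
  show 2: "k - 1 \<le> d w" using 1 q_large by linarith
  show "k \<le> d w" if "n \<le> (\<Sum>v\<in>W. d v)" using b that nq e(2) q_large by linarith
  show "3 \<le> d w"
  proof -
    consider "k = 2" | "k = 3" | "k \<ge> 4" using k2 by linarith
    then show ?thesis
    proof cases
      case 1
      then show ?thesis using sum_bound_split[OF W, of d "min 2 (k - 2)"] d sum nq q_large by simp
    next
      case 2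
      then show ?thesis using sum_bound_split[OF W, of d "min 2 (k - 2)"] d sum nq q_large by simp
    next
      case 3
      then show ?thesis using 2 by linarith
    qed
  qed
qed

lemma degree_upper_bound:
  assumes C: "connected_graph V E" and b: "(rho V E)\<^sup>2 < q + min 3 (k - 1)" and v: "v \<in> V"
  shows "card (E `` {v}) \<le> q + min 2 (k - 2)"
proof -
  have "real (card (E `` {v})) < real (q + min 3 (k - 1))"
    using degree_le_rho_square[OF C v] b by linarith
  then have "card (E `` {v}) < q + min 3 (k - 1)" by (simp only: of_nat_less_iff)
  then show ?thesis using k2 by linarith
qed

text \<open>Deletion is treated first, because the count of private leaves that feeds both swaps
  needs a tree.\<close>

lemma minimal_covered_is_subdivided_tree:
  assumes V: "card V = n" "W \<subseteq> V" "card W = k" and E: "E \<in> covered_graphs V W"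
    and min: "\<And>E'. E' \<in> covered_graphs V W \<Longrightarrow> rho V E \<le> rho V E'"
    and b: "(rho V E)\<^sup>2 < q + min 3 (k - 1)"
  shows "subdivided_tree V E W"
proof -
  have C: "connected_graph V E" and cov: "\<And>u v. (u, v) \<in> E \<Longrightarrow> u \<in> W \<or> v \<in> W"
    using E by (auto simp: covered_graphs_def)
  have G: "simple_graph V E" and fin: "finite W" using C V
    by (auto simp: connected_graph_def simple_graph_def intro: finite_subset)
  have bridged: "bridged E" unfolding bridged_def
  proof (intro allI impI notI)
    fix a b assume ab: "(a, b) \<in> E" "(a, b) \<in> (E - {(a, b), (b, a)})\<^sup>*"
    have C': "connected_graph V (E - {(a, b), (b, a)})" by (rule connected_delete[OF C ab(2)])
    then have "E - {(a, b), (b, a)} \<in> covered_graphs V W" using cov by (auto simp: covered_graphs_def)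
    from min[OF this] rho_delete_less[OF C ab(1) C'] show False by simp
  qed
  have up: "card (E `` {w}) \<le> q + min 2 (k - 2)" if "w \<in> W" for w
    using degree_upper_bound[OF C b] that V by auto
  note low = degree_lower_bounds[where d = "\<lambda>w. card (E `` {w})", OF fin V(3) _ up]
  have leaf: "private_leaves E W w \<noteq> {}" if "w \<in> W" "card (E `` {w} - private_leaves E W w) < card (E `` {w})" for w
    using that by auto
  have indep: False if uv: "(u, v) \<in> E" "u \<in> W" "v \<in> W" for u v
  proof -
    \<comment> \<open>The inner edge raises the bound on the degree sum by one, so every degree is
      at least k instead of k - 1, more than the number of neighbours that are not private
      leaves.\<close>
    have sum: "n \<le> (\<Sum>w\<in>W. card (E `` {w}))" using sum_degree_cover(2)[OF E V(2) uv] V by simp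
    have has: "private_leaves E W w \<noteq> {}" if "w \<in> W" for w
    proof (rule leaf[OF that])
      have "k \<le> card (E `` {w})" using low(4)[OF that] sum by simp
      then show "card (E `` {w} - private_leaves E W w) < card (E `` {w})"
        using card_shared_nbrs(1)[OF E bridged V(2) that] V k2 by linarith
    qed
    \<comment> \<open>Otherwise n <= 3 k, against n + 1 >= k q and q >= 4. Degree 4 gives rho >= 2,
      as the subdivision requires.\<close>
    have "\<exists>w\<in>W. 4 \<le> card (E `` {w})"
    proof (rule ccontr)
      assume "\<not> ?thesis"
      then have "(\<Sum>w\<in>W. card (E `` {w})) \<le> (\<Sum>w\<in>W. 3)" by (intro sum_mono) auto
      then have "n \<le> k * 3" using sum V by simp
      moreover have "k * 4 \<le> k * q" using q_ge k2 by (intro mult_le_mono2) linarith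
      ultimately show False using nq k2 by linarith
    qed
    then obtain w where w: "w \<in> W" "4 \<le> card (E `` {w})" by blast
    then have "4 \<le> (rho V E)\<^sup>2" using degree_le_rho_square[OF C, of w] V by force
    then have two: "2 \<le> rho V E"
      using rho_nonneg[OF C] by (intro power2_le_imp_le[of 2]) auto
    obtain x where x: "positive_eigenvector V E (rho V E) x" using rho_eigenvector[OF C] .
    \<comment> \<open>The leaf is taken at the end with the larger Perron entry; one of the two
      orientations of uv qualifies.\<close>
    have *: False if ab: "(a, b) \<in> E" "a \<in> W" "b \<in> W" "x b \<le> x a" for a b
    proof -
      obtain s where s: "s \<notin> W" "E `` {s} = {a}" using has[OF ab(2)] by (auto simp: private_leaves_def)
      have sb: "s \<noteq> b" using s ab by auto
      note less = rho_subdivide_less[OF C x ab(1) s(2) sb ab(4) two]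
      have "swap_edge E a b s \<in> covered_graphs V W"
        using less(1) cov ab by (auto simp: covered_graphs_def swap_edge_def)
      from min[OF this] less(2) show False by simp
    qed
    show False
      using *[OF uv] *[OF simple_graph_symD[OF G uv(1)] uv(3,2)] by linarith
  qed
  have deg2: "card (E `` {s}) \<le> 2" if s: "s \<in> V - W" for s
  proof (rule ccontr)
    assume "\<not> ?thesis"
    then have three: "3 \<le> card (E `` {s})" by simp
    then obtain B where "B \<subseteq> E `` {s}" "card B = 3" by (meson obtain_subset_with_card_n)
    then obtain b w1 w2 where w: "(s, b) \<in> E" "(s, w1) \<in> E" "(s, w2) \<in> E" "distinct [b, w1, w2]"
      by (auto simp: card_3_iff)
    have bW: "b \<in> W" "w1 \<in> W" using cov[OF w(1)] cov[OF w(2)] s by auto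
    have ws: "s \<in> E `` {w1} - W" using simple_graph_symD[OF G w(2)] s by auto
    \<comment> \<open>Here only degree k - 1 is available, but the branching neighbour s lowers the
      number of non-private neighbours to k - 2.\<close>
    have "private_leaves E W w1 \<noteq> {}"
    proof (rule leaf[OF bW(2)])
      have "k - 1 \<le> card (E `` {w1})"
        using low(3)[OF bW(2)] sum_degree_cover(1)[OF E V(2)] V by simp
      then show "card (E `` {w1} - private_leaves E W w1) < card (E `` {w1})"
        using card_shared_nbrs(2)[OF E bridged V(2) bW(2) ws three] V k2 by linarith
    qed
    then obtain s' where s': "E `` {s'} = {w1}" by (auto simp: private_leaves_def)
    note less = rho_split_branching_less[OF C w s']
    have "swap_edge E s b s' \<in> covered_graphs V W"
      using less(1) cov bW by (auto simp: covered_graphs_def swap_edge_def)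
    from min[OF this] less(2) show False by simp
  qed
  have "E \<subseteq> W \<times> (V - W) \<union> (V - W) \<times> W"
    using indep cov simple_graph_in_verts[OF G] by auto
  with C V bridged deg2 show ?thesis by (auto simp: subdivided_tree_def)
qed

end

section \<open>A caterpillar of small spectral radius\<close>

abbreviation image_rel :: "('a \<Rightarrow> 'b) \<Rightarrow> 'a rel \<Rightarrow> 'b rel" where
  "image_rel f E \<equiv> map_prod f f ` E"

lemma image_rel_nbrs:
  assumes "simple_graph V E" "inj_on f V" "v \<in> V"
  shows "image_rel f E `` {f v} = f ` (E `` {v})"
proof -
  have "E \<subseteq> V \<times> V" using assms by (simp add: simple_graph_def)
  then show ?thesis using assms(2,3) by (fastforce dest: inj_onD simp: map_prod_def)
qed

lemma simple_graph_image:
  assumes "simple_graph V E" "inj_on f V"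
  shows "simple_graph (f ` V) (image_rel f E)"
  using assms by (fastforce simp: simple_graph_def irrefl_def intro!: symI dest: symD inj_onD)

lemma connected_graph_image:
  assumes C: "connected_graph V E" and f: "inj_on f V"
  shows "connected_graph (f ` V) (image_rel f E)"
proof -
  have "(f u, f v) \<in> (image_rel f E)\<^sup>*" if "(u, v) \<in> E\<^sup>*" for u v
    using that
  proof (induction rule: rtrancl_induct)
    case (step y z)
    then have "(f y, f z) \<in> image_rel f E" by force
    with step show ?case by (meson rtrancl_into_rtrancl)
  qed simp
  then show ?thesis using C simple_graph_image[OF _ f] by (auto simp: connected_graph_def)
qed

lemma rho_image:
  assumes C: "connected_graph V E" and f: "inj_on f V"
  shows "rho (f ` V) (image_rel f E) = rho V E"
proof -
  obtain x where x: "positive_eigenvector V E (rho V E) x" using rho_eigenvector[OF C] .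
  have G: "simple_graph V E" using C by (simp add: connected_graph_def)
  define y where "y = x \<circ> the_inv_into V f"
  have y: "y (f v) = x v" if "v \<in> V" for v using that f by (simp add: y_def the_inv_into_f_f)
  have "nbr_sum (image_rel f E) y (f v) = nbr_sum E x v" if v: "v \<in> V" for v
  proof -
    have sub: "E `` {v} \<subseteq> V" using G by (auto simp: simple_graph_def)
    have "nbr_sum (image_rel f E) y (f v) = (\<Sum>u\<in>E `` {v}. y (f u))"
      unfolding nbr_sum_def image_rel_nbrs[OF G f v]
      using inj_on_subset[OF f sub] by (simp add: sum.reindex)
    also have "\<dots> = nbr_sum E x v" unfolding nbr_sum_def using y sub by (intro sum.cong) auto
    finally show ?thesis .
  qed
  then have "positive_eigenvector (f ` V) (image_rel f E) (rho V E) y"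
    using x y by (auto simp: positive_eigenvector_def)
  then show ?thesis
    using connected_graph_image[OF C f] by (intro rho_eqI) (auto simp: connected_graph_def)
qed

lemma covered_graphs_image:
  assumes "E \<in> covered_graphs V W" "inj_on f V"
  shows "image_rel f E \<in> covered_graphs (f ` V) (f ` W)"
  using assms connected_graph_image[of V E f] unfolding covered_graphs_def by fastforce

section \<open>The caterpillar, and existence of a minimum below its spectral radius\<close>

context large_order
begin

text \<open>
  The vertices below \<open>k\<close> form the cover, those from \<open>k\<close> to \<open>2 k - 2\<close> link consecutive cover
  vertices, and the rest are leaves dealt out cyclically. The offset \<open>3\<close> makes the cover vertex
  \<open>1\<close> the last to receive an extra leaf; this gives the sharper bounds for \<open>k = 2\<close> and \<open>k = 3\<close>,
  without which the cover vertices of a minimizer need not have degree at least three.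
\<close>

definition path_nbrs :: "nat \<Rightarrow> nat set" where
  "path_nbrs s = (if s < 2 * k - 1 then {s - k, s - k + 1} else {(s + 3) mod k})"

definition path_edges :: "nat rel" where
  "path_edges = {(s, w). s \<in> {k..<n} \<and> w \<in> path_nbrs s} \<union> {(w, s). s \<in> {k..<n} \<and> w \<in> path_nbrs s}"

lemma path_nbrs_less: "s \<in> {k..<n} \<Longrightarrow> w \<in> path_nbrs s \<Longrightarrow> w < k"
  using k2 by (auto simp: path_nbrs_def split: if_splits)

lemma n_ge: "4 * k \<le> n + 1"
proof -
  have "k * 4 \<le> k * q" using q_ge k2 by (intro mult_le_mono2) linarith
  then show ?thesis using nq by linarith
qed

lemma path_edges_connected: "connected_graph {..<n} path_edges"
proof -
  have G: "simple_graph {..<n} path_edges"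
    unfolding simple_graph_def
  proof (intro conjI)
    show "path_edges \<subseteq> {..<n} \<times> {..<n}"
      using path_nbrs_less n_ge k2 by (fastforce simp: path_edges_def)
    show "irrefl path_edges" using path_nbrs_less by (fastforce simp: path_edges_def irrefl_def)
  qed (auto simp: path_edges_def intro!: symI)
  have sym: "sym path_edges" using G by (simp add: simple_graph_def)
  have low: "(w, 0) \<in> path_edges\<^sup>*" if "w < k" for w
    using that
  proof (induction w)
    case (Suc w)
    then have "(Suc w, k + w) \<in> path_edges" "(k + w, w) \<in> path_edges"
      using n_ge by (auto simp: path_edges_def path_nbrs_def)
    with Suc show ?case by (meson Suc_lessD converse_rtrancl_into_rtrancl)
  qed simp
  have all: "(v, 0) \<in> path_edges\<^sup>*" if v: "v < n" for v
  proof (cases "v < k")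
    case False
    have "path_nbrs v \<noteq> {}" by (simp add: path_nbrs_def)
    then obtain w where w: "w \<in> path_nbrs v" by blast
    then have "(v, w) \<in> path_edges" using False v by (auto simp: path_edges_def)
    moreover have "w < k" using path_nbrs_less[OF _ w] False v by simp
    ultimately show ?thesis using low by (meson converse_rtrancl_into_rtrancl)
  qed (rule low)
  have "(u, v) \<in> path_edges\<^sup>*" if "u < n" "v < n" for u v
    using all[OF that(1)] rtrancl_symmetric[OF sym all[OF that(2)]] by (rule rtrancl_trans)
  moreover have "0 \<in> {..<n}" using n_ge k2 by simp
  ultimately show ?thesis using G by (auto simp: connected_graph_def)
qed

lemma path_edges_nbrs_high: "s \<in> {k..<n} \<Longrightarrow> path_edges `` {s} = path_nbrs s"
  using path_nbrs_less by (fastforce simp: path_edges_def)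

lemma path_edges_nbrs_low: "w < k \<Longrightarrow> path_edges `` {w} = {s \<in> {k..<n}. w \<in> path_nbrs s}"
  using path_nbrs_less by (fastforce simp: path_edges_def)

definition path_leaves :: "nat \<Rightarrow> nat set" where
  "path_leaves w = {s \<in> {2 * k - 1..<n}. (s + 3) mod k = w}"

definition path_links :: "nat \<Rightarrow> nat set" where
  "path_links w = {s \<in> {k..<2 * k - 1}. w = s - k \<or> w = s - k + 1}"

text \<open>Leaves at the same cover vertex differ in the quotient of s + 3 by k, so it suffices to
  count quotients. As s + 3 runs from 2 k + 2 to k q + r + 1, they lie in {2..q} for residue at
  least 2, in {3..q} for residue 1 and in {3..q + 1} for residue 0.\<close>

lemma card_path_leaves:
  assumes w: "w < k"
  shows "card (path_leaves w) \<le> q - 1" "w = 1 \<Longrightarrow> card (path_leaves w) \<le> q - 2"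
proof -
  have inj: "inj_on (\<lambda>s. (s + 3) div k) (path_leaves w)"
  proof (rule inj_onI)
    fix s t assume "s \<in> path_leaves w" "t \<in> path_leaves w" "(s + 3) div k = (t + 3) div k"
    then have "s + 3 = t + 3"
      by (metis (mono_tags, lifting) mem_Collect_eq mult_div_mod_eq path_leaves_def)
    then show "s = t" by simp
  qed
  have rng: "\<exists>m. s + 3 = k * m + w \<and> (s + 3) div k = m" if "s \<in> path_leaves w" for s
    using that mult_div_mod_eq[of k "s + 3"] by (auto simp: path_leaves_def)
  have lo: "2 * k + 2 \<le> s + 3" and hi: "s + 3 \<le> k * q + r + 1" if "s \<in> path_leaves w" for s
    using that k2 nq by (auto simp: path_leaves_def)
  have m_hi: "m \<le> q" if "k * m + w \<le> k * q + r + 1" "w \<noteq> 0" for m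
  proof (rule ccontr)
    assume "\<not> m \<le> q"
    then have "k * (q + 1) \<le> k * m" by (intro mult_le_mono2) simp
    then show False using that rk by simp
  qed
  have m_hi0: "m \<le> q + 1" if "k * m + w \<le> k * q + r + 1" for m
  proof (rule ccontr)
    assume "\<not> m \<le> q + 1"
    then have "k * (q + 2) \<le> k * m" by (intro mult_le_mono2) simp
    then show False using that rk k2 by (simp add: algebra_simps)
  qed
  have m_lo: "2 \<le> m" if "2 * k + 2 \<le> k * m + w" for m
  proof (rule ccontr)
    assume "\<not> 2 \<le> m"
    then have "k * m \<le> k * 1" by (intro mult_le_mono2) simp
    then show False using that w unfolding mult_1_right by linarith
  qed
  have m_lo1: "3 \<le> m" if "2 * k + 2 \<le> k * m + w" "w \<le> 1" for m
  proof (rule ccontr)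
    assume "\<not> 3 \<le> m"
    then have "k * m \<le> k * 2" by (intro mult_le_mono2) simp
    then show False using that by linarith
  qed
  have bound: "card (path_leaves w) \<le> card A" if "finite A" "\<And>m. 2 * k + 2 \<le> k * m + w \<Longrightarrow> k * m + w \<le> k * q + r + 1 \<Longrightarrow> m \<in> A" for A
  proof (rule card_inj_on_le[OF inj _ that(1)])
    show "(\<lambda>s. (s + 3) div k) ` path_leaves w \<subseteq> A"
    proof
      fix m assume "m \<in> (\<lambda>s. (s + 3) div k) ` path_leaves w"
      then obtain s where s: "s \<in> path_leaves w" "m = (s + 3) div k" by blast
      then show "m \<in> A" using rng[OF s(1)] lo[OF s(1)] hi[OF s(1)] that(2)[of m] by auto
    qed
  qed
  have q4: "4 \<le> q" using q_ge k2 by linarith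
  show "card (path_leaves w) \<le> q - 2" if "w = 1"
    using bound[of "{3..q}"] m_hi m_lo1 that by simp
  show "card (path_leaves w) \<le> q - 1"
  proof (cases "w = 0")
    case True
    then show ?thesis using bound[of "{3..q + 1}"] m_hi0 m_lo1 q4 by simp
  next
    case False
    then show ?thesis using bound[of "{2..q}"] m_hi m_lo q4 by simp
  qed
qed

lemma card_path_links:
  "card (path_links w) \<le> 2" "w = 0 \<or> w = k - 1 \<Longrightarrow> card (path_links w) \<le> 1"
proof -
  have "path_links w \<subseteq> {k + w, k + w - 1}" by (auto simp: path_links_def)
  then have "card (path_links w) \<le> card {k + w, k + w - 1}" by (intro card_mono) auto
  also have "\<dots> \<le> 2" by (simp add: card_insert_if)
  finally show "card (path_links w) \<le> 2" .
  assume w: "w = 0 \<or> w = k - 1"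
  then have "path_links w \<subseteq> {if w = 0 then k else 2 * k - 2}" using k2 by (auto simp: path_links_def)
  then have "card (path_links w) \<le> card {if w = 0 then k else 2 * k - 2}" by (intro card_mono) auto
  then show "card (path_links w) \<le> 1" by simp
qed

text \<open>With B the biadjacency matrix whose rows are the cover vertices, this is the row sum of
  B B^T at w: leaves count once, links twice.\<close>

lemma sum_card_path_nbrs:
  assumes w: "w < k"
  shows "(\<Sum>s\<in>path_edges `` {w}. card (path_nbrs s)) = card (path_leaves w) + 2 * card (path_links w)"
proof -
  have fin: "finite (path_leaves w)" "finite (path_links w)" by (auto simp: path_leaves_def path_links_def)
  have eq: "path_edges `` {w} = path_leaves w \<union> path_links w"
    unfolding path_edges_nbrs_low[OF w] using n_ge k2
    by (auto simp: path_nbrs_def path_leaves_def path_links_def split: if_splits)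
  have disj: "path_leaves w \<inter> path_links w = {}" by (auto simp: path_leaves_def path_links_def)
  have "(\<Sum>s\<in>path_leaves w. card (path_nbrs s)) = card (path_leaves w)"
    by (simp add: path_nbrs_def path_leaves_def)
  moreover have "(\<Sum>s\<in>path_links w. card (path_nbrs s)) = 2 * card (path_links w)"
    by (simp add: path_nbrs_def path_links_def)
  ultimately show ?thesis unfolding eq sum.union_disjoint[OF fin disj] by simp
qed

text \<open>The number b bounds all row sums of B B^T, so the all-ones vector on the cover is a
  supersolution; the entries outside the cover make the equations there exact. In general a row sum
  is at most (q - 1) + 4. For k = 2 each cover vertex has a single link, and for k = 3 the only one
  with two links is vertex 1, which has fewer leaves.\<close>

lemma rho_path_edges: "(rho {..<n} path_edges)\<^sup>2 < q + min 3 (k - 1)"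
proof -
  define b where "b = real (q + min 3 (k - 1))"
  define z where "z v = (if v < k then 1 else real (card (path_nbrs v)) / sqrt b)" for v
  have bpos: "b > 0" using q_ge k2 by (simp add: b_def)
  have q4: "4 \<le> q" using q_ge k2 by linarith
  have row: "card (path_leaves w) + 2 * card (path_links w) \<le> q + min 3 (k - 1)" if wk: "w < k" for w
  proof -
    note b = card_path_leaves[OF wk] card_path_links[of w]
    consider "k = 2" "w = 0 \<or> w = k - 1" | "k = 3" "w = 0 \<or> w = k - 1" | "k = 3" "w = 1" | "k \<ge> 4"
      using wk k2 by linarith
    then show ?thesis
    proof cases
      case 1 then show ?thesis using b(1) b(4)[OF 1(2)] q4 by simp
    next
      case 2 then show ?thesis using b(1) b(4)[OF 2(2)] q4 by simp
    next
      case 3 then show ?thesis using b(2)[OF 3(2)] b(3) q4 by simp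
    next
      case 4 then show ?thesis using b(1,3) q4 by simp
    qed
  qed
  \<comment> \<open>A row with sum below b: for k = 2 vertex 1 with its fewer leaves, otherwise the
    end 0 with its single link.\<close>
  define w0 where "w0 = (if k = 2 then 1 else 0 :: nat)"
  have w0: "w0 < k" using k2 by (simp add: w0_def)
  have strict: "card (path_leaves w0) + 2 * card (path_links w0) < q + min 3 (k - 1)"
    using card_path_leaves[OF w0] card_path_links[of w0] q4 k2 by (auto simp: w0_def split: if_splits)
  have nlow: "nbr_sum path_edges z w = real (card (path_leaves w) + 2 * card (path_links w)) / sqrt b"
    if "w < k" for w
  proof -
    have "nbr_sum path_edges z w = (\<Sum>s\<in>path_edges `` {w}. real (card (path_nbrs s)) / sqrt b)"
      unfolding nbr_sum_def by (rule sum.cong) (use path_edges_nbrs_low[OF that] in \<open>auto simp: z_def\<close>)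
    then show ?thesis
      using sum_card_path_nbrs[OF that] by (simp add: sum_divide_distrib[symmetric] flip: of_nat_sum)
  qed
  have nhigh: "nbr_sum path_edges z s = sqrt b * z s" if s: "s \<in> {k..<n}" for s
  proof -
    have "nbr_sum path_edges z s = (\<Sum>w\<in>path_nbrs s. 1)"
      unfolding nbr_sum_def path_edges_nbrs_high[OF s]
      by (rule sum.cong) (use path_nbrs_less[OF s] in \<open>auto simp: z_def\<close>)
    then show ?thesis using s bpos by (simp add: z_def)
  qed
  have sq: "sqrt b * sqrt b = b" using bpos by simp
  have "rho {..<n} path_edges < sqrt b"
  proof (rule rho_less[OF path_edges_connected, where z = z and w = w0])
    fix v assume v: "v \<in> {..<n}"
    have "card (path_nbrs v) > 0" by (simp add: path_nbrs_def card_gt_0_iff)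
    then show "z v > 0" using bpos by (simp add: z_def)
    show "nbr_sum path_edges z v \<le> sqrt b * z v"
    proof (cases "v < k")
      case True
      then have "real (card (path_leaves v) + 2 * card (path_links v)) \<le> b"
        using row[OF True] by (simp only: b_def of_nat_le_iff)
      then show ?thesis using True bpos unfolding nlow[OF True]
        by (simp add: z_def divide_le_eq sq)
    next
      case False then show ?thesis using nhigh[of v] v by simp
    qed
  next
    show "w0 \<in> {..<n}" using w0 n_ge by simp
    have "real (card (path_leaves w0) + 2 * card (path_links w0)) < b"
      using strict by (simp only: b_def of_nat_less_iff)
    then show "nbr_sum path_edges z w0 < sqrt b * z w0" using w0 bpos unfolding nlow[OF w0]
      by (simp add: z_def divide_less_eq sq)
  qed
  then have "(rho {..<n} path_edges)\<^sup>2 < (sqrt b)\<^sup>2"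
    using rho_nonneg[OF path_edges_connected] by (intro power_strict_mono) auto
  then show ?thesis using bpos by (simp add: b_def)
qed

text \<open>Only finitely many graphs on \<open>V\<close> have the cover \<open>W\<close>; the
  relabelled caterpillar shows that there is one and bounds the minimum.\<close>

lemma minimal_covered_exists:
  fixes V :: "'a set"
  assumes V: "finite V" "card V = n" "W \<subseteq> V" "card W = k"
  obtains E where "E \<in> covered_graphs V W" "\<And>E'. E' \<in> covered_graphs V W \<Longrightarrow> rho V E \<le> rho V E'"
    "(rho V E)\<^sup>2 < q + min 3 (k - 1)"
proof -
  have finW: "finite W" using V finite_subset by blast
  obtain g where g: "bij_betw g {..<k} W"
    using finite_same_card_bij[of "{..<k}" W] V finW by auto
  have "card {k..<n} = card (V - W)" using V finW by (simp add: card_Diff_subset)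
  then obtain h where h: "bij_betw h {k..<n} (V - W)"
    using finite_same_card_bij[of "{k..<n}" "V - W"] V by auto
  define f where "f i = (if i < k then g i else h i)" for i
  have "bij_betw f {..<k} W" using g by (rule bij_betw_cong[THEN iffD1, rotated]) (simp add: f_def)
  moreover have "bij_betw f {k..<n} (V - W)"
    using h by (rule bij_betw_cong[THEN iffD1, rotated]) (simp add: f_def)
  ultimately have "bij_betw f ({..<k} \<union> {k..<n}) (W \<union> (V - W))" by (rule bij_betw_combine) auto
  moreover have "{..<k} \<union> {k..<n} = {..<n}" using n_ge k2 by auto
  moreover have "W \<union> (V - W) = V" using V by auto
  ultimately have f: "bij_betw f {..<n} V" by simp
  have fW: "f ` {..<k} = W" using \<open>bij_betw f {..<k} W\<close> by (simp add: bij_betw_def)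
  have inj: "inj_on f {..<n}" and fV: "f ` {..<n} = V" using f by (auto simp: bij_betw_def)
  have "path_edges \<in> covered_graphs {..<n} {..<k}"
    using path_edges_connected path_nbrs_less by (fastforce simp: covered_graphs_def path_edges_def)
  from covered_graphs_image[OF this inj] have mem: "image_rel f path_edges \<in> covered_graphs V W"
    unfolding fV fW .
  have "covered_graphs V W \<subseteq> Pow (V \<times> V)"
    by (auto simp: covered_graphs_def connected_graph_def simple_graph_def)
  then have fin: "finite (covered_graphs V W)" using V by (auto intro: finite_subset)
  define E where "E = arg_min_on (rho V) (covered_graphs V W)"
  have E: "E \<in> covered_graphs V W" unfolding E_def using fin mem by (intro arg_min_if_finite) auto
  have min: "rho V E \<le> rho V E'" if "E' \<in> covered_graphs V W" for E'
    unfolding E_def using fin mem that by (intro arg_min_least) auto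
  have "rho V E \<le> rho {..<n} path_edges"
    using min[OF mem] rho_image[OF path_edges_connected inj] by (simp add: fV)
  moreover have "rho V E \<ge> 0" using E by (intro rho_nonneg) (simp add: covered_graphs_def)
  ultimately have "(rho V E)\<^sup>2 \<le> (rho {..<n} path_edges)\<^sup>2" by (intro power_mono)
  then have "(rho V E)\<^sup>2 < q + min 3 (k - 1)" using rho_path_edges by linarith
  with E min that show ?thesis by blast
qed

end

section \<open>Attaching and detaching pendant vertices\<close>

definition matched :: "'a set \<Rightarrow> 'a rel \<Rightarrow> 'a set \<Rightarrow> bool" where
  "matched V E W \<longleftrightarrow> (\<exists>f. inj_on f W \<and> (\<forall>w\<in>W. f w \<in> V - W \<and> (w, f w) \<in> E))"

lemma matched_image:
  assumes "matched V E W" "inj_on f V" "W \<subseteq> V"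
  shows "matched (f ` V) (image_rel f E) (f ` W)"
proof -
  from assms obtain g where g: "inj_on g W" "\<And>w. w \<in> W \<Longrightarrow> g w \<in> V - W \<and> (w, g w) \<in> E"
    by (auto simp: matched_def)
  have inv: "the_inv_into V f (f v) = v" if "v \<in> V" for v using assms that by (simp add: the_inv_into_f_f)
  let ?h = "f \<circ> g \<circ> the_inv_into V f"
  have "inj_on ?h (f ` W)"
  proof (rule inj_onI)
    fix x y assume "x \<in> f ` W" "y \<in> f ` W" "?h x = ?h y"
    then obtain u v where uv: "u \<in> W" "v \<in> W" "x = f u" "y = f v" "?h (f u) = ?h (f v)" by blast
    then have "f (g u) = f (g v)" using inv[of u] inv[of v] subsetD[OF assms(3)] by simp
    then have "g u = g v" using g(2)[OF uv(1)] g(2)[OF uv(2)] assms(2) by (auto dest: inj_onD)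
    then show "x = y" using uv g(1) by (auto dest: inj_onD)
  qed
  moreover have "?h x \<in> f ` V - f ` W \<and> (x, ?h x) \<in> image_rel f E" if "x \<in> f ` W" for x
  proof -
    from that obtain w where w: "w \<in> W" "x = f w" by blast
    have "?h x = f (g w)" using w inv assms(3) by auto
    moreover have "f (g w) \<notin> f ` W" using g(2)[OF w(1)] assms(2,3) by (auto dest: inj_onD)
    ultimately show ?thesis using g(2)[OF w(1)] w by force
  qed
  ultimately show ?thesis unfolding matched_def by blast
qed

text \<open>The complement of \<open>W\<close> is independent, and in any independent set the
  vertices in \<open>W\<close> can be exchanged for their partners, which the set does not
  contain.\<close>

lemma independence_number_matched:
  assumes G: "simple_graph V E" and W: "W \<subseteq> V" and cov: "\<And>u v. (u, v) \<in> E \<Longrightarrow> u \<in> W \<or> v \<in> W"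
    and m: "matched V E W"
  shows "independence_number \<lparr>pverts = V, parcs = E\<rparr> = card V - card W"
  unfolding independence_number_def
proof (rule Max_eqI)
  have fin: "finite V" "finite W" using G W by (auto simp: simple_graph_def intro: finite_subset)
  let ?I = "{S. independent_set \<lparr>pverts = V, parcs = E\<rparr> S}"
  have "?I \<subseteq> Pow V" by (auto simp: independent_set_def)
  then show "finite (card ` ?I)" using fin by (intro finite_imageI) (auto intro: finite_subset)
  have "V - W \<in> ?I" using cov by (auto simp: independent_set_def)
  moreover have "card (V - W) = card V - card W" using fin W by (simp add: card_Diff_subset)
  ultimately show "card V - card W \<in> card ` ?I" by force
  fix c assume "c \<in> card ` ?I"
  then obtain S where S: "c = card S" "S \<subseteq> V" "\<And>u v. u \<in> S \<Longrightarrow> v \<in> S \<Longrightarrow> (u, v) \<notin> E"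
    by (auto simp: independent_set_def)
  from m obtain f where f: "inj_on f W" "\<And>w. w \<in> W \<Longrightarrow> f w \<in> V - W \<and> (w, f w) \<in> E"
    by (auto simp: matched_def)
  have "card S = card (S \<inter> W) + card (S - W)"
    using finite_subset[OF S(2) fin(1)] by (metis card_Int_Diff)
  also have "card (S \<inter> W) = card (f ` (S \<inter> W))"
    using f(1) by (metis card_image inf_le2 inj_on_subset)
  also have "card (f ` (S \<inter> W)) + card (S - W) = card (f ` (S \<inter> W) \<union> (S - W))"
    using S f fin finite_subset[OF S(2) fin(1)] by (intro card_Un_disjoint[symmetric]) auto
  also have "\<dots> \<le> card (V - W)" using S f fin by (intro card_mono) auto
  finally show "c \<le> card V - card W" using fin W S by (simp add: card_Diff_subset)
qed

context large_order
begin

text \<open>A vertex with a private leaf is matched to one. Two vertices without private leaves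
  would both have degree at most k - 1, too small for the degree sum; so there is at most one, and
  it may take any neighbour, which cannot be a private leaf of another vertex.\<close>

lemma subdivided_tree_matched:
  assumes T: "subdivided_tree V E W" and V: "card V = n" "card W = k"
    and up: "\<And>w. w \<in> W \<Longrightarrow> card (E `` {w}) \<le> q + min 2 (k - 2)"
  shows "matched V E W"
proof -
  have C: "connected_graph V E" and WV: "W \<subseteq> V" and bip: "E \<subseteq> W \<times> (V - W) \<union> (V - W) \<times> W"
    and B: "bridged E"
    using T by (auto simp: subdivided_tree_def)
  have G: "simple_graph V E" and fin: "finite W" using C WV
    by (auto simp: connected_graph_def simple_graph_def intro: finite_subset)
  have E: "E \<in> covered_graphs V W" using C bip by (auto simp: covered_graphs_def)
  have sum: "n - 1 \<le> (\<Sum>w\<in>W. card (E `` {w}))" using sum_degree_cover(1)[OF E WV] V by simp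
  have few: "card (E `` {w}) \<le> k - 1" if "w \<in> W" "private_leaves E W w = {}" for w
    using card_shared_nbrs(1)[OF E B WV that(1)] that(2) V by simp
  have unique: "w = w'" if w: "w \<in> W" "private_leaves E W w = {}" "w' \<in> W" "private_leaves E W w' = {}" for w w'
  proof (rule ccontr)
    assume ne: "w \<noteq> w'"
    have "(\<Sum>w\<in>W. card (E `` {w})) = card (E `` {w}) + (card (E `` {w'}) + (\<Sum>w\<in>W - {w} - {w'}. card (E `` {w})))"
      using w ne fin by (simp add: sum.remove[of W w] sum.remove[of "W - {w}" w'])
    also have "(\<Sum>w\<in>W - {w} - {w'}. card (E `` {w})) \<le> (\<Sum>w\<in>W - {w} - {w'}. q + 2)"
      by (rule sum_mono) (use up in \<open>fastforce intro: order_trans\<close>)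
    also have "\<dots> = (k - 2) * (q + 2)" using w ne fin V by (simp add: numeral_2_eq_2)
    finally have "n - 1 \<le> (k - 1) + ((k - 1) + (k - 2) * (q + 2))"
      using few[OF w(1,2)] few[OF w(3,4)] sum by linarith
    moreover obtain j where "k = j + 2" using k2 nat_le_iff_add by (metis add.commute)
    ultimately show False using nq q_ge by (simp add: algebra_simps)
  qed
  have "\<exists>y. (w, y) \<in> E \<and> (private_leaves E W w \<noteq> {} \<longrightarrow> y \<in> private_leaves E W w)" if w: "w \<in> W" for w
  proof (cases "private_leaves E W w = {}")
    case True
    have "3 \<le> card (E `` {w})"
      using degree_lower_bounds(2)[where d = "\<lambda>w. card (E `` {w})", OF fin V(2) w up sum] by simp
    then have "E `` {w} \<noteq> {}" by auto
    then show ?thesis using True by auto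
  qed (auto simp: private_leaves_def)
  then obtain f where f: "\<And>w. w \<in> W \<Longrightarrow> (w, f w) \<in> E"
    "\<And>w. w \<in> W \<Longrightarrow> private_leaves E W w \<noteq> {} \<Longrightarrow> f w \<in> private_leaves E W w" by metis
  have "inj_on f W"
  proof (rule inj_onI)
    fix w w' assume w: "w \<in> W" "w' \<in> W" "f w = f w'"
    have sym: "w \<in> E `` {f w}" "w' \<in> E `` {f w'}" using f(1)[OF w(1)] f(1)[OF w(2)] simple_graph_symD[OF G] by blast+
    show "w = w'"
    proof (cases "private_leaves E W w = {} \<and> private_leaves E W w' = {}")
      case True then show ?thesis using unique w by blast
    next
      case False
      then have "f w \<in> private_leaves E W w \<or> f w' \<in> private_leaves E W w'" using f(2) w by metis
      then have "E `` {f w} = {w} \<or> E `` {f w'} = {w'}" by (auto simp only: private_leaves_def mem_Collect_eq)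
      then show ?thesis using sym w(3) by auto
    qed
  qed
  moreover have "f w \<in> V - W" if "w \<in> W" for w using f(1)[OF that] bip that by auto
  ultimately show ?thesis unfolding matched_def using f(1) by blast
qed

end

section \<open>Pendant attachment on vertex and edge sets, its spectral radius and its
  inverse\<close>

abbreviation attach_verts :: "'a set \<Rightarrow> nat \<Rightarrow> 'a set \<Rightarrow> ('a + 'a \<times> nat) set" where
  "attach_verts V l U \<equiv> Inl ` V \<union> Inr ` (U \<times> {..<l})"

definition attach_edges :: "'a rel \<Rightarrow> nat \<Rightarrow> 'a set \<Rightarrow> ('a + 'a \<times> nat) rel" where
  "attach_edges E l U = {(Inl u, Inl v) | u v. (u, v) \<in> E}
             \<union> {(Inl u, Inr (u, i)) | u i. u \<in> U \<and> i < l}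
             \<union> {(Inr (u, i), Inl u) | u i. u \<in> U \<and> i < l}"

lemma attach_pendants_eq:
  "attach_pendants G l U = \<lparr>pverts = attach_verts (pverts G) l U, parcs = attach_edges (parcs G) l U\<rparr>"
  by (simp add: attach_pendants_def attach_edges_def)

lemma attach_edges_nbrs:
  "attach_edges E l U `` {Inl v} = Inl ` (E `` {v}) \<union> (if v \<in> U then (\<lambda>i. Inr (v, i)) ` {..<l} else {})"
  "u \<in> U \<Longrightarrow> i < l \<Longrightarrow> attach_edges E l U `` {Inr (u, i)} = {Inl u}"
  by (auto simp: attach_edges_def)

lemma attach_connected:
  assumes C: "connected_graph V E" and U: "U \<subseteq> V"
  shows "connected_graph (attach_verts V l U) (attach_edges E l U)"
proof -
  let ?V = "attach_verts V l U" and ?E = "attach_edges E l U"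
  have G: "simple_graph V E" using C by (simp add: connected_graph_def)
  have fin: "finite V" "finite U" using G U by (auto simp: simple_graph_def intro: finite_subset)
  have S: "simple_graph ?V ?E" unfolding simple_graph_def
  proof (intro conjI)
    show "finite ?V" using fin by simp
    show "?E \<subseteq> ?V \<times> ?V" using G U by (auto simp: attach_edges_def simple_graph_def)
    show "sym ?E" using G by (auto simp: attach_edges_def intro!: symI dest: simple_graph_symD)
    show "irrefl ?E" using G by (auto simp: attach_edges_def simple_graph_def irrefl_def)
  qed
  have sym: "sym ?E" using S by (simp add: simple_graph_def)
  have lift: "(Inl u, Inl v) \<in> ?E\<^sup>*" if "(u, v) \<in> E\<^sup>*" for u v
    using that
  proof (induction rule: rtrancl_induct)
    case (step y z)
    then have "(Inl y, Inl z) \<in> ?E" by (simp add: attach_edges_def)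
    with step show ?case by (meson rtrancl_into_rtrancl)
  qed simp
  obtain c where c: "c \<in> V" using C by (auto simp: connected_graph_def)
  have base: "(Inl v, Inl c) \<in> ?E\<^sup>*" if "v \<in> V" for v using lift C c that by (simp add: connected_graph_def)
  have toc: "(x, Inl c) \<in> ?E\<^sup>*" if x: "x \<in> ?V" for x
  proof -
    from x consider v where "v \<in> V" "x = Inl v" | u i where "u \<in> U" "i < l" "x = Inr (u, i)" by auto
    then show ?thesis
    proof cases
      case 1 then show ?thesis using base by simp
    next
      case 2
      then have "(x, Inl u) \<in> ?E" by (simp add: attach_edges_def)
      moreover have "(Inl u, Inl c) \<in> ?E\<^sup>*" using base U 2 by auto
      ultimately show ?thesis by (rule converse_rtrancl_into_rtrancl)
    qed
  qed
  have "(x, y) \<in> ?E\<^sup>*" if "x \<in> ?V" "y \<in> ?V" for x y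
    using toc[OF that(1)] rtrancl_symmetric[OF sym toc[OF that(2)]] by (rule rtrancl_trans)
  then show ?thesis using S c by (auto simp: connected_graph_def)
qed

lemma attach_covered:
  assumes "E \<in> covered_graphs V W" "W \<subseteq> V"
  shows "attach_edges E l W \<in> covered_graphs (attach_verts V l W) (Inl ` W)"
  using assms attach_connected[of V E W l] unfolding covered_graphs_def attach_edges_def by blast

lemma attach_matched:
  assumes "matched V E W" "W \<subseteq> V"
  shows "matched (attach_verts V l W) (attach_edges E l W) (Inl ` W)"
proof -
  from assms obtain g where g: "inj_on g W" "\<And>w. w \<in> W \<Longrightarrow> g w \<in> V - W \<and> (w, g w) \<in> E"
    by (auto simp: matched_def)
  let ?h = "\<lambda>x. Inl (g (projl x))"
  have "inj_on ?h (Inl ` W)" using g(1) by (auto simp: inj_on_def)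
  moreover have "?h x \<in> attach_verts V l W - Inl ` W \<and> (x, ?h x) \<in> attach_edges E l W"
    if "x \<in> Inl ` W" for x
    using that g(2) by (auto simp: attach_edges_def)
  ultimately show ?thesis unfolding matched_def by blast
qed

lemma card_attach_verts:
  assumes "finite V" "finite U"
  shows "card (attach_verts V l U) = card V + card U * l"
  using assms by (subst card_Un_disjoint) (auto simp: card_image card_cartesian_product)

lemma rho_attach:
  assumes C: "connected_graph V E" and W: "W \<subseteq> V" and bip: "E \<subseteq> W \<times> (V - W) \<union> (V - W) \<times> W"
    and pos: "V = W \<or> rho V E > 0" "(rho V E)\<^sup>2 + real l > 0"
  shows "rho (attach_verts V l W) (attach_edges E l W) = sqrt ((rho V E)\<^sup>2 + real l)"
proof -
  let ?V = "attach_verts V l W" and ?E = "attach_edges E l W"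
  let ?r = "rho V E"
  define c where "c = sqrt (?r\<^sup>2 + real l)"
  have c: "c > 0" "c * c = ?r\<^sup>2 + real l" using pos(2) by (auto simp: c_def)
  obtain x where x: "positive_eigenvector V E ?r x" using rho_eigenvector[OF C] .
  have xp: "x v > 0" and eig: "nbr_sum E x v = ?r * x v" if "v \<in> V" for v
    using x that by (auto simp: positive_eigenvector_def)
  have G: "simple_graph V E" using C by (simp add: connected_graph_def)
  \<comment> \<open>The Perron vector is kept on \<open>W\<close>; the equations at the other old
    vertices and at the pendants then force the factors rho / c and 1 / c. If rho = 0 the factor rho
    / c would spoil positivity, hence the alternative \<open>V = W\<close>, which serves the single
    vertex.\<close>
  define z where "z y = (case y of Inl v \<Rightarrow> if v \<in> W then x v else ?r / c * x v | Inr p \<Rightarrow> x (fst p) / c)" for y :: "'a + 'a \<times> nat"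
  have zpos: "z y > 0" if "y \<in> ?V" for y
    using that xp W c(1) pos(1) by (auto simp: z_def)
  have nb: "nbr_sum ?E z y = c * z y" if y: "y \<in> ?V" for y
  proof -
    from y consider v where "v \<in> W" "y = Inl v" | v where "v \<in> V - W" "y = Inl v"
      | u i where "u \<in> W" "i < l" "y = Inr (u, i)" by auto
    then show ?thesis
    proof cases
      case 1
      then have v: "v \<in> V" using W by auto
      have sub: "E `` {v} \<subseteq> V - W" using bip 1 by auto
      have "nbr_sum ?E z y = (\<Sum>u\<in>Inl ` (E `` {v}). z u) + (\<Sum>u\<in>(\<lambda>i. Inr (v, i)) ` {..<l}. z u)"
        unfolding nbr_sum_def 1(2) attach_edges_nbrs(1) using 1(1) simple_graph_finite_nbrs[OF G, of v]
        by (simp, subst sum.union_disjoint) auto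
      also have "(\<Sum>u\<in>Inl ` (E `` {v}). z u) = (\<Sum>u\<in>E `` {v}. ?r / c * x u)"
        using sub by (subst sum.reindex) (auto simp: z_def intro!: sum.cong)
      also have "\<dots> = ?r / c * (?r * x v)"
        unfolding eig[OF v, symmetric] nbr_sum_def by (rule sum_distrib_left[symmetric])
      also have "(\<Sum>u\<in>(\<lambda>i. Inr (v, i)) ` {..<l}. z u) = real l * (x v / c)"
        by (subst sum.reindex) (auto simp: z_def inj_on_def)
      also have "?r / c * (?r * x v) + real l * (x v / c) = (?r\<^sup>2 + real l) * x v / c"
        by (simp add: add_divide_distrib algebra_simps power2_eq_square)
      also have "\<dots> = c * x v" unfolding c(2)[symmetric] using c(1) by simp
      finally have "nbr_sum ?E z y = c * x v" .
      moreover have "z y = x v" using 1 by (simp add: z_def)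
      ultimately show ?thesis by simp
    next
      case 2
      have sub: "E `` {v} \<subseteq> W" using bip 2 by auto
      have "nbr_sum ?E z y = (\<Sum>u\<in>Inl ` (E `` {v}). z u)"
        unfolding nbr_sum_def 2(2) attach_edges_nbrs(1) using 2(1) by simp
      also have "\<dots> = nbr_sum E x v" unfolding nbr_sum_def
        using sub by (subst sum.reindex) (auto simp: z_def intro!: sum.cong)
      also have "\<dots> = c * z y" using eig 2 c(1) by (simp add: z_def)
      finally show ?thesis .
    next
      case 3
      then show ?thesis unfolding nbr_sum_def 3(3) attach_edges_nbrs(2)[OF 3(1,2)]
        using c(1) by (simp add: z_def)
    qed
  qed
  have C': "connected_graph ?V ?E" by (rule attach_connected[OF C W])
  have "positive_eigenvector ?V ?E c z" using zpos nb by (simp add: positive_eigenvector_def)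
  then show ?thesis unfolding c_def[symmetric]
    using C' by (intro rho_eqI) (auto simp: connected_graph_def)
qed

lemma detach_leaves:
  assumes T: "subdivided_tree V E W" and many: "\<And>w. w \<in> W \<Longrightarrow> l \<le> card (private_leaves E W w)"
  obtains V0 E0 f where "subdivided_tree V0 E0 W" "V0 \<subseteq> V"
    "\<And>w. w \<in> W \<Longrightarrow> card (E0 `` {w}) + l = card (E `` {w})"
    "inj_on f (attach_verts V0 l W)" "V = f ` attach_verts V0 l W" "E = image_rel f (attach_edges E0 l W)"
proof -
  have C: "connected_graph V E" and WV: "W \<subseteq> V" and bip: "E \<subseteq> W \<times> (V - W) \<union> (V - W) \<times> W"
    and deg: "\<And>s. s \<in> V - W \<Longrightarrow> card (E `` {s}) \<le> 2" and B: "bridged E"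
    using T by (auto simp: subdivided_tree_def)
  have G: "simple_graph V E" using C by (simp add: connected_graph_def)
  have finN: "finite (E `` {v})" for v by (rule simple_graph_finite_nbrs[OF G])
  have "\<exists>R. R \<subseteq> private_leaves E W w \<and> card R = l" if "w \<in> W" for w
    using obtain_subset_with_card_n[OF many[OF that]] by metis
  then obtain R where R: "\<And>w. w \<in> W \<Longrightarrow> R w \<subseteq> private_leaves E W w \<and> card (R w) = l" by metis
  have finR: "finite (R w)" if "w \<in> W" for w
    using R[OF that] finN[of w] by (intro finite_subset[of "R w" "E `` {w}"]) (auto simp: private_leaves_def)
  have Rl: "E `` {y} = {w}" "(w, y) \<in> E" "y \<in> V - W" if "w \<in> W" "y \<in> R w" for w y
  proof -
    have y: "y \<in> private_leaves E W w" using R that by blast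
    then show "E `` {y} = {w}" "(w, y) \<in> E" by (auto simp: private_leaves_def)
    then show "y \<in> V - W" using y simple_graph_in_verts[OF G] by (auto simp: private_leaves_def)
  qed
  have Rdisj: "w = w'" if "w \<in> W" "y \<in> R w" "w' \<in> W" "y \<in> R w'" for w w' y
    using Rl(1)[OF that(1,2)] Rl(1)[OF that(3,4)] by simp
  have "\<exists>h. bij_betw h {..<l} (R w)" if "w \<in> W" for w
    using finite_same_card_bij[of "{..<l}" "R w"] R[OF that] finR[OF that] by simp
  then obtain h where h: "\<And>w. w \<in> W \<Longrightarrow> bij_betw (h w) {..<l} (R w)" by metis
  define V0 where "V0 = V - (\<Union>w\<in>W. R w)"
  define E0 where "E0 = E \<inter> V0 \<times> V0"
  have WV0: "W \<subseteq> V0" using WV Rl(3) by (auto simp: V0_def)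
  have G0: "simple_graph V0 E0"
    using G unfolding simple_graph_def V0_def E0_def irrefl_def sym_def by auto
  \<comment> \<open>A retraction of \<open>V\<close> onto \<open>V0\<close>: a removed leaf goes to
    its only neighbour, so edges map to edges or to points and walks survive. On \<open>V\<close>
    the \<open>THE\<close> is reached only at removed leaves, where it is well defined.\<close>
  define p where "p v = (if v \<in> V0 then v else THE w. E `` {v} = {w})" for v
  have pout: "p y = w" if "w \<in> W" "y \<in> R w" for w y
    using that Rl(1)[OF that] by (auto simp: p_def V0_def)
  have pstep: "(p u, p v) \<in> E0\<^sup>*" if uv: "(u, v) \<in> E" for u v
  proof -
    have vu: "(v, u) \<in> E" by (rule simple_graph_symD[OF G uv])
    have V: "u \<in> V" "v \<in> V" using simple_graph_in_verts[OF G uv] by auto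
    consider "u \<in> V0" "v \<in> V0" | w where "w \<in> W" "u \<in> R w" | w where "w \<in> W" "v \<in> R w"
      using V by (auto simp: V0_def)
    then show ?thesis
    proof cases
      case 1 then show ?thesis using uv by (auto simp: p_def E0_def)
    next
      case 2
      then have "v = w" using Rl(1)[OF 2] uv by auto
      then show ?thesis using pout[OF 2] WV0 2 by (auto simp: p_def)
    next
      case 3
      then have "u = w" using Rl(1)[OF 3] vu by auto
      then show ?thesis using pout[OF 3] WV0 3 by (auto simp: p_def)
    qed
  qed
  have pwalk: "(p u, p v) \<in> E0\<^sup>*" if "(u, v) \<in> E\<^sup>*" for u v
    using that by (induction rule: rtrancl_induct) (auto intro: rtrancl_trans pstep)
  have C0: "connected_graph V0 E0"
  proof -
    obtain c where c: "c \<in> V" using C by (auto simp: connected_graph_def)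
    have "V0 \<noteq> {}"
    proof (cases "W = {}")
      case True then show ?thesis using c by (auto simp: V0_def)
    next
      case False then show ?thesis using WV0 by blast
    qed
    moreover have "(u, v) \<in> E0\<^sup>*" if "u \<in> V0" "v \<in> V0" for u v
      using pwalk[of u v] that C by (auto simp: p_def V0_def connected_graph_def)
    ultimately show ?thesis using G0 by (simp add: connected_graph_def)
  qed
  have "bridged E0" unfolding bridged_def
  proof (intro allI impI notI)
    fix a b assume "(a, b) \<in> E0" "(a, b) \<in> (E0 - {(a, b), (b, a)})\<^sup>*"
    moreover have "(E0 - {(a, b), (b, a)})\<^sup>* \<subseteq> (E - {(a, b), (b, a)})\<^sup>*"
      by (rule rtrancl_mono) (auto simp: E0_def)
    ultimately show False using B by (auto simp: bridged_def E0_def)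
  qed
  moreover have "card (E0 `` {s}) \<le> 2" if "s \<in> V0 - W" for s
  proof -
    have "card (E0 `` {s}) \<le> card (E `` {s})" using finN by (intro card_mono) (auto simp: E0_def)
    then show ?thesis using deg[of s] that by (auto simp: V0_def)
  qed
  moreover have "E0 \<subseteq> W \<times> (V0 - W) \<union> (V0 - W) \<times> W" using bip by (auto simp: E0_def)
  ultimately have T0: "subdivided_tree V0 E0 W" using C0 WV0 by (simp add: subdivided_tree_def)
  have split: "E `` {w} = E0 `` {w} \<union> R w" "E0 `` {w} \<inter> R w = {}" if w: "w \<in> W" for w
  proof -
    have "v \<in> R w" if "(w, v) \<in> E" "(w, v) \<notin> E0" for v
    proof -
      have "v \<in> V - V0" using that w WV0 simple_graph_in_verts[OF G] by (auto simp: E0_def)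
      then obtain w' where w': "w' \<in> W" "v \<in> R w'" by (auto simp: V0_def)
      then have "w = w'" using Rl(1)[OF w'] simple_graph_symD[OF G that(1)] by auto
      with w' show ?thesis by simp
    qed
    then show "E `` {w} = E0 `` {w} \<union> R w" using Rl(2)[OF w] by (auto simp: E0_def)
    show "E0 `` {w} \<inter> R w = {}" using w by (auto simp: E0_def V0_def)
  qed
  have deg0: "card (E0 `` {w}) + l = card (E `` {w})" if w: "w \<in> W" for w
    using card_Un_disjoint[OF _ finR[OF w] split(2)[OF w]] split(1)[OF w] R[OF w]
      simple_graph_finite_nbrs[OF G0] by simp
  \<comment> \<open>The i-th removed leaf at w takes the role of the i-th new pendant.\<close>
  define f where "f y = (case y of Inl v \<Rightarrow> v | Inr (w, i) \<Rightarrow> h w i)" for y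
  have hR: "h w i \<in> R w" if "w \<in> W" "i < l" for w i using h[OF that(1)] that by (auto simp: bij_betw_def)
  have hinj: "i = j" if "w \<in> W" "i < l" "j < l" "h w i = h w j" for w i j
    using h[OF that(1)] that by (auto simp: bij_betw_def dest: inj_onD)
  have hsurj: "\<exists>i<l. y = h w i" if "w \<in> W" "y \<in> R w" for w y
    using h[OF that(1)] that by (auto simp: bij_betw_def)
  have hV0: "h w i \<notin> V0" if "w \<in> W" "i < l" for w i
    using hR[OF that] that by (auto simp: V0_def)
  have inj: "inj_on f (attach_verts V0 l W)"
  proof (rule inj_onI)
    fix x y assume "x \<in> attach_verts V0 l W" "y \<in> attach_verts V0 l W" "f x = f y"
    moreover have "a = b \<and> i = j" if "a \<in> W" "b \<in> W" "i < l" "j < l" "h a i = h b j" for a b i j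
      using that hR[OF that(1,3)] hR[OF that(2,4)] Rdisj hinj by metis
    ultimately show "x = y" using hV0 by (auto simp: f_def)
  qed
  have img: "V = f ` attach_verts V0 l W"
  proof (intro subset_antisym subsetI)
    fix v assume v: "v \<in> V"
    show "v \<in> f ` attach_verts V0 l W"
    proof (cases "v \<in> V0")
      case True
      then show ?thesis by (intro image_eqI[of _ _ "Inl v"]) (auto simp: f_def)
    next
      case False
      then obtain w where w: "w \<in> W" "v \<in> R w" using v by (auto simp: V0_def)
      with hsurj obtain i where "i < l" "v = h w i" by blast
      then show ?thesis using w by (intro image_eqI[of _ _ "Inr (w, i)"]) (auto simp: f_def)
    qed
  next
    fix v assume "v \<in> f ` attach_verts V0 l W"
    then show "v \<in> V" using hR Rl(3) by (auto simp: f_def V0_def)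
  qed
  have edges: "E = image_rel f (attach_edges E0 l W)"
  proof (intro subset_antisym subsetI)
    fix e assume e: "e \<in> E"
    obtain u v where uv: "e = (u, v)" by fastforce
    have Euv: "(u, v) \<in> E" "(v, u) \<in> E" using e uv simple_graph_symD[OF G] by auto
    have V: "u \<in> V" "v \<in> V" using simple_graph_in_verts[OF G Euv(1)] by auto
    consider "u \<in> V0" "v \<in> V0" | w where "w \<in> W" "u \<in> R w" | w where "w \<in> W" "v \<in> R w"
      using V by (auto simp: V0_def)
    then show "e \<in> image_rel f (attach_edges E0 l W)"
    proof cases
      case 1
      then show ?thesis using Euv uv
        by (intro image_eqI[of _ _ "(Inl u, Inl v)"]) (auto simp: f_def attach_edges_def E0_def)
    next
      case 2
      then have "v = w" using Rl(1)[OF 2] Euv by auto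
      moreover obtain i where "i < l" "u = h w i" using hsurj[OF 2] by blast
      ultimately show ?thesis using 2 uv
        by (intro image_eqI[of _ _ "(Inr (w, i), Inl w)"]) (auto simp: f_def attach_edges_def)
    next
      case 3
      then have "u = w" using Rl(1)[OF 3] Euv by auto
      moreover obtain i where "i < l" "v = h w i" using hsurj[OF 3] by blast
      ultimately show ?thesis using 3 uv
        by (intro image_eqI[of _ _ "(Inl w, Inr (w, i))"]) (auto simp: f_def attach_edges_def)
    qed
  next
    fix e assume "e \<in> image_rel f (attach_edges E0 l W)"
    then show "e \<in> E" using hR Rl(2) simple_graph_symD[OF G]
      by (auto simp: attach_edges_def f_def E0_def)
  qed
  show ?thesis by (rule that[OF T0 _ deg0 inj img edges]) (auto simp: V0_def)
qed

section \<open>Even vertices\<close>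

lemma set_vwalk_arcs: "set (vwalk_arcs p) = {(p ! i, p ! Suc i) | i. Suc i < length p}"
proof (induction p rule: vwalk_arcs.induct)
  case (3 x y xs)
  have "{((x # y # xs) ! i, (x # y # xs) ! Suc i) | i. Suc i < length (x # y # xs)} =
    insert (x, y) {((y # xs) ! i, (y # xs) ! Suc i) | i. Suc i < length (y # xs)}" (is "?L = insert _ ?R")
  proof (intro subset_antisym subsetI)
    fix e assume "e \<in> ?L"
    then obtain i where i: "e = ((x # y # xs) ! i, (x # y # xs) ! Suc i)" "Suc i < length (x # y # xs)" by blast
    then show "e \<in> insert (x, y) ?R" by (cases i) auto
  next
    fix e assume "e \<in> insert (x, y) ?R"
    then consider "e = (x, y)" | i where "e = ((y # xs) ! i, (y # xs) ! Suc i)" "Suc i < length (y # xs)" by blast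
    then show "e \<in> ?L"
    proof cases
      case 1 then show ?thesis by (auto intro: exI[of _ 0])
    next
      case 2
      then have "e = ((x # y # xs) ! Suc i, (x # y # xs) ! Suc (Suc i))" "Suc (Suc i) < length (x # y # xs)"
        by auto
      then show ?thesis by blast
    qed
  qed
  with 3 show ?case by simp
qed auto

lemma card_vwalk_arcs_nbrs:
  assumes "distinct p"
  shows "card ((set (vwalk_arcs p) \<union> (set (vwalk_arcs p))\<inverse>) `` {u}) \<le> 2"
proof -
  let ?N = "(set (vwalk_arcs p) \<union> (set (vwalk_arcs p))\<inverse>) `` {u}"
  have "\<exists>a b. ?N \<subseteq> {a, b}"
  proof (cases "u \<in> set p")
    case True
    then obtain j where j: "j < length p" "u = p ! j" by (metis in_set_conv_nth)
    \<comment> \<open>At the ends of p the truncated j - 1 and the out-of-range entry are harmless: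
      they only enlarge the right-hand set.\<close>
    have "?N \<subseteq> {p ! (j - 1), p ! Suc j}"
      using j assms by (auto simp: set_vwalk_arcs nth_eq_iff_index_eq)
    then show ?thesis by blast
  next
    case False
    then have "?N = {}" by (auto simp: set_vwalk_arcs)
    then show ?thesis by blast
  qed
  then obtain a b where "?N \<subseteq> {a, b}" by blast
  then have "card ?N \<le> card {a, b}" by (intro card_mono) auto
  also have "\<dots> \<le> 2" by (simp add: card_insert_if)
  finally show ?thesis .
qed

lemma vwalk_rtrancl_last:
  assumes "set (vwalk_arcs p) \<subseteq> R" "z \<in> set p"
  shows "(z, last p) \<in> R\<^sup>*"
  using assms
proof (induction p arbitrary: z rule: vwalk_arcs.induct)
  case (3 x y xs)
  have "(y, last (y # xs)) \<in> R\<^sup>*" using "3.IH"[of y] "3.prems" by auto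
  moreover have "(x, y) \<in> R" using 3 by auto
  ultimately have "(x, last (y # xs)) \<in> R\<^sup>*" by (rule converse_rtrancl_into_rtrancl[rotated])
  then show ?case using 3 by (cases "z = x") auto
qed auto

lemma out_degree_eq: "out_degree (with_proj \<lparr>pverts = V, parcs = E\<rparr>) v = card (E `` {v})"
proof -
  have "{e \<in> E. fst e = v} = Pair v ` (E `` {v})" by auto
  then show ?thesis by (simp add: out_degree_def out_arcs_def card_image inj_on_def)
qed

lemma not_path_graph:
  assumes "3 \<le> card (E `` {u})"
  shows "\<not> is_path_graph (with_proj \<lparr>pverts = V, parcs = E\<rparr>)"
proof
  assume "is_path_graph (with_proj \<lparr>pverts = V, parcs = E\<rparr>)"
  then obtain vs where "distinct vs" "E = set (vwalk_arcs vs) \<union> (set (vwalk_arcs vs))\<inverse>"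
    by (auto simp: is_path_graph_def path_labelling_def)
  then show False using card_vwalk_arcs_nbrs[of vs u] assms by simp
qed

text \<open>In \<open>D_m\<close> only the vertex that carries the two extra pendants can have
  degree above two.\<close>

lemma not_D_graph:
  assumes "3 \<le> card (E `` {u})" "3 \<le> card (E `` {v})" "u \<noteq> v"
  shows "\<not> is_D_graph (with_proj \<lparr>pverts = V, parcs = E\<rparr>)"
proof
  assume "is_D_graph (with_proj \<lparr>pverts = V, parcs = E\<rparr>)"
  then obtain ws a b where ws: "distinct (a # b # ws)"
    and E: "E = (set (vwalk_arcs ws) \<union> {(hd ws, a), (hd ws, b)}) \<union> (set (vwalk_arcs ws) \<union> {(hd ws, a), (hd ws, b)})\<inverse>"
    by (auto simp: is_D_graph_def D_labelling_def Let_def)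
  have "card (E `` {x}) \<le> 2" if x: "x \<noteq> hd ws" for x
  proof (cases "x \<in> {a, b}")
    case True
    then have "E `` {x} \<subseteq> {hd ws}" using x ws unfolding E by (auto simp: set_vwalk_arcs)
    then have "card (E `` {x}) \<le> card {hd ws}" by (intro card_mono) auto
    then show ?thesis by simp
  next
    case False
    then have "E `` {x} = (set (vwalk_arcs ws) \<union> (set (vwalk_arcs ws))\<inverse>) `` {x}"
      using x unfolding E by auto
    then show ?thesis using card_vwalk_arcs_nbrs[of ws x] ws by simp
  qed
  then show False using assms by (metis Suc_n_not_le_n numeral_2_eq_2 numeral_3_eq_3 order_trans)
qed

text \<open>Without its only neighbour a, the vertex y is isolated. The record repeats the
  projections \<open>fst\<close> and \<open>snd\<close> because a subgraph must have the same tail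
  and head maps.\<close>

lemma private_leaf_component:
  assumes G: "simple_graph V E" and y: "E `` {y} = {a}" "y \<in> V"
  shows "\<lparr>verts = {y}, arcs = {}, tail = fst, head = snd\<rparr> \<in>
    pre_digraph.sccs (pre_digraph.del_vert (with_proj \<lparr>pverts = V, parcs = E\<rparr>) a)"
proof -
  let ?T = "with_proj \<lparr>pverts = V, parcs = E\<rparr>"
  let ?D = "pre_digraph.del_vert ?T a"
  let ?C = "\<lparr>verts = {y}, arcs = {}, tail = fst, head = snd\<rparr> :: ('a, 'a \<times> 'a) pre_digraph"
  have ya: "(y, a) \<in> E" using y by auto
  have D: "verts ?D = V - {a}" "arcs ?D = {e \<in> E. fst e \<noteq> a \<and> snd e \<noteq> a}" "tail ?D = fst" "head ?D = snd"
    by (simp_all add: pre_digraph.del_vert_def)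
  have wfD: "wf_digraph ?D"
    by unfold_locales (use G in \<open>auto simp: D simple_graph_def\<close>)
  have wfC: "wf_digraph ?C" by unfold_locales auto
  have "y \<noteq> a" using simple_graph_in_verts[OF G ya] by simp
  have ind: "induced_subgraph ?C ?D"
    using wfD wfC y(2) \<open>y \<noteq> a\<close> simple_graph_in_verts[OF G]
    by (auto simp: induced_subgraph_def subgraph_def compatible_def D)
  have con: "strongly_connected ?C" by (auto simp: strongly_connected_def reachable_def)
  have max: "\<not> (\<exists>H. induced_subgraph H ?D \<and> strongly_connected H \<and> verts ?C \<subset> verts H)"
  proof
    assume "\<exists>H. induced_subgraph H ?D \<and> strongly_connected H \<and> verts ?C \<subset> verts H"
    then obtain H u where H: "induced_subgraph H ?D" "strongly_connected H" "y \<in> verts H" "u \<in> verts H" "u \<noteq> y"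
      by auto
    then have "(y, u) \<in> rtrancl_on (verts H) (arcs_ends H)"
      by (auto simp: strongly_connected_def reachable_def)
    then have "u = y \<or> (\<exists>v. (y, v) \<in> arcs_ends H)"
      by (induction rule: rtrancl_on_induct) auto
    with H(5) obtain v where "(y, v) \<in> arcs_ends H" by blast
    then have "(y, v) \<in> E" "v \<noteq> a"
      using H(1) by (auto simp: arcs_ends_def arc_to_ends_def induced_subgraph_def subgraph_def compatible_def D)
    then show False using y by auto
  qed
  show ?thesis unfolding pre_digraph.sccs_def using ind con max by blast
qed

text \<open>Every private leaf of a is a path component once a is deleted, so a vertex of degree at
  least three with at most one other neighbour qualifies.\<close>

lemma control_vertexI:
  assumes G: "simple_graph V E" and a: "a \<in> V" "3 \<le> card (E `` {a})"
    and leaves: "card (E `` {a}) - 1 \<le> card (private_leaves E W a)"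
    and notP: "\<not> is_path_graph (with_proj \<lparr>pverts = V, parcs = E\<rparr>)"
    and notD: "\<not> is_D_graph (with_proj \<lparr>pverts = V, parcs = E\<rparr>)"
  shows "a \<in> control_vertices (with_proj \<lparr>pverts = V, parcs = E\<rparr>)"
proof -
  let ?T = "with_proj \<lparr>pverts = V, parcs = E\<rparr>"
  let ?D = "pre_digraph.del_vert ?T a"
  let ?c = "\<lambda>y. \<lparr>verts = {y}, arcs = {}, tail = fst, head = snd\<rparr> :: ('a, 'a \<times> 'a) pre_digraph"
  let ?S = "{C \<in> pre_digraph.sccs ?D. is_path_graph C}"
  have D: "verts ?D = V - {a}" "arcs ?D = {e \<in> E. fst e \<noteq> a \<and> snd e \<noteq> a}" "tail ?D = fst" "head ?D = snd"
    by (simp_all add: pre_digraph.del_vert_def)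
  have wfD: "wf_digraph ?D"
    by unfold_locales (use G in \<open>auto simp: D simple_graph_def\<close>)
  have "verts ` pre_digraph.sccs ?D \<subseteq> Pow V"
    by (auto simp: pre_digraph.sccs_def induced_subgraph_def subgraph_def D)
  moreover have "finite (Pow V)" using G by (simp add: simple_graph_def)
  ultimately have "finite (verts ` pre_digraph.sccs ?D)" by (rule finite_subset)
  \<comment> \<open>Finiteness matters: \<open>card\<close> of an infinite set of components would
    be 0.\<close>
  then have fin: "finite (pre_digraph.sccs ?D)"
    using wf_digraph.inj_on_verts_sccs[OF wfD] by (rule finite_imageD)
  have path: "is_path_graph (?c y)" for y
    unfolding is_path_graph_def path_labelling_def by (intro exI[of _ "[y]"]) (simp add: arcs_ends_def)
  have "?c ` private_leaves E W a \<subseteq> ?S"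
  proof
    fix C assume "C \<in> ?c ` private_leaves E W a"
    then obtain y where y: "C = ?c y" "E `` {y} = {a}" by (auto simp: private_leaves_def)
    then have "(y, a) \<in> E" by auto
    then have "y \<in> V" using simple_graph_in_verts[OF G] by blast
    then show "C \<in> ?S" using private_leaf_component[OF G y(2)] path y(1) by simp
  qed
  then have "card (?c ` private_leaves E W a) \<le> card ?S" using fin by (intro card_mono) auto
  moreover have "card (?c ` private_leaves E W a) = card (private_leaves E W a)"
    by (intro card_image inj_onI) simp
  ultimately show ?thesis using a leaves notP notD
    by (simp add: control_vertices_def out_degree_eq)
qed

lemma alternating_walk:
  assumes bip: "E \<subseteq> W \<times> (V - W) \<union> (V - W) \<times> W" and p: "set (vwalk_arcs p) \<subseteq> E" "p \<noteq> []" "hd p \<in> W"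
  shows "i < length p \<Longrightarrow> p ! i \<in> W \<longleftrightarrow> even i"
proof (induction i)
  case 0 then show ?case using p by (simp add: hd_conv_nth)
next
  case (Suc i)
  then have "(p ! i, p ! Suc i) \<in> E" using p by (auto simp: set_vwalk_arcs)
  then have "p ! i \<in> W \<longleftrightarrow> p ! Suc i \<notin> W" using bip by auto
  then show ?case using Suc by auto
qed

text \<open>A neighbour y of the end other than its predecessor and the private leaves leads to a
  further cover vertex b, and p could be prolonged by y and b, which are new since the tree has no
  cycle. Maximality among the paths with the same start that contain p is a form that holds for p
  and for its reversal alike.\<close>

lemma longest_path_end:
  assumes T: "subdivided_tree V E W" and p: "set (vwalk_arcs p) \<subseteq> E" "distinct p" "set p \<subseteq> V" "2 \<le> length p" "last p \<in> W"
    and longest: "\<And>p'. set (vwalk_arcs p') \<subseteq> E \<Longrightarrow> distinct p' \<Longrightarrow> set p' \<subseteq> V \<Longrightarrow> hd p' = hd p \<Longrightarrow>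
      last p' \<in> W \<Longrightarrow> set p \<subseteq> set p' \<Longrightarrow> length p' \<le> length p"
  shows "card (E `` {last p}) - 1 \<le> card (private_leaves E W (last p))"
proof -
  let ?a = "last p" and ?b = "p ! (length p - 2)"
  have C: "connected_graph V E" and bip: "E \<subseteq> W \<times> (V - W) \<union> (V - W) \<times> W" and B: "bridged E"
    using T by (auto simp: subdivided_tree_def)
  have G: "simple_graph V E" using C by (simp add: connected_graph_def)
  have ne: "p \<noteq> []" using p by auto
  have la: "?a = p ! (length p - 1)" using ne by (simp add: last_conv_nth)
  have "y = ?b" if y: "y \<in> E `` {?a}" "y \<notin> private_leaves E W ?a" for y
  proof (rule ccontr)
    assume yb: "y \<noteq> ?b"
    have ay: "(?a, y) \<in> E" "(y, ?a) \<in> E" using y simple_graph_symD[OF G] by auto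
    have yW: "y \<in> V - W" using ay(1) bip p(5) by auto
    have "E `` {y} \<noteq> {?a}" using y yW by (auto simp: private_leaves_def)
    then obtain b where b: "(y, b) \<in> E" "b \<noteq> ?a" using ay by auto
    have bW: "b \<in> W" "b \<in> V" using b bip yW simple_graph_in_verts[OF G b(1)] by auto
    \<comment> \<open>Deleting the edge from the end to y leaves p intact, so if y or b were on p,
      then y would still reach the end and the edge would not be a bridge.\<close>
    let ?E = "E - {(?a, y), (y, ?a)}"
    have "(p ! i, p ! Suc i) \<in> ?E" if i: "Suc i < length p" for i
    proof -
      have "(p ! i, p ! Suc i) \<in> E" using p(1) i by (auto simp: set_vwalk_arcs)
      moreover have "p ! i \<noteq> ?a" unfolding la using i p(2) by (simp add: nth_eq_iff_index_eq)
      moreover have "p ! i \<noteq> y \<or> p ! Suc i \<noteq> ?a"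
      proof (rule ccontr)
        assume "\<not> ?thesis"
        then have "Suc i = length p - 1" unfolding la using i p(2) by (simp add: nth_eq_iff_index_eq)
        then have "i = length p - 2" by simp
        with \<open>\<not> ?thesis\<close> yb show False by simp
      qed
      ultimately show ?thesis by auto
    qed
    then have arcs: "set (vwalk_arcs p) \<subseteq> ?E" by (auto simp: set_vwalk_arcs)
    have "(y, ?a) \<notin> ?E\<^sup>*"
    proof
      assume "(y, ?a) \<in> ?E\<^sup>*"
      moreover have "sym ?E" using simple_graph_delete[OF G] by (simp add: simple_graph_def)
      ultimately have "(?a, y) \<in> ?E\<^sup>*" by (metis rtrancl_symmetric)
      then show False using B ay by (auto simp: bridged_def)
    qed
    then have nyp: "y \<notin> set p" using vwalk_rtrancl_last[OF arcs] by blast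
    have "(y, b) \<in> ?E" using b bW yW p(5) by auto
    then have nbp: "b \<notin> set p"
      using \<open>(y, ?a) \<notin> ?E\<^sup>*\<close> vwalk_rtrancl_last[OF arcs, of b] by (meson converse_rtrancl_into_rtrancl)
    let ?p = "p @ [y, b]"
    have "length ?p \<le> length p"
    proof (rule longest)
      show "set (vwalk_arcs ?p) \<subseteq> E" using vwalk_arcs_append[OF ne, of "[y, b]"] p(1) ay b by auto
      show "distinct ?p" using p(2) nyp nbp bW yW by auto
      show "set ?p \<subseteq> V" using p(3) bW yW by auto
      show "hd ?p = hd p" using ne by simp
      show "last ?p \<in> W" using bW by simp
    qed auto
    then show False by simp
  qed
  then have "E `` {?a} \<subseteq> insert ?b (private_leaves E W ?a)" by blast
  moreover have "finite (private_leaves E W ?a)"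
    by (rule finite_subset[OF _ simple_graph_finite_nbrs[OF G, of ?a]]) (auto simp: private_leaves_def)
  ultimately have "card (E `` {?a}) \<le> card (insert ?b (private_leaves E W ?a))" by (intro card_mono) auto
  also have "\<dots> \<le> card (private_leaves E W ?a) + 1" by (simp add: card_insert_if \<open>finite (private_leaves E W ?a)\<close>)
  finally show ?thesis by simp
qed

text \<open>Otherwise w together with its leaves would be a whole component.\<close>

lemma nonprivate_nbr:
  assumes C: "connected_graph V E" and w: "w \<in> W" "w' \<in> W" "w \<noteq> w'" "W \<subseteq> V"
  shows "E `` {w} - private_leaves E W w \<noteq> {}"
proof
  assume A: "E `` {w} - private_leaves E W w = {}"
  have "(w, w') \<in> E\<^sup>*" using C w by (auto simp: connected_graph_def)
  then have "w' = w \<or> w' \<in> private_leaves E W w"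
  proof (induction rule: rtrancl_induct)
    case (step y z)
    then show ?case using A by (auto simp: private_leaves_def)
  qed simp
  then show False using w by (auto simp: private_leaves_def)
qed

text \<open>Control vertices have degree at least three and hence lie in \<open>W\<close>, so
  control paths alternate, with \<open>W\<close> at the even positions. Conversely, a longest path
  through w with both ends in \<open>W\<close> is a control path, because each of its ends has at
  most one neighbour that is not a private leaf.\<close>

lemma even_vertices_subdivided_tree:
  assumes T: "subdivided_tree V E W" and k: "2 \<le> card W" and deg: "\<And>w. w \<in> W \<Longrightarrow> 3 \<le> card (E `` {w})"
  shows "even_vertices (with_proj \<lparr>pverts = V, parcs = E\<rparr>) = W"
proof -
  let ?T = "with_proj \<lparr>pverts = V, parcs = E\<rparr>"
  have C: "connected_graph V E" and WV: "W \<subseteq> V" and bip: "E \<subseteq> W \<times> (V - W) \<union> (V - W) \<times> W"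
    and deg2: "\<And>s. s \<in> V - W \<Longrightarrow> card (E `` {s}) \<le> 2"
    using T by (auto simp: subdivided_tree_def)
  have G: "simple_graph V E" and fin: "finite V" using C by (auto simp: connected_graph_def simple_graph_def)
  obtain u v where uv: "u \<in> W" "v \<in> W" "u \<noteq> v"
    using k by (metis card_le_Suc0_iff_eq card.infinite not_less_eq_eq numeral_2_eq_2 zero_le)
  have notP: "\<not> is_path_graph ?T" using not_path_graph[OF deg[OF uv(1)]] .
  have notD: "\<not> is_D_graph ?T" using not_D_graph[OF deg[OF uv(1)] deg[OF uv(2)] uv(3)] .
  have ctrlW: "control_vertices ?T \<subseteq> W"
    using deg2 notP notD by (fastforce simp: control_vertices_def out_degree_eq)
  have leaf: "leaf_set ?T \<inter> W = {}"
    using notP deg by (fastforce simp: leaf_set_def out_degree_eq)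
  have vp: "vpath p ?T \<longleftrightarrow> set p \<subseteq> V \<and> set (vwalk_arcs p) \<subseteq> E \<and> p \<noteq> [] \<and> distinct p" for p
    by (auto simp: vpath_def vwalk_def)
  show ?thesis
  proof (intro subset_antisym subsetI)
    fix x assume "x \<in> even_vertices ?T"
    then obtain p i where p: "control_path ?T p" "i < length p" "even i" "x = p ! i"
      by (auto simp: even_vertices_def)
    then have "set (vwalk_arcs p) \<subseteq> E" "p \<noteq> []" "hd p \<in> W"
      using ctrlW vp by (auto simp: control_path_def)
    from alternating_walk[OF bip this p(2)] p(3,4) show "x \<in> W" by simp
  next
    fix w assume w: "w \<in> W"
    define P where "P p \<longleftrightarrow> set (vwalk_arcs p) \<subseteq> E \<and> distinct p \<and> set p \<subseteq> V \<and> p \<noteq> [] \<and> hd p \<in> W \<and> last p \<in> W \<and> w \<in> set p" for p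
    have P1: "P [w]" using w WV by (auto simp: P_def)
    have P2: "\<forall>p. P p \<longrightarrow> length p < Suc (card V)"
    proof (intro allI impI)
      fix p assume "P p"
      then have "length p = card (set p)" by (simp add: P_def distinct_card)
      also have "\<dots> \<le> card V" using \<open>P p\<close> fin by (intro card_mono) (auto simp: P_def)
      finally show "length p < Suc (card V)" by simp
    qed
    obtain p where p: "P p" and max: "\<And>p'. P p' \<Longrightarrow> length p' \<le> length p"
      using ex_has_greatest_nat[where P = P and f = length, OF P1 P2] by metis
    \<comment> \<open>Two distinct ends are needed: a control path with equal ends is allowed only
      if there is a single control vertex.\<close>
    have len: "2 \<le> length p"
    proof -
      obtain w' where w': "w' \<in> W" "w' \<noteq> w" using uv by metis
      then obtain y where y: "(w, y) \<in> E" "y \<notin> private_leaves E W w"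
        using nonprivate_nbr[OF C w w'(1) _ WV] by auto
      then have yW: "y \<in> V - W" using bip w by auto
      have "E `` {y} \<noteq> {w}" using y yW by (auto simp: private_leaves_def)
      moreover have "(y, w) \<in> E" by (rule simple_graph_symD[OF G y(1)])
      ultimately obtain b where b: "(y, b) \<in> E" "b \<noteq> w" by auto
      then have "b \<in> W" using bip yW by auto
      then have "P [w, y, b]" using w y b yW WV by (auto simp: P_def)
      from max[OF this] show ?thesis by simp
    qed
    have rev: "set (vwalk_arcs (rev p')) \<subseteq> E" if "set (vwalk_arcs p') \<subseteq> E" for p'
    proof -
      have "(rev p' ! i, rev p' ! Suc i) \<in> E" if i: "Suc i < length p'" for i
      proof -
        let ?j = "length p' - Suc (Suc i)"
        have "Suc ?j < length p'" using i by simp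
        then have "(p' ! ?j, p' ! Suc ?j) \<in> E"
          using \<open>set (vwalk_arcs p') \<subseteq> E\<close> unfolding set_vwalk_arcs by blast
        moreover have "Suc ?j = length p' - Suc i" using i by simp
        ultimately show ?thesis using i simple_graph_symD[OF G] by (simp add: rev_nth)
      qed
      then show ?thesis by (auto simp: set_vwalk_arcs)
    qed
    have last: "card (E `` {last p}) - 1 \<le> card (private_leaves E W (last p))"
    proof (rule longest_path_end[OF T])
      fix p' assume p': "set (vwalk_arcs p') \<subseteq> E" "distinct p'" "set p' \<subseteq> V" "hd p' = hd p" "last p' \<in> W" "set p \<subseteq> set p'"
      have "P p'" using p p' by (auto simp: P_def)
      then show "length p' \<le> length p" by (rule max)
    qed (use p len in \<open>auto simp: P_def\<close>)
    have "card (E `` {last (rev p)}) - 1 \<le> card (private_leaves E W (last (rev p)))"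
    proof (rule longest_path_end[OF T])
      fix p' assume p': "set (vwalk_arcs p') \<subseteq> E" "distinct p'" "set p' \<subseteq> V" "hd p' = hd (rev p)" "last p' \<in> W" "set (rev p) \<subseteq> set p'"
      have "P p'" using p p' by (auto simp: P_def hd_rev)
      then show "length p' \<le> length (rev p)" using max by simp
    qed (use p len rev in \<open>auto simp: P_def last_rev\<close>)
    then have first: "card (E `` {hd p}) - 1 \<le> card (private_leaves E W (hd p))"
      using p by (simp add: P_def last_rev)
    have ends: "hd p \<in> W" "last p \<in> W" using p by (auto simp: P_def)
    have ctrl: "hd p \<in> control_vertices ?T" "last p \<in> control_vertices ?T"
      using control_vertexI[OF G _ deg first notP notD] control_vertexI[OF G _ deg last notP notD] ends WV by auto
    have "hd p \<noteq> last p"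
      using p len by (auto simp: P_def hd_conv_nth last_conv_nth nth_eq_iff_index_eq)
    then have cp: "control_path ?T p" using p ctrl vp by (auto simp: control_path_def P_def)
    obtain i where i: "i < length p" "w = p ! i" using p by (metis P_def in_set_conv_nth)
    have "even i" using alternating_walk[OF bip _ _ _ i(1)] p w i(2) by (auto simp: P_def)
    then show "w \<in> even_vertices ?T"
      using cp i w leaf WV by (auto simp: even_vertices_def)
  qed
qed

section \<open>Minimizer graphs\<close>

lemma pair_graph_iff: "pair_graph G \<longleftrightarrow> simple_graph (pverts G) (parcs G)"
proof
  assume "pair_graph G"
  then interpret pair_graph G .
  show "simple_graph (pverts G) (parcs G)"
    unfolding simple_graph_def
  proof (intro conjI)
    show "finite (pverts G)" by (rule pair_finite_verts)
    show "parcs G \<subseteq> pverts G \<times> pverts G" using in_arcsD1 in_arcsD2 by auto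
    show "sym (parcs G)" using pair_sym_arcs by (simp add: symmetric_def)
    show "irrefl (parcs G)" using pair_no_loops by (force simp: irrefl_def)
  qed
next
  assume G: "simple_graph (pverts G) (parcs G)"
  have "finite (parcs G)"
    by (rule finite_subset[of _ "pverts G \<times> pverts G"]) (use G in \<open>auto simp: simple_graph_def\<close>)
  then show "pair_graph G"
    using G by unfold_locales (auto simp: simple_graph_def irrefl_def symmetric_def)
qed

lemma rtrancl_on_iff:
  assumes "E \<subseteq> V \<times> V" "u \<in> V"
  shows "(u, v) \<in> rtrancl_on V E \<longleftrightarrow> (u, v) \<in> E\<^sup>*"
proof
  show "(u, v) \<in> rtrancl_on V E \<Longrightarrow> (u, v) \<in> E\<^sup>*"
    by (induction rule: rtrancl_on_induct) (auto intro: rtrancl_into_rtrancl)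
  show "(u, v) \<in> E\<^sup>* \<Longrightarrow> (u, v) \<in> rtrancl_on V E"
    by (induction rule: rtrancl_induct) (use assms in \<open>auto intro: rtrancl_on_into_rtrancl_on\<close>)
qed

lemma connected_iff:
  assumes "simple_graph V E"
  shows "Digraph_Component.connected (with_proj \<lparr>pverts = V, parcs = E\<rparr>) \<longleftrightarrow> connected_graph V E"
proof -
  have "parcs (mk_symmetric (with_proj \<lparr>pverts = V, parcs = E\<rparr>)) = E"
    using simple_graph_symD[OF assms] by (auto simp: parcs_mk_symmetric)
  then show ?thesis
    using assms rtrancl_on_iff[of E V]
    by (auto simp: Digraph_Component.connected_def strongly_connected_def reachable_def
        connected_graph_def simple_graph_def)
qed

lemma conn_graphs_k_iff:
  assumes "2 \<le> n" "k \<le> n"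
  shows "\<lparr>pverts = V, parcs = E\<rparr> \<in> conn_graphs_k k n (n - k) \<longleftrightarrow>
    connected_graph V E \<and> card V = n \<and> independence_number \<lparr>pverts = V, parcs = E\<rparr> = n - k"
  using assms connected_iff[of V E]
  by (auto simp: conn_graphs_k_def conn_graphs_def pair_graph_iff connected_graph_def)

text \<open>The cover is the complement of a maximum independent set.\<close>

lemma conn_graphs_k_cover:
  assumes nk: "2 \<le> n" "k \<le> n" and G: "\<lparr>pverts = V, parcs = E\<rparr> \<in> conn_graphs_k k n (n - k)"
  obtains W where "W \<subseteq> V" "card W = k" "E \<in> covered_graphs V W"
proof -
  have C: "connected_graph V E" and V: "card V = n"
    and ind: "independence_number \<lparr>pverts = V, parcs = E\<rparr> = n - k"
    using G conn_graphs_k_iff[OF nk, of V E] by auto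
  have fin: "finite V" using C by (simp add: connected_graph_def simple_graph_def)
  let ?I = "{S. independent_set \<lparr>pverts = V, parcs = E\<rparr> S}"
  have "?I \<subseteq> Pow V" by (auto simp: independent_set_def)
  then have "finite ?I" using fin by (auto intro: finite_subset)
  moreover have "{} \<in> ?I" by (simp add: independent_set_def)
  ultimately have "n - k \<in> card ` ?I" unfolding ind[symmetric] independence_number_def
    by (intro Max_in) auto
  then obtain S where S: "S \<subseteq> V" "card S = n - k" "\<And>u v. u \<in> S \<Longrightarrow> v \<in> S \<Longrightarrow> (u, v) \<notin> E"
    by (auto simp: independent_set_def)
  show ?thesis
  proof (rule that)
    show "V - S \<subseteq> V" by blast
    show "card (V - S) = k" using S V fin nk by (simp add: card_Diff_subset finite_subset)
    show "E \<in> covered_graphs V (V - S)"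
      using C S(3) simple_graph_in_verts[of V E] by (auto simp: covered_graphs_def connected_graph_def)
  qed
qed

lemma conn_graphs_k_matchedI:
  assumes nk: "2 \<le> n" "k \<le> n" and E: "E \<in> covered_graphs V W" and W: "W \<subseteq> V" "card W = k" "card V = n"
    and m: "matched V E W"
  shows "\<lparr>pverts = V, parcs = E\<rparr> \<in> conn_graphs_k k n (n - k)"
proof -
  have C: "connected_graph V E" and cov: "\<And>u v. (u, v) \<in> E \<Longrightarrow> u \<in> W \<or> v \<in> W"
    using E by (auto simp: covered_graphs_def)
  have G: "simple_graph V E" using C by (simp add: connected_graph_def)
  show ?thesis unfolding conn_graphs_k_iff[OF nk]
    using C W independence_number_matched[OF G W(1) cov m] by simp
qed

text \<open>An isomorphism also relabels arcs, tails and heads. Since the arcs of H are pairs with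
  the usual projections, the arc map is forced to act as the vertex map on both components;
  inverting it writes T as an image of H.\<close>

lemma graph_isoD:
  assumes "T \<simeq>\<^sub>G H"
  obtains f where "inj_on f (pverts H)" "T = \<lparr>pverts = f ` pverts H, parcs = image_rel f (parcs H)\<rparr>"
proof -
  from assms obtain hom where hom: "pre_digraph.digraph_isomorphism (with_proj T) hom"
    and H: "with_proj H = app_iso hom (with_proj T)"
    by (auto simp: graph_iso_def digraph_iso_def)
  define g where "g = iso_verts hom"
  have wf: "wf_digraph (with_proj T)" and inj: "inj_on g (pverts T)"
    and arcs: "\<And>a. a \<in> parcs T \<Longrightarrow> g (fst a) = iso_tail hom (iso_arcs hom a) \<and> g (snd a) = iso_head hom (iso_arcs hom a)"
    using hom by (auto simp: pre_digraph.digraph_isomorphism_def g_def)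
  have V: "pverts H = g ` pverts T" using arg_cong[OF H, of verts] by (simp add: g_def)
  have th: "iso_tail hom = fst" "iso_head hom = snd"
    using arg_cong[OF H, of tail] arg_cong[OF H, of head] by simp_all
  have "iso_arcs hom a = map_prod g g a" if "a \<in> parcs T" for a
    using arcs[OF that] th by (simp add: prod_eq_iff)
  then have "iso_arcs hom ` parcs T = image_rel g (parcs T)" by (intro image_cong) auto
  then have E: "parcs H = image_rel g (parcs T)" using arg_cong[OF H, of arcs] by simp
  let ?f = "the_inv_into (pverts T) g"
  have inv: "?f (g v) = v" if "v \<in> pverts T" for v using inj that by (rule the_inv_into_f_f)
  have sub: "parcs T \<subseteq> pverts T \<times> pverts T"
    using wf_digraph.tail_in_verts[OF wf] wf_digraph.head_in_verts[OF wf] by fastforce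
  show ?thesis
  proof (rule that)
    show "inj_on ?f (pverts H)" unfolding V using inj by (rule inj_on_the_inv_into)
    have "?f ` pverts H = pverts T" unfolding V using inv by (force simp: image_image)
    moreover have "image_rel ?f (parcs H) = id ` parcs T"
      unfolding E image_image by (rule image_cong) (use sub inv in auto)
    ultimately show "T = \<lparr>pverts = ?f ` pverts H, parcs = image_rel ?f (parcs H)\<rparr>" by simp
  qed
qed

lemma graph_isoI:
  assumes H: "simple_graph (pverts H) (parcs H)" and f: "inj_on f (pverts H)"
    and T: "T = \<lparr>pverts = f ` pverts H, parcs = image_rel f (parcs H)\<rparr>"
  shows "T \<simeq>\<^sub>G H"
proof -
  let ?g = "the_inv_into (pverts H) f"
  have inv: "?g (f v) = v" if "v \<in> pverts H" for v using f that by (rule the_inv_into_f_f)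
  have sub: "parcs H \<subseteq> pverts H \<times> pverts H" using H by (simp add: simple_graph_def)
  have gi: "inj_on ?g (pverts T)" unfolding T using f by (simp add: inj_on_the_inv_into)
  have subT: "parcs T \<subseteq> pverts T \<times> pverts T" using sub by (auto simp: T)
  have wf: "wf_digraph (with_proj T)" by unfold_locales (use subT in auto)
  define hom where "hom = \<lparr>iso_verts = ?g, iso_arcs = map_prod ?g ?g, iso_head = snd, iso_tail = fst\<rparr>"
  have "inj_on (map_prod ?g ?g) (parcs T)"
    using map_prod_inj_on[OF gi gi] subT by (rule inj_on_subset)
  then have "pre_digraph.digraph_isomorphism (with_proj T) hom"
    using wf gi by (simp add: pre_digraph.digraph_isomorphism_def hom_def)
  moreover have "with_proj H = app_iso hom (with_proj T)"
  proof -
    have "?g ` pverts T = pverts H" unfolding T using inv by (force simp: image_image)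
    moreover have "image_rel ?g (parcs T) = id ` parcs H"
      unfolding T pair_pre_digraph.simps image_image by (rule image_cong) (use sub inv in auto)
    ultimately show ?thesis by (simp add: app_iso_def hom_def with_proj_def)
  qed
  ultimately show ?thesis unfolding graph_iso_def digraph_iso_def by blast
qed

lemma pair_pre_digraph_cases: obtains V E where "(G :: 'a pair_pre_digraph) = \<lparr>pverts = V, parcs = E\<rparr>"
  by (cases G) simp

section \<open>Trees below the caterpillar bound\<close>

context large_order
begin

lemma n2: "2 \<le> n" "k \<le> n" using n_ge k2 by auto

text \<open>What is kept of minimality. Unlike minimality it refers to a single graph, and it
  already yields the degree bounds, the matching and the even vertices.\<close>

definition near_optimal :: "'a set \<Rightarrow> 'a rel \<Rightarrow> 'a set \<Rightarrow> bool" where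
  "near_optimal V E W \<longleftrightarrow> subdivided_tree V E W \<and> card V = n \<and> card W = k \<and>
     (rho V E)\<^sup>2 < q + min 3 (k - 1)"

lemma near_optimal_degrees:
  assumes "near_optimal V E W" "w \<in> W"
  shows "card (E `` {w}) \<le> q + min 2 (k - 2)" "3 \<le> card (E `` {w})" "q + r \<le> card (E `` {w}) + 2 * k"
proof -
  have C: "connected_graph V E" and WV: "W \<subseteq> V" and bip: "E \<subseteq> W \<times> (V - W) \<union> (V - W) \<times> W"
    and V: "card V = n" "card W = k" and b: "(rho V E)\<^sup>2 < q + min 3 (k - 1)"
    using assms by (auto simp: near_optimal_def subdivided_tree_def)
  have fin: "finite W" using V k2 by (intro card_ge_0_finite) simp
  have E: "E \<in> covered_graphs V W" using C bip by (auto simp: covered_graphs_def)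
  have up: "card (E `` {v}) \<le> q + min 2 (k - 2)" if "v \<in> W" for v
    using degree_upper_bound[OF C b] that WV by auto
  then show "card (E `` {w}) \<le> q + min 2 (k - 2)" using assms by simp
  have sum: "n - 1 \<le> (\<Sum>w\<in>W. card (E `` {w}))" using sum_degree_cover(1)[OF E WV] V by simp
  note low = degree_lower_bounds[where d = "\<lambda>w. card (E `` {w})", OF fin V(2) assms(2) up sum]
  show "3 \<le> card (E `` {w})" "q + r \<le> card (E `` {w}) + 2 * k" using low by auto
qed

lemma near_optimal_matched: "near_optimal V E W \<Longrightarrow> matched V E W"
  using near_optimal_degrees(1)[of V E W]
  by (intro subdivided_tree_matched) (simp_all only: near_optimal_def)

lemma near_optimal_in_class:
  assumes "near_optimal V E W"
  shows "\<lparr>pverts = V, parcs = E\<rparr> \<in> conn_graphs_k k n (n - k)"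
  using assms near_optimal_matched[OF assms]
  by (intro conn_graphs_k_matchedI[of n k E V W] n2)
    (auto simp: near_optimal_def subdivided_tree_def covered_graphs_def)

lemma rho_pos: assumes "near_optimal V E W" shows "0 < rho V E"
proof -
  have C: "connected_graph V E" and WV: "W \<subseteq> V" and "card W = k"
    using assms by (auto simp: near_optimal_def subdivided_tree_def)
  then obtain w where w: "w \<in> W" using k2 by fastforce
  have "3 \<le> real (card (E `` {w}))" using near_optimal_degrees(2)[OF assms w] by simp
  also have "\<dots> \<le> (rho V E)\<^sup>2" using degree_le_rho_square[OF C] w WV by auto
  finally have "rho V E \<noteq> 0" by auto
  then show ?thesis using rho_nonneg[OF C] by simp
qed

text \<open>Minimizing over the cover given by a maximum independent set produces \<open>E'\<close>.
  If E is no worse, it is itself minimal for that cover and so has the same shape.\<close>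

lemma near_optimal_below:
  assumes G: "\<lparr>pverts = V, parcs = E\<rparr> \<in> conn_graphs_k k n (n - k)"
  obtains E' W where "near_optimal V E' W" "rho V E' \<le> rho V E"
    "rho V E \<le> rho V E' \<Longrightarrow> near_optimal V E W"
proof -
  obtain W where W: "W \<subseteq> V" "card W = k" and E: "E \<in> covered_graphs V W"
    using conn_graphs_k_cover[OF n2 G] .
  have V: "card V = n" "finite V"
    using G conn_graphs_k_iff[OF n2, of V E] by (auto simp: connected_graph_def simple_graph_def)
  obtain E' where E': "E' \<in> covered_graphs V W" and min: "\<And>F. F \<in> covered_graphs V W \<Longrightarrow> rho V E' \<le> rho V F"
    and b: "(rho V E')\<^sup>2 < q + min 3 (k - 1)"
    using minimal_covered_exists[OF V(2,1) W] by blast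
  show ?thesis
  proof (rule that)
    show "near_optimal V E' W" using minimal_covered_is_subdivided_tree[OF V(1) W E' min b] V W b
      by (simp add: near_optimal_def)
    show le: "rho V E' \<le> rho V E" by (rule min[OF E])
    assume "rho V E \<le> rho V E'"
    with le have eq: "rho V E = rho V E'" by simp
    show "near_optimal V E W"
      using minimal_covered_is_subdivided_tree[OF V(1) W E] min b V W by (simp add: near_optimal_def eq)
  qed
qed

text \<open>The graph \<open>E'\<close> found below a minimizer is again in the class, so it cannot
  be strictly below.\<close>

lemma minimizer_near_optimal:
  fixes V :: "'a set"
  assumes "minimizer_graph k n (n - k) \<lparr>pverts = V, parcs = E\<rparr>"
  obtains W where "near_optimal V E W"
proof -
  have G: "\<lparr>pverts = V, parcs = E\<rparr> \<in> conn_graphs_k k n (n - k)"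
    and min: "\<And>H :: 'a pair_pre_digraph. H \<in> conn_graphs_k k n (n - k) \<Longrightarrow> rho V E \<le> graph_spectral_radius H"
    using assms by (auto simp: minimizer_graph_def)
  obtain E' W where "near_optimal V E' W" "rho V E \<le> rho V E' \<Longrightarrow> near_optimal V E W"
    using near_optimal_below[OF G] by blast
  then show ?thesis using min[OF near_optimal_in_class] that by blast
qed

lemma near_optimal_even_vertices:
  assumes "near_optimal V E W"
  shows "even_vertices (with_proj \<lparr>pverts = V, parcs = E\<rparr>) = W"
  using assms near_optimal_degrees(2)[OF assms] k2
  by (intro even_vertices_subdivided_tree) (auto simp: near_optimal_def)

lemma near_optimal_attach:
  assumes N: "near_optimal V E W" and f: "inj_on f (attach_verts V l W)"
  defines "T \<equiv> \<lparr>pverts = f ` attach_verts V l W, parcs = image_rel f (attach_edges E l W)\<rparr>"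
  shows "T \<in> conn_graphs_k k (n + k * l) (n + k * l - k)"
    and "graph_spectral_radius T = sqrt ((rho V E)\<^sup>2 + real l)"
proof -
  have C: "connected_graph V E" and WV: "W \<subseteq> V" and bip: "E \<subseteq> W \<times> (V - W) \<union> (V - W) \<times> W"
    and V: "card V = n" "card W = k"
    using N by (auto simp: near_optimal_def subdivided_tree_def)
  have fin: "finite V" "finite W" using C WV
    by (auto simp: connected_graph_def simple_graph_def intro: finite_subset)
  have E: "E \<in> covered_graphs V W" using C bip by (auto simp: covered_graphs_def)
  have sub: "Inl ` W \<subseteq> attach_verts V l W" using WV by auto
  note C' = attach_connected[OF C WV, of l]
  show "T \<in> conn_graphs_k k (n + k * l) (n + k * l - k)" unfolding T_def
  proof (rule conn_graphs_k_matchedI)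
    show "image_rel f (attach_edges E l W) \<in> covered_graphs (f ` attach_verts V l W) (f ` Inl ` W)"
      by (rule covered_graphs_image[OF attach_covered[OF E WV] f])
    show "f ` Inl ` W \<subseteq> f ` attach_verts V l W" using sub by (rule image_mono)
    show "card (f ` Inl ` W) = k"
      using card_image[OF inj_on_subset[OF f sub]] V by (simp add: card_image)
    show "card (f ` attach_verts V l W) = n + k * l"
      using card_image[OF f] card_attach_verts[OF fin, of l] V by simp
    show "matched (f ` attach_verts V l W) (image_rel f (attach_edges E l W)) (f ` Inl ` W)"
      by (rule matched_image[OF attach_matched[OF near_optimal_matched[OF N] WV] f sub])
  qed (use n2 in auto)
  have "rho (attach_verts V l W) (attach_edges E l W) = sqrt ((rho V E)\<^sup>2 + real l)"
    using rho_pos[OF N] by (intro rho_attach[OF C WV bip]) (auto intro: add_pos_nonneg)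
  then show "graph_spectral_radius T = sqrt ((rho V E)\<^sup>2 + real l)"
    unfolding T_def rho_image[OF C' f] .
qed

end

section \<open>The correspondence between the orders \<open>n0\<close> and \<open>n\<close>\<close>

locale shifted_order = large_order n k q r + base: large_order n0 k q0 r for n k q r n0 q0 +
  fixes l :: nat
  assumes q_shift: "q = q0 + l" and q0_eq: "q0 + r + 1 = 3 * k"
begin

lemma n_shift: "n = n0 + k * l"
  using nq base.nq q_shift by (simp add: algebra_simps)

lemma near_optimal_detach:
  assumes N: "near_optimal V E W"
  obtains V0 E0 f where "\<lparr>pverts = V0, parcs = E0\<rparr> \<in> conn_graphs_k k n0 (n0 - k)"
    "even_vertices (with_proj \<lparr>pverts = V0, parcs = E0\<rparr>) = W" "connected_graph V0 E0" "W \<subseteq> V0"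
    "inj_on f (attach_verts V0 l W)"
    "V = f ` attach_verts V0 l W" "E = image_rel f (attach_edges E0 l W)"
    "rho V E = sqrt ((rho V0 E0)\<^sup>2 + real l)"
proof -
  have T: "subdivided_tree V E W" and V: "card V = n" "card W = k" using N by (auto simp: near_optimal_def)
  have C: "connected_graph V E" and WV: "W \<subseteq> V" and bip: "E \<subseteq> W \<times> (V - W) \<union> (V - W) \<times> W"
    and B: "bridged E"
    using T by (auto simp: subdivided_tree_def)
  have E: "E \<in> covered_graphs V W" using C bip by (auto simp: covered_graphs_def)
  have G: "simple_graph V E" using C by (simp add: connected_graph_def)
  have many: "l \<le> card (private_leaves E W w)" if w: "w \<in> W" for w
  proof -
    have sub: "private_leaves E W w \<subseteq> E `` {w}" by (auto simp: private_leaves_def)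
    then have fin: "finite (private_leaves E W w)"
      using simple_graph_finite_nbrs[OF G] by (rule finite_subset)
    have "card (E `` {w}) - card (private_leaves E W w) \<le> k - 1"
      using card_shared_nbrs(1)[OF E B WV w] V card_Diff_subset[OF fin sub] by simp
    \<comment> \<open>The equality q0 + r + 1 = 3 k turns the degree bound q + r - 2 k into l + k -
      1, which leaves l private leaves besides the at most k - 1 other neighbours.\<close>
    moreover have "l + k - 1 \<le> card (E `` {w})"
      using near_optimal_degrees(3)[OF N w] q_shift q0_eq by linarith
    ultimately show ?thesis using k2 by linarith
  qed
  obtain V0 E0 f where T0: "subdivided_tree V0 E0 W" "V0 \<subseteq> V"
    and deg: "\<And>w. w \<in> W \<Longrightarrow> card (E0 `` {w}) + l = card (E `` {w})"
    and f: "inj_on f (attach_verts V0 l W)" "V = f ` attach_verts V0 l W" "E = image_rel f (attach_edges E0 l W)"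
    using detach_leaves[OF T many] by metis
  have C0: "connected_graph V0 E0" and W0: "W \<subseteq> V0" and bip0: "E0 \<subseteq> W \<times> (V0 - W) \<union> (V0 - W) \<times> W"
    using T0(1) by (auto simp: subdivided_tree_def)
  have fin: "finite V0" "finite W" using C0 W0
    by (auto simp: connected_graph_def simple_graph_def intro: finite_subset)
  have "n = card V0 + k * l"
    using card_image[OF f(1)] card_attach_verts[OF fin, of l] V f(2) by simp
  then have V0: "card V0 = n0" using n_shift by simp
  have E0: "E0 \<in> covered_graphs V0 W" using C0 bip0 by (auto simp: covered_graphs_def)
  \<comment> \<open>Losing l leaves at each cover vertex turns the degree cap for q into the one for
    q0, so the counts for order n0 apply.\<close>
  have up: "card (E0 `` {w}) \<le> q0 + min 2 (k - 2)" if "w \<in> W" for w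
    using deg[OF that] near_optimal_degrees(1)[OF N that] q_shift by linarith
  have sum: "n0 - 1 \<le> (\<Sum>w\<in>W. card (E0 `` {w}))" using sum_degree_cover(1)[OF E0 W0] V0 by simp
  have three: "3 \<le> card (E0 `` {w})" if "w \<in> W" for w
    using base.degree_lower_bounds(2)[where d = "\<lambda>w. card (E0 `` {w})", OF fin(2) V(2) that up sum] by simp
  have m: "matched V0 E0 W" by (rule base.subdivided_tree_matched[OF T0(1) V0 V(2) up])
  have cls: "\<lparr>pverts = V0, parcs = E0\<rparr> \<in> conn_graphs_k k n0 (n0 - k)"
    by (rule conn_graphs_k_matchedI[OF base.n2 E0 W0 V(2) V0 m])
  have ev: "even_vertices (with_proj \<lparr>pverts = V0, parcs = E0\<rparr>) = W"
    using even_vertices_subdivided_tree[OF T0(1) _ three] V k2 by simp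
  have pos: "rho V0 E0 > 0"
  proof -
    obtain w where w: "w \<in> W" using V k2 by fastforce
    have "3 \<le> real (card (E0 `` {w}))" using three[OF w] by simp
    also have "\<dots> \<le> (rho V0 E0)\<^sup>2" using degree_le_rho_square[OF C0] w W0 by auto
    finally have "rho V0 E0 \<noteq> 0" by auto
    then show ?thesis using rho_nonneg[OF C0] by simp
  qed
  have "rho V E = sqrt ((rho V0 E0)\<^sup>2 + real l)"
    unfolding f(2,3) rho_image[OF attach_connected[OF C0 W0] f(1)]
    using pos by (intro rho_attach[OF C0 W0 bip0]) (auto intro: add_pos_nonneg)
  from that[OF cls ev C0 W0 f this] show ?thesis .
qed

text \<open>A competitor of order n0 may be replaced by a near-optimal one. With l pendants attached
  it competes at order n, and since both squared radii grow by l, the inequality there carries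
  over.\<close>

lemma minimizer_detach:
  fixes T :: "nat pair_pre_digraph"
  assumes T: "minimizer_graph k n (n - k) T"
  shows "\<exists>T0 :: nat pair_pre_digraph. minimizer_graph k n0 (n0 - k) T0 \<and>
    T \<simeq>\<^sub>G attach_pendants T0 l (even_vertices (with_proj T0))"
proof -
  obtain V E where TVE: "T = \<lparr>pverts = V, parcs = E\<rparr>" by (rule pair_pre_digraph_cases)
  have min: "rho V E \<le> graph_spectral_radius H" if "H \<in> conn_graphs_k k n (n - k)" for H :: "nat pair_pre_digraph"
    using T that by (auto simp: minimizer_graph_def TVE)
  obtain W where N: "near_optimal V E W" using minimizer_near_optimal T unfolding TVE by metis
  obtain V0 E0 f where cls: "\<lparr>pverts = V0, parcs = E0\<rparr> \<in> conn_graphs_k k n0 (n0 - k)"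
    and ev: "even_vertices (with_proj \<lparr>pverts = V0, parcs = E0\<rparr>) = W" and C0: "connected_graph V0 E0" "W \<subseteq> V0"
    and f: "inj_on f (attach_verts V0 l W)" "V = f ` attach_verts V0 l W" "E = image_rel f (attach_edges E0 l W)"
    and rho: "rho V E = sqrt ((rho V0 E0)\<^sup>2 + real l)"
    by (rule near_optimal_detach[OF N])
  let ?T0 = "\<lparr>pverts = V0, parcs = E0\<rparr>"
  have "minimizer_graph k n0 (n0 - k) ?T0" unfolding minimizer_graph_def
  proof (intro conjI ballI cls)
    fix H :: "nat pair_pre_digraph" assume H: "H \<in> conn_graphs_k k n0 (n0 - k)"
    obtain V1 E1 where H1: "H = \<lparr>pverts = V1, parcs = E1\<rparr>" by (rule pair_pre_digraph_cases)
    obtain E2 W2 where N2: "base.near_optimal V1 E2 W2" "rho V1 E2 \<le> rho V1 E1"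
      using base.near_optimal_below H unfolding H1 by metis
    \<comment> \<open>Attaching produces vertices of a sum type; \<open>to_nat\<close> brings the
      competitor back to graphs on the naturals, where minimality is stated.\<close>
    have inj: "inj_on to_nat (attach_verts V1 l W2)" by (simp add: inj_on_def)
    have "rho V E \<le> sqrt ((rho V1 E2)\<^sup>2 + real l)"
      using min base.near_optimal_attach[OF N2(1) inj] unfolding n_shift[symmetric] by metis
    then have "(rho V0 E0)\<^sup>2 \<le> (rho V1 E2)\<^sup>2" unfolding rho by simp
    then have "rho V0 E0 \<le> rho V1 E2"
      by (rule power2_le_imp_le[OF _ less_imp_le[OF base.rho_pos[OF N2(1)]]])
    with N2(2) show "graph_spectral_radius ?T0 \<le> graph_spectral_radius H" by (simp add: H1)
  qed
  moreover have "T \<simeq>\<^sub>G attach_pendants ?T0 l (even_vertices (with_proj ?T0))"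
    unfolding ev attach_pendants_eq TVE
    by (rule graph_isoI[where f = f])
      (use attach_connected[OF C0, of l] f in \<open>auto simp: connected_graph_def\<close>)
  ultimately show ?thesis by blast
qed

text \<open>A competitor of order n is replaced by a near-optimal one, which after losing l leaves
  per cover vertex is measured against \<open>T0\<close>.\<close>

lemma minimizer_attach:
  fixes T T0 :: "nat pair_pre_digraph"
  assumes T0: "minimizer_graph k n0 (n0 - k) T0"
    and iso: "T \<simeq>\<^sub>G attach_pendants T0 l (even_vertices (with_proj T0))"
  shows "minimizer_graph k n (n - k) T"
    and "graph_spectral_radius T = sqrt ((graph_spectral_radius T0)\<^sup>2 + real l)"
proof -
  obtain V0 E0 where TVE: "T0 = \<lparr>pverts = V0, parcs = E0\<rparr>" by (rule pair_pre_digraph_cases)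
  obtain W where N: "base.near_optimal V0 E0 W" using base.minimizer_near_optimal T0 unfolding TVE by metis
  have ev: "even_vertices (with_proj T0) = W" unfolding TVE by (rule base.near_optimal_even_vertices[OF N])
  obtain f where f: "inj_on f (attach_verts V0 l W)"
    and T: "T = \<lparr>pverts = f ` attach_verts V0 l W, parcs = image_rel f (attach_edges E0 l W)\<rparr>"
    using graph_isoD[OF iso] unfolding ev by (auto simp: attach_pendants_eq TVE)
  note att = base.near_optimal_attach[OF N f, folded T, folded n_shift]
  show rho: "graph_spectral_radius T = sqrt ((graph_spectral_radius T0)\<^sup>2 + real l)"
    using att(2) by (simp add: TVE)
  show "minimizer_graph k n (n - k) T" unfolding minimizer_graph_def
  proof (intro conjI ballI att(1))
    fix H :: "nat pair_pre_digraph" assume H: "H \<in> conn_graphs_k k n (n - k)"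
    obtain V1 E1 where H1: "H = \<lparr>pverts = V1, parcs = E1\<rparr>" by (rule pair_pre_digraph_cases)
    obtain E2 W2 where N2: "near_optimal V1 E2 W2" "rho V1 E2 \<le> rho V1 E1"
      using near_optimal_below H unfolding H1 by metis
    obtain V3 E3 g where cls: "\<lparr>pverts = V3, parcs = E3\<rparr> \<in> conn_graphs_k k n0 (n0 - k)"
      and "even_vertices (with_proj \<lparr>pverts = V3, parcs = E3\<rparr>) = W2" "connected_graph V3 E3" "W2 \<subseteq> V3"
        "inj_on g (attach_verts V3 l W2)" "V1 = g ` attach_verts V3 l W2"
        "E2 = image_rel g (attach_edges E3 l W2)"
      and r3: "rho V1 E2 = sqrt ((rho V3 E3)\<^sup>2 + real l)"
      by (rule near_optimal_detach[OF N2(1)])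
    have "rho V0 E0 \<le> rho V3 E3" using T0 cls by (auto simp: minimizer_graph_def TVE)
    moreover have "rho V0 E0 \<ge> 0" using base.rho_pos[OF N] by simp
    ultimately have "(rho V0 E0)\<^sup>2 \<le> (rho V3 E3)\<^sup>2" by (rule power_mono)
    then have "graph_spectral_radius T \<le> rho V1 E2" unfolding rho r3 by (simp add: TVE)
    then show "graph_spectral_radius T \<le> graph_spectral_radius H" using N2(2) by (simp add: H1)
  qed
qed

end

section \<open>The case k = 1: single vertices and stars\<close>

lemma rho_single: "rho {v} {} = 0"
  by (rule rho_eqI[where x = "\<lambda>_. 1"])
    (auto simp: simple_graph_def irrefl_def sym_def positive_eigenvector_def nbr_sum_def)

text \<open>A one-vertex path has only one labelling, which determines the choice made by
  \<open>SOME\<close>; its vertex has degree 0 and so is not a leaf.\<close>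

lemma even_vertices_single: "even_vertices (with_proj \<lparr>pverts = {v}, parcs = {}\<rparr>) = {v}"
proof -
  let ?T = "with_proj \<lparr>pverts = {v}, parcs = {}\<rparr>"
  have unique: "vs = [v]" if "path_labelling ?T vs" for vs
  proof -
    have "distinct vs" "set vs = {v}" using that by (auto simp: path_labelling_def)
    then have "length vs = 1" using distinct_card[of vs] by simp
    then obtain u where "vs = [u]" by (cases vs) auto
    with \<open>set vs = {v}\<close> show ?thesis by simp
  qed
  have lab: "path_labelling ?T [v]" by (simp add: path_labelling_def)
  then have "is_path_graph ?T" by (auto simp: is_path_graph_def)
  moreover have "the_path_labelling ?T = [v]"
    unfolding the_path_labelling_def using lab unique by (rule some_equality)
  ultimately have ctrl: "control_vertices ?T = {v}" by (simp add: control_vertices_def)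
  have leaf: "leaf_set ?T = {}" by (simp add: leaf_set_def out_degree_eq)
  have "control_path ?T [v]" using ctrl by (simp add: control_path_def vpath_def vwalk_def)
  moreover have "x = v" if "x \<in> pverts \<lparr>pverts = {v}, parcs = {}\<rparr>" for x using that by simp
  ultimately show ?thesis using leaf unfolding even_vertices_def
    by (auto intro!: exI[of _ "[v]"])
qed

lemma minimizer_single_iff:
  "minimizer_graph 1 1 0 G \<longleftrightarrow> (\<exists>v. G = \<lparr>pverts = {v}, parcs = {}\<rparr>)"
proof -
  have cls: "G \<in> conn_graphs_k 1 1 0 \<longleftrightarrow> (\<exists>v. G = \<lparr>pverts = {v}, parcs = {}\<rparr>)" for G :: "'a pair_pre_digraph"
  proof
    assume "G \<in> conn_graphs_k 1 1 0"
    then have G: "simple_graph (pverts G) (parcs G)" and "card (pverts G) = 1"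
      by (auto simp: conn_graphs_k_def pair_graph_iff)
    then obtain v where v: "pverts G = {v}" by (auto simp: card_1_singleton_iff)
    have "parcs G = {}" using simple_graph_in_verts[OF G] v by auto
    with v show "\<exists>v. G = \<lparr>pverts = {v}, parcs = {}\<rparr>" by (intro exI[of _ v]) simp
  next
    assume "\<exists>v. G = \<lparr>pverts = {v}, parcs = {}\<rparr>"
    then show "G \<in> conn_graphs_k 1 1 0"
      by (auto simp: conn_graphs_k_def pair_graph_iff simple_graph_def irrefl_def sym_def)
  qed
  have zero: "graph_spectral_radius H = 0" if H: "H \<in> conn_graphs_k 1 1 0" for H :: "'a pair_pre_digraph"
  proof -
    obtain v where "H = \<lparr>pverts = {v}, parcs = {}\<rparr>" using H unfolding cls by blast
    then show ?thesis by (simp add: rho_single)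
  qed
  show ?thesis unfolding minimizer_graph_def cls[symmetric] using zero by (metis order_refl)
qed

lemma connected_single: "connected_graph {v} {}"
  by (auto simp: connected_graph_def simple_graph_def irrefl_def sym_def)

lemma star_graph:
  assumes l: "1 \<le> l" and f: "inj_on f (attach_verts {v} l {v})"
  defines "T \<equiv> \<lparr>pverts = f ` attach_verts {v} l {v}, parcs = image_rel f (attach_edges {} l {v})\<rparr>"
  shows "T \<in> conn_graphs_k 1 (l + 1) (l + 1 - 1)" "graph_spectral_radius T = sqrt (real l)"
proof -
  let ?V = "attach_verts {v} l {v}" and ?E = "attach_edges {} l {v}"
  have C: "connected_graph ?V ?E" by (rule attach_connected[OF connected_single]) simp
  have E: "?E \<in> covered_graphs ?V (Inl ` {v})"
    by (rule attach_covered) (auto simp: covered_graphs_def connected_single)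
  \<comment> \<open>The pendant with index 0 exists because l >= 1.\<close>
  have m: "matched ?V ?E (Inl ` {v})"
    unfolding matched_def using l by (intro exI[of _ "\<lambda>_. Inr (v, 0)"]) (auto simp: attach_edges_def)
  show "T \<in> conn_graphs_k 1 (l + 1) (l + 1 - 1)" unfolding T_def
  proof (rule conn_graphs_k_matchedI)
    show "image_rel f ?E \<in> covered_graphs (f ` ?V) (f ` Inl ` {v})" by (rule covered_graphs_image[OF E f])
    show "matched (f ` ?V) (image_rel f ?E) (f ` Inl ` {v})" by (rule matched_image[OF m f]) simp
    show "card (f ` ?V) = l + 1" using card_image[OF f] card_attach_verts[of "{v}" "{v}" l] by simp
  qed (use l in auto)
  have "rho ?V ?E = sqrt ((rho {v} {})\<^sup>2 + real l)"
    using l by (intro rho_attach[OF connected_single]) (auto simp: rho_single)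
  then show "graph_spectral_radius T = sqrt (real l)" unfolding T_def rho_image[OF C f] by (simp add: rho_single)
qed

text \<open>A cover by one vertex w leaves each other vertex only w as a neighbour.\<close>

lemma star_graph_unique:
  fixes v :: 'b
  assumes l: "1 \<le> l" and G: "\<lparr>pverts = V, parcs = E\<rparr> \<in> conn_graphs_k 1 (l + 1) (l + 1 - 1)"
  obtains f where "inj_on f (attach_verts {v} l {v})" "V = f ` attach_verts {v} l {v}"
    "E = image_rel f (attach_edges {} l {v})"
proof -
  have nk: "2 \<le> l + 1" "1 \<le> l + 1" using l by auto
  obtain W where W: "W \<subseteq> V" "card W = 1" "E \<in> covered_graphs V W" using conn_graphs_k_cover[OF nk G] .
  then obtain w where w: "W = {w}" by (auto simp: card_1_singleton_iff)
  have C: "connected_graph V E" and cov: "\<And>a b. (a, b) \<in> E \<Longrightarrow> a = w \<or> b = w"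
    using W(3) by (auto simp: covered_graphs_def w)
  have S: "simple_graph V E" and wV: "w \<in> V" using C W w by (auto simp: connected_graph_def)
  have V: "card V = l + 1" "finite V"
    using G S unfolding conn_graphs_k_iff[OF nk] simple_graph_def by blast+
  have sw: "(s, w) \<in> E" if s: "s \<in> V" "s \<noteq> w" for s
  proof -
    have "(s, w) \<in> E\<^sup>*" using C s wV by (auto simp: connected_graph_def)
    then obtain y where "(s, y) \<in> E" using s(2) by (meson converse_rtranclE)
    then show ?thesis using cov[of s y] s by auto
  qed
  have "card {..<l} = card (V - {w})" using V wV by simp
  then obtain h where h: "bij_betw h {..<l} (V - {w})"
    using finite_same_card_bij[of "{..<l}" "V - {w}"] V by auto
  have hV: "h i \<in> V" "h i \<noteq> w" if "i < l" for i using h that by (auto simp: bij_betw_def)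
  define f where "f y = (case y of Inl _ \<Rightarrow> w | Inr (_, i) \<Rightarrow> h i)" for y :: "'b + 'b \<times> nat"
  show ?thesis
  proof (rule that)
    have "h i = h j \<longleftrightarrow> i = j" if "i < l" "j < l" for i j
      using h that by (auto simp: bij_betw_def inj_on_def)
    then show "inj_on f (attach_verts {v} l {v})"
      using hV by (fastforce simp: inj_on_def f_def)
    have "f ` attach_verts {v} l {v} = insert w (h ` {..<l})"
      by (force simp: f_def image_Un image_image)
    then show "V = f ` attach_verts {v} l {v}" using h wV by (auto simp: bij_betw_def)
    show "E = image_rel f (attach_edges {} l {v})"
    proof (intro subset_antisym subsetI)
      fix e assume e: "e \<in> E"
      obtain a b where ab: "e = (a, b)" by fastforce
      have in_h: "\<exists>i<l. s = h i" if "s \<in> V" "s \<noteq> w" for s using h that by (auto simp: bij_betw_def)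
      have V': "a \<in> V" "b \<in> V" "a \<noteq> b" using simple_graph_in_verts[OF S] e ab by auto
      from cov[of a b] e ab consider "a = w" | "b = w" by auto
      then show "e \<in> image_rel f (attach_edges {} l {v})"
      proof cases
        case 1
        then obtain i where "i < l" "b = h i" using in_h[of b] V' by auto
        then show ?thesis using 1 ab
          by (intro image_eqI[of _ _ "(Inl v, Inr (v, i))"]) (auto simp: f_def attach_edges_def)
      next
        case 2
        then obtain i where "i < l" "a = h i" using in_h[of a] V' by auto
        then show ?thesis using 2 ab
          by (intro image_eqI[of _ _ "(Inr (v, i), Inl v)"]) (auto simp: f_def attach_edges_def)
      qed
    next
      fix e assume "e \<in> image_rel f (attach_edges {} l {v})"
      then show "e \<in> E" using hV sw simple_graph_symD[OF S] by (auto simp: f_def attach_edges_def)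
    qed
  qed
qed

text \<open>All graphs of the class are copies of one star, so each of them is a minimizer; likewise
  for the one-vertex graphs.\<close>

lemma minimizer_star:
  fixes T T0 :: "nat pair_pre_digraph"
  assumes l: "1 \<le> l"
  shows "minimizer_graph 1 (l + 1) (l + 1 - 1) T \<longleftrightarrow>
      (\<exists>T0 :: nat pair_pre_digraph. minimizer_graph 1 1 0 T0 \<and>
        T \<simeq>\<^sub>G attach_pendants T0 l (even_vertices (with_proj T0)))" (is "_ \<longleftrightarrow> ?R")
    and "minimizer_graph 1 1 0 T0 \<Longrightarrow> T \<simeq>\<^sub>G attach_pendants T0 l (even_vertices (with_proj T0)) \<Longrightarrow>
      graph_spectral_radius T = sqrt ((graph_spectral_radius T0)\<^sup>2 + real l)"
proof -
  have star: "T \<in> conn_graphs_k 1 (l + 1) (l + 1 - 1) \<and> graph_spectral_radius T = sqrt (real l) \<and>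
      graph_spectral_radius T0 = 0"
    if T0: "minimizer_graph 1 1 0 T0" and iso: "T \<simeq>\<^sub>G attach_pendants T0 l (even_vertices (with_proj T0))"
    for T0 :: "nat pair_pre_digraph"
  proof -
    obtain v where v: "T0 = \<lparr>pverts = {v}, parcs = {}\<rparr>" using T0 unfolding minimizer_single_iff by blast
    obtain f where f: "inj_on f (attach_verts {v} l {v})"
      and T: "T = \<lparr>pverts = f ` attach_verts {v} l {v}, parcs = image_rel f (attach_edges {} l {v})\<rparr>"
      using graph_isoD[OF iso] unfolding v even_vertices_single attach_pendants_eq by auto
    show ?thesis using star_graph[OF l f] by (simp add: T v rho_single)
  qed
  have all: "graph_spectral_radius H = sqrt (real l) \<and>
      (\<exists>f. inj_on f (attach_verts {0 :: nat} l {0}) \<and>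
        H = \<lparr>pverts = f ` attach_verts {0} l {0}, parcs = image_rel f (attach_edges {} l {0})\<rparr>)"
    if mem: "H \<in> conn_graphs_k 1 (l + 1) (l + 1 - 1)" for H :: "nat pair_pre_digraph"
  proof -
    obtain V E where H: "H = \<lparr>pverts = V, parcs = E\<rparr>" by (rule pair_pre_digraph_cases)
    obtain f where f: "inj_on f (attach_verts {0 :: nat} l {0})" "V = f ` attach_verts {0} l {0}"
      "E = image_rel f (attach_edges {} l {0})"
      by (rule star_graph_unique[OF l mem[unfolded H]])
    show ?thesis using star_graph(2)[OF l f(1)] f by (auto simp: H)
  qed
  show "minimizer_graph 1 (l + 1) (l + 1 - 1) T \<longleftrightarrow> ?R"
  proof
    assume "minimizer_graph 1 (l + 1) (l + 1 - 1) T"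
    then have "T \<in> conn_graphs_k 1 (l + 1) (l + 1 - 1)" by (simp only: minimizer_graph_def)
    then obtain f where f: "inj_on f (attach_verts {0 :: nat} l {0})"
      and T: "T = \<lparr>pverts = f ` attach_verts {0} l {0}, parcs = image_rel f (attach_edges {} l {0})\<rparr>"
      using all by blast
    have "connected_graph (attach_verts {0 :: nat} l {0}) (attach_edges {} l {0})"
      by (rule attach_connected[OF connected_single]) simp
    then have "T \<simeq>\<^sub>G attach_pendants \<lparr>pverts = {0 :: nat}, parcs = {}\<rparr> l
        (even_vertices (with_proj \<lparr>pverts = {0 :: nat}, parcs = {}\<rparr>))"
      unfolding even_vertices_single attach_pendants_eq
      by (intro graph_isoI[where f = f]) (use f T in \<open>auto simp: connected_graph_def\<close>)
    then show ?R using minimizer_single_iff by blast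
  next
    assume ?R
    then have "T \<in> conn_graphs_k 1 (l + 1) (l + 1 - 1)" "graph_spectral_radius T = sqrt (real l)"
      using star by blast+
    then show "minimizer_graph 1 (l + 1) (l + 1 - 1) T"
      unfolding minimizer_graph_def using all by simp
  qed
  show "graph_spectral_radius T = sqrt ((graph_spectral_radius T0)\<^sup>2 + real l)"
    if "minimizer_graph 1 1 0 T0" "T \<simeq>\<^sub>G attach_pendants T0 l (even_vertices (with_proj T0))"
    using star[OF that] by simp
qed

theorem theorem4p1:
  fixes n k \<alpha> r n0 l :: nat
    and T :: "nat pair_pre_digraph"
  assumes "pair_graph T"
    and "1 \<le> k" and "2 * k \<le> n"
    and "\<alpha> = n - k"
    and "r < k" and "[n + 1 = r] (mod k)"
    and "int n0 = 3 * (int k)\<^sup>2 - int k - 1 - (int k - 1) * int r"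
    and "n0 \<le> n"
    and "l = (n - n0) div k"
  shows "k dvd (n - n0) \<and>
    (minimizer_graph k n \<alpha> T \<longleftrightarrow>
       (\<exists>T0 :: nat pair_pre_digraph.
          minimizer_graph k n0 (n0 - k) T0 \<and>
          T \<simeq>\<^sub>G attach_pendants T0 l (even_vertices (with_proj T0)))) \<and>
    (\<forall>T0 :: nat pair_pre_digraph.
       minimizer_graph k n0 (n0 - k) T0 \<longrightarrow>
       T \<simeq>\<^sub>G attach_pendants T0 l (even_vertices (with_proj T0)) \<longrightarrow>
       graph_spectral_radius T = sqrt ((graph_spectral_radius T0)\<^sup>2 + real l))"
proof (cases "k = 1")
  case True
  \<comment> \<open>For k = 1 the only remainder is 0, so the seed is a single vertex and l = n -
    1.\<close>
  then have n0: "n0 = 1" using assms(5,7) by auto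
  then have l: "1 \<le> l" "n = l + 1" using assms(3,8,9) True by auto
  have eqs: "n0 - k = 0" "\<alpha> = l + 1 - 1" "n - n0 = l" using n0 l True assms(4) by simp_all
  show ?thesis
    unfolding eqs unfolding True n0 l(2)
    by (intro conjI allI impI one_dvd minimizer_star(1)[OF l(1)] minimizer_star(2)[OF l(1)])
next
  case False
  then have k2: "2 \<le> k" using assms(2) by simp
  \<comment> \<open>The quotient belonging to n0: the given formula for n0 is n0 + 1 = k q0 + r
    rewritten.\<close>
  define q0 where "q0 = 3 * k - 1 - r"
  have q0: "q0 + r + 1 = 3 * k" using assms(5) by (simp add: q0_def)
  have iq: "int q0 = 3 * int k - 1 - int r" using q0 by linarith
  have "int (k * q0 + r) = int k * (3 * int k - 1 - int r) + int r" by (simp add: iq)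
  also have "\<dots> = int (n0 + 1)" using assms(7) by (simp add: algebra_simps power2_eq_square)
  finally have "int (n0 + 1) = int (k * q0 + r)" by simp
  then have n0: "n0 + 1 = k * q0 + r" by (simp only: of_nat_eq_iff)
  have "(n0 + 1) mod k = r mod k" using n0 by simp
  then have "[n + 1 = n0 + 1] (mod k)" using assms(6) by (simp add: cong_def)
  then have "[n = n0] (mod k)" by (simp only: cong_add_rcancel_nat)
  then have dvd: "k dvd n - n0" using assms(8) by (simp add: cong_altdef_nat' nat_diff_distrib')
  then have n: "n = n0 + k * l" using assms(8,9) by simp
  interpret shifted_order n k "q0 + l" r n0 q0 l
    by unfold_locales (use k2 assms(5) n n0 q0 in \<open>auto simp: algebra_simps\<close>)
  show ?thesis unfolding assms(4)
  proof (intro conjI allI impI iffI dvd)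
    show "\<exists>T0 :: nat pair_pre_digraph. minimizer_graph k n0 (n0 - k) T0 \<and>
        T \<simeq>\<^sub>G attach_pendants T0 l (even_vertices (with_proj T0))" if "minimizer_graph k n (n - k) T"
      using that by (rule minimizer_detach)
    show "minimizer_graph k n (n - k) T" if "\<exists>T0 :: nat pair_pre_digraph. minimizer_graph k n0 (n0 - k) T0 \<and>
        T \<simeq>\<^sub>G attach_pendants T0 l (even_vertices (with_proj T0))"
      using that minimizer_attach(1) by (elim exE conjE)
  qed (rule minimizer_attach(2))
qed

end
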